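(* Let $k$ be a temperate weight function on $\mathbb{R}^d$, let $1\le r\le\infty$, and let $P\in\mathbb{C}[X_1,\dots,X_d,T]$. Then $N_{\mathcal{L}(\mathcal{D}(\mathbb{R}),B_{r,k}(\mathbb{R}^d))}(P)=\{0\}$ if and only if $P\neq 0$.
   Context: A temperate weight function is a positive function $k$ on $\mathbb{R}^d$ for which there are constants $C,N>0$ with $k(\boldsymbol{\xi}+\boldsymbol{\eta})\le(1+C\|\boldsymbol{\xi}\|_2)^Nk(\boldsymbol{\eta})$ for all $\boldsymbol{\xi},\boldsymbol{\eta}\in\mathbb{R}^d$. The Besov space $B_{r,k}(\mathbb{R}^d)$ is the Banach space of $u\in\mathcal{S}'(\mathbb{R}^d)$ whose Fourier transform $\widehat{u}$ (with $\widehat{\psi}(\boldsymbol{\xi})=\int\psi(\mathbf{x})e^{-i\langle\boldsymbol{\xi},\mathbf{x}\rangle}d\mathbf{x}$) is a function with $\|u\|_{r,k}=\left(\int_{\mathbb{R}^d}|k(\boldsymbol{\xi})\widehat{u}(\boldsymbol{\xi})|^r d\boldsymbol{\xi}\right)^{1/r}<\infty$ (ess sup of $|k\widehat{u}|$ if $r=\infty$). $\mathcal{L}(\mathcal{D}(\mathbb{R}),B_{r,k}(\mathbb{R}^d))$ is the space of continuous linear maps $\mathcal{D}(\mathbb{R})\to B_{r,k}(\mathbb{R}^d)$; each such $u$ is regarded as the distribution $U\in\mathcal{D}'(\mathbb{R}^{d+1})$ with $\langle U,\varphi\otimes\psi\rangle=\langle u(\varphi),\psi\rangle$ for $\varphi\in\mathcal{D}(\mathbb{R})$,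 $\psi\in\mathcal{D}(\mathbb{R}^d)$. Coordinates on $\mathbb{R}^{d+1}$ are $(\mathbf{x},t)$; $D_P=P\left(\frac{\partial}{\partial x_1},\dots,\frac{\partial}{\partial x_d},\frac{\partial}{\partial t}\right)$; for a subspace $S\subset\mathcal{D}'(\mathbb{R}^{d+1})$, $N_S(P)=\{u\in S: D_Pu=0,\ u|_{t<0}=0\}$, where $u|_{t<0}$ is the restriction to $\{t<0\}$. *)

theory Defs
  imports "HOL-Analysis.Analysis"
begin

fun dd :: "'a::euclidean_space list \<Rightarrow> ('a \<Rightarrow> complex) \<Rightarrow> 'a \<Rightarrow> complex" where
  "dd [] f = f"
| "dd (v # vs) f = (\<lambda>x. frechet_derivative (dd vs f) (at x) v)"

definition smooth_fun :: "('a::euclidean_space \<Rightarrow> complex) \<Rightarrow> bool" where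
  "smooth_fun f \<longleftrightarrow> (\<forall>vs. set vs \<subseteq> Basis \<longrightarrow> (\<forall>x. dd vs f differentiable (at x)))"

definition tsupp :: "('a::euclidean_space \<Rightarrow> complex) \<Rightarrow> 'a set" where
  "tsupp f = closure {x. f x \<noteq> 0}"

definition test_fun :: "('a::euclidean_space \<Rightarrow> complex) \<Rightarrow> bool" where
  "test_fun f \<longleftrightarrow> smooth_fun f \<and> compact (tsupp f)"

definition seminorm_m :: "nat \<Rightarrow> ('a::euclidean_space \<Rightarrow> complex) \<Rightarrow> real" where
  "seminorm_m m f = (SUP p \<in> {(vs, x). set vs \<subseteq> Basis \<and> length vs \<le> m}. norm (dd (fst p) f (snd p)))"

text \<open>Distributions on R^n: linear functionals on D(R^n) continuous in the
  inductive-limit topology, i.e. bounded on each D_K by a C^m seminorm.\<close>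
definition distribution :: "(('a::euclidean_space \<Rightarrow> complex) \<Rightarrow> complex) \<Rightarrow> bool" where
  "distribution T \<longleftrightarrow>
     (\<forall>a b f g. test_fun f \<and> test_fun g \<longrightarrow> T (\<lambda>x. a * f x + b * g x) = a * T f + b * T g) \<and>
     (\<forall>K. compact K \<longrightarrow> (\<exists>C m. \<forall>f. test_fun f \<and> tsupp f \<subseteq> K \<longrightarrow> norm (T f) \<le> C * seminorm_m m f))"

definition temperate_weight :: "(real^'d::finite \<Rightarrow> real) \<Rightarrow> bool" where
  "temperate_weight k \<longleftrightarrow> (\<forall>\<xi>. 0 < k \<xi>) \<and>
     (\<exists>C N. C > 0 \<and> N > 0 \<and> (\<forall>\<xi> \<eta>. k (\<xi> + \<eta>) \<le> (1 + C * norm \<xi>) powr N * k \<eta>))"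

text \<open>An element u of B_{r,k}(R^d) is represented by its Fourier transform
  \<open>f = \<hat>u\<close> (a measurable function, identified up to a.e. equality).
  besov_le k r f B  means  ||u||_{r,k} \<le> B.\<close>
definition besov_le :: "(real^'d::finite \<Rightarrow> real) \<Rightarrow> ereal \<Rightarrow> (real^'d \<Rightarrow> complex) \<Rightarrow> real \<Rightarrow> bool" where
  "besov_le k r f B \<longleftrightarrow> 0 \<le> B \<and>
     (if r = \<infinity> then (AE \<xi> in lborel. k \<xi> * cmod (f \<xi>) \<le> B)
      else (\<integral>\<^sup>+ \<xi>. ennreal ((k \<xi> * cmod (f \<xi>)) powr real_of_ereal r) \<partial>lborel)
              \<le> ennreal (B powr real_of_ereal r))"

definition in_besov :: "(real^'d::finite \<Rightarrow> real) \<Rightarrow> ereal \<Rightarrow> (real^'d \<Rightarrow> complex) \<Rightarrow> bool" where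
  "in_besov k r f \<longleftrightarrow> f \<in> borel_measurable lborel \<and> (\<exists>B. besov_le k r f B)"

text \<open>Pairing of u in B_{r,k} (given by f = \<hat>u) with a test function psi:
  \<open>\<langle>u,\<psi>\<rangle> = (2\<pi>)^{-d} \<integral> f(\<xi>) \<integral> \<psi>(x) e^{i\<langle>\<xi>,x\<rangle>} dx d\<xi>\<close> (Fourier inversion).\<close>
definition besov_pair :: "(real^'d::finite \<Rightarrow> complex) \<Rightarrow> (real^'d \<Rightarrow> complex) \<Rightarrow> complex" where
  "besov_pair f \<psi> = complex_of_real ((2 * pi) powr (- real CARD('d))) *
     (\<integral>\<xi>. f \<xi> * (\<integral>x. \<psi> x * cis (\<xi> \<bullet> x) \<partial>lborel) \<partial>lborel)"

definition LDB :: "(real^'d::finite \<Rightarrow> real) \<Rightarrow> ereal \<Rightarrow> ((real \<Rightarrow> complex) \<Rightarrow> (real^'d \<Rightarrow> complex)) \<Rightarrow> bool" where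
  "LDB k r u \<longleftrightarrow>
     (\<forall>\<phi>. test_fun \<phi> \<longrightarrow> in_besov k r (u \<phi>)) \<and>
     (\<forall>a b \<phi> \<theta>. test_fun \<phi> \<and> test_fun \<theta> \<longrightarrow>
         (AE \<xi> in lborel. u (\<lambda>t. a * \<phi> t + b * \<theta> t) \<xi> = a * u \<phi> \<xi> + b * u \<theta> \<xi>)) \<and>
     (\<forall>K. compact K \<longrightarrow> (\<exists>C m. \<forall>\<phi>. test_fun \<phi> \<and> tsupp \<phi> \<subseteq> K \<longrightarrow>
         besov_le k r (u \<phi>) (C * seminorm_m m \<phi>)))"

text \<open>A polynomial P in C[X_1..X_d,T] is given by its finitely supported coefficient
  function c: c (alpha, j) is the coefficient of X^alpha T^j.\<close>
definition poly_coeffs :: "(('d::finite \<Rightarrow> nat) \<times> nat \<Rightarrow> complex) \<Rightarrow> bool" where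
  "poly_coeffs c \<longleftrightarrow> finite {a. c a \<noteq> 0}"

definition xdir :: "'d::finite \<Rightarrow> (real^'d) \<times> real" where
  "xdir i = (axis i 1, 0)"

definition tdir :: "(real^'d::finite) \<times> real" where
  "tdir = (0, 1)"

text \<open>Partial derivative d_x^alpha d_t^j (order of partial derivatives is
  immaterial on smooth functions).\<close>
definition pder :: "('d::finite \<Rightarrow> nat) \<Rightarrow> nat \<Rightarrow> ((real^'d) \<times> real \<Rightarrow> complex) \<Rightarrow> (real^'d) \<times> real \<Rightarrow> complex" where
  "pder \<alpha> j \<theta> = dd (replicate j tdir)
      (Finite_Set.fold (\<lambda>i g. dd (replicate (\<alpha> i) (xdir i)) g) \<theta> UNIV)"

text \<open>Formal transpose P(-d): <D_P U, chi> = <U, P(-d) chi>.\<close>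
definition transp_op :: "(('d::finite \<Rightarrow> nat) \<times> nat \<Rightarrow> complex) \<Rightarrow> ((real^'d) \<times> real \<Rightarrow> complex) \<Rightarrow> (real^'d) \<times> real \<Rightarrow> complex" where
  "transp_op c \<theta> = (\<lambda>p. \<Sum>a\<in>{a. c a \<noteq> 0}. c a * (-1) ^ (sum (fst a) UNIV + snd a) * pder (fst a) (snd a) \<theta> p)"

text \<open>N_{L(D(R),B_{r,k}(R^d))}(P): those u whose associated distribution U on R^{d+1}
  (determined by <U, phi \<otimes> psi> = <u(phi), psi>) satisfies D_P U = 0 and U|_{t<0} = 0.\<close>
definition N_LDB :: "(real^'d::finite \<Rightarrow> real) \<Rightarrow> ereal \<Rightarrow> (('d \<Rightarrow> nat) \<times> nat \<Rightarrow> complex)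
                      \<Rightarrow> ((real \<Rightarrow> complex) \<Rightarrow> (real^'d \<Rightarrow> complex)) set" where
  "N_LDB k r c = {u. LDB k r u \<and>
     (\<exists>U :: ((real^'d) \<times> real \<Rightarrow> complex) \<Rightarrow> complex.
        distribution U \<and>
        (\<forall>\<phi> \<psi>. test_fun \<phi> \<and> test_fun \<psi> \<longrightarrow> U (\<lambda>(x, t). \<phi> t * \<psi> x) = besov_pair (u \<phi>) \<psi>) \<and>
        (\<forall>\<theta>. test_fun \<theta> \<longrightarrow> U (transp_op c \<theta>) = 0) \<and>
        (\<forall>\<theta>. test_fun \<theta> \<and> tsupp \<theta> \<subseteq> {p. snd p < 0} \<longrightarrow> U \<theta> = 0))}"

definition is_zero_map :: "((real \<Rightarrow> complex) \<Rightarrow> (real^'d::finite \<Rightarrow> complex)) \<Rightarrow> bool" where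
  "is_zero_map u \<longleftrightarrow> (\<forall>\<phi>. test_fun \<phi> \<longrightarrow> (AE \<xi> in lborel. u \<phi> \<xi> = 0))"

end

theory Submission
  imports Defs "HOL-Probability.Probability" "HOL-Computational_Algebra.Polynomial"
begin

text \<open>
Testing the equation against tensor products \<open>\<phi> \<otimes> \<psi>\<close> and using that the Fourier transforms of the
\<open>\<psi>\<close> separate functions, one gets \<open>\<Sum>\<^sub>j (-1)\<^sup>j p\<^sub>j(\<xi>) u(\<phi>\<^sup>(\<^sup>j\<^sup>))(\<xi>) = 0\<close> for almost
every \<open>\<xi>\<close>, where \<open>p\<^sub>j(\<xi>)\<close> is the coefficient of \<open>T\<^sup>j\<close> in \<open>P(i\<xi>, T)\<close>. Let \<open>m\<close> be the degree
of \<open>P\<close> in \<open>T\<close>; the polynomial \<open>p\<^sub>m\<close> vanishes only on a null set. Since \<open>u\<close> ignores the past, one may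
insert for \<open>\<phi>\<close> the iterated primitives \<open>I\<^sup>n \<phi>\<close> taken from \<open>+\<infinity>\<close>, \<eta> off in the past. On the set where
all \<open>\<bar>p\<^sub>j\<bar> \<le> Q \<bar>p\<^sub>m\<bar>\<close> this bounds \<open>\<bar>u(I\<^sup>n \<phi>)\<bar>\<close> by \<open>Q\<close> times a sum of terms \<open>\<bar>u(I\<^sup>n\<^sup>+\<^sup>i \<phi>)\<bar>\<close>
with \<open>i \<ge> 1\<close>. Continuity of \<open>u\<close> makes the norm of \<open>u(I\<^sup>n \<phi>)\<close> decay like \<open>L\<^sup>n / n!\<close>, which beats
the geometric growth produced by iterating the estimate, so \<open>u(\<phi>) = 0\<close>.
If \<open>P = 0\<close>, then \<open>u(\<phi>) = \<phi>(1) f\<close> is a nonzero element for any \<open>f\<close> whose transform is an indicator.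
\<close>

subsection \<open>Smooth functions of one real variable\<close>


text \<open>A direct estimate is blocked in two places. Dividing the transformed equation by
  \<open>p\<^sub>m\<close> destroys integrability near the zeros of \<open>p\<^sub>m\<close>. But
  the equation holds pointwise in \<xi>, without coupling between frequencies, so it may be
  integrated over each set where the quotients are bounded by Q, and countably many Q exhaust the
  complement of a null set. Secondly, primitives taken from the right are not compactly supported:
  left of the support of \<phi> they are polynomials. The cut-off \<eta> falls from 1 to 0 between
  -1 and -2, and not at 0, because the hypothesis concerns test functions whose closed support lies
  in the open half-space t < 0. The estimates run in a weighted L1 norm dominated by the Besov norm:
  integrating over a subset and adding terms are immediate there, and r disappears. For uniqueness,
  only tensor products of functions of one variable are inserted as test functions, so smoothness,
  partial derivatives and Fourier transforms all reduce to the line.\<close>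

definition der :: "(real \<Rightarrow> complex) \<Rightarrow> real \<Rightarrow> complex" where
  "der f = (\<lambda>t. frechet_derivative f (at t) 1)"

lemma der_eqI:
  assumes "\<And>t. (f has_vector_derivative f' t) (at t)"
  shows "der f = f'"
proof
  fix t
  have "frechet_derivative f (at t) = (\<lambda>h. h *\<^sub>R f' t)"
    using frechet_derivative_at[of f "\<lambda>h. h *\<^sub>R f' t" t] assms[of t]
    by (simp add: has_vector_derivative_def)
  then show "der f t = f' t" by (simp add: der_def)
qed

lemma differentiable_has_der:
  assumes "f differentiable (at t)"
  shows "(f has_vector_derivative der f t) (at t)"
proof -
  have d: "(f has_derivative frechet_derivative f (at t)) (at t)"
    using assms frechet_derivative_works by blast
  then have "linear (frechet_derivative f (at t))"
    by (rule has_derivative_linear)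
  then have "frechet_derivative f (at t) h = h *\<^sub>R frechet_derivative f (at t) 1" for h :: real
    using linear_scale[of "frechet_derivative f (at t)" h 1] by simp
  then have "frechet_derivative f (at t) = (\<lambda>h. h *\<^sub>R der f t)"
    unfolding der_def by (rule ext)
  then show ?thesis using d by (simp add: has_vector_derivative_def)
qed

lemma dd_replicate_real: "dd (replicate n 1) f = (der ^^ n) f"
  by (induction n) (auto simp: der_def)

text \<open>The only basis vector of the line is 1, so a list of directions carries no information
  beyond its length.\<close>

lemma smooth_fun_iff_der: "smooth_fun f \<longleftrightarrow> (\<forall>n t. (der ^^ n) f differentiable (at t))"
proof
  assume s: "smooth_fun f"
  show "\<forall>n t. (der ^^ n) f differentiable (at t)"
  proof (intro allI)
    fix n t
    have "set (replicate n (1::real)) \<subseteq> Basis" by auto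
    then show "(der ^^ n) f differentiable (at t)"
      using s unfolding smooth_fun_def by (metis dd_replicate_real)
  qed
next
  assume s: "\<forall>n t. (der ^^ n) f differentiable (at t)"
  have "vs = replicate (length vs) 1" if "set vs \<subseteq> (Basis :: real set)" for vs
    using that by (intro replicate_eqI) auto
  then show "smooth_fun f"
    unfolding smooth_fun_def using s by (metis dd_replicate_real)
qed

lemma smooth_has_der: "smooth_fun f \<Longrightarrow> (f has_vector_derivative der f t) (at t)"
  by (rule differentiable_has_der) (metis smooth_fun_iff_der funpow_0)

lemma smooth_der: "smooth_fun f \<Longrightarrow> smooth_fun (der f)"
  unfolding smooth_fun_iff_der by (metis funpow_Suc_right o_apply)

lemma smooth_der_iter: "smooth_fun f \<Longrightarrow> smooth_fun ((der ^^ n) f)"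
  by (induction n) (auto simp: smooth_der)

lemma smooth_continuous: "smooth_fun (f :: real \<Rightarrow> complex) \<Longrightarrow> continuous_on A f"
  by (meson continuous_at_imp_continuous_on has_vector_derivative_continuous smooth_has_der)

text \<open>Coinduction: \<open>der\<close> maps S into itself, so all iterates stay in S and are
  differentiable. It suffices to exhibit a family closed under differentiation, without a formula
  for higher derivatives.\<close>

lemma smooth_coinduct:
  assumes "f \<in> S"
    and "\<And>g. g \<in> S \<Longrightarrow> \<exists>g'\<in>S. \<forall>t. (g has_vector_derivative g' t) (at t)"
  shows "smooth_fun f"
proof -
  have D: "der g \<in> S \<and> (\<forall>t. g differentiable (at t))" if "g \<in> S" for g
    using assms(2)[OF that] der_eqI by (metis differentiableI_vector)
  have "(der ^^ n) f \<in> S" for n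
    by (induction n) (use assms(1) D in auto)
  then show ?thesis using D by (auto simp: smooth_fun_iff_der)
qed

lemma smooth_primitive:
  assumes "\<And>t. (f has_vector_derivative g t) (at t)" "smooth_fun g"
  shows "smooth_fun f"
proof -
  have "\<exists>g'\<in>insert f {g. smooth_fun g}. \<forall>t. (h has_vector_derivative g' t) (at t)"
    if "h \<in> insert f {g. smooth_fun g}" for h
    using that assms smooth_der smooth_has_der by blast
  then show ?thesis by (intro smooth_coinduct[of f "insert f {g. smooth_fun g}"]) auto
qed

lemma smooth_const: "smooth_fun (\<lambda>t::real. a)"
proof -
  have "\<exists>g'\<in>range (\<lambda>a t. a). \<forall>t. (h has_vector_derivative g' t) (at t)"
    if "h \<in> range (\<lambda>a t. a)" for h :: "real \<Rightarrow> complex"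
    using that by (auto intro!: exI[of _ 0])
  then show ?thesis by (intro smooth_coinduct[of _ "range (\<lambda>a t. a)"]) auto
qed

lemma has_der_lincomb:
  assumes "smooth_fun f" "smooth_fun g"
  shows "((\<lambda>t. a * f t + b * g t) has_vector_derivative a * der f t + b * der g t) (at t)"
  using smooth_has_der[OF assms(1), of t] smooth_has_der[OF assms(2), of t]
  by (auto intro!: derivative_intros)

lemma smooth_lincomb:
  fixes f g :: "real \<Rightarrow> complex"
  assumes "smooth_fun f" "smooth_fun g"
  shows "smooth_fun (\<lambda>t. a * f t + b * g t)"
proof -
  let ?S = "{(\<lambda>t. a * f t + b * g t) |f g. smooth_fun f \<and> smooth_fun (g :: real \<Rightarrow> complex)}"
  have "\<exists>g'\<in>?S. \<forall>t. (h has_vector_derivative g' t) (at t)" if "h \<in> ?S" for h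
  proof -
    from that have "\<exists>f g. h = (\<lambda>t. a * f t + b * g t) \<and> smooth_fun f \<and> smooth_fun g"
      by simp
    then obtain f g where h: "h = (\<lambda>t. a * f t + b * g t)" "smooth_fun f" "smooth_fun g"
      by (elim exE conjE) (rule that)
    show ?thesis unfolding h(1)
      by (rule bexI[where x = "\<lambda>t. a * der f t + b * der g t"])
        (use has_der_lincomb[OF h(2,3)] smooth_der[OF h(2)] smooth_der[OF h(3)] in auto)
  qed
  then show ?thesis using assms by (intro smooth_coinduct[of _ ?S]) auto
qed

lemma der_lincomb:
  assumes "smooth_fun f" "smooth_fun g"
  shows "der (\<lambda>t. a * f t + b * g t) = (\<lambda>t. a * der f t + b * der g t)"
  by (intro der_eqI has_der_lincomb assms)

lemma der_iter_lincomb: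
  assumes "smooth_fun f" "smooth_fun g"
  shows "(der ^^ n) (\<lambda>t. a * f t + b * g t) = (\<lambda>t. a * (der ^^ n) f t + b * (der ^^ n) g t)"
  by (induction n) (auto simp: der_lincomb smooth_der_iter assms)

text \<open>Products alone are not closed under differentiation, finite sums of products are.\<close>

inductive_set products :: "(real \<Rightarrow> complex) set" where
  prod: "smooth_fun f \<Longrightarrow> smooth_fun g \<Longrightarrow> (\<lambda>t. f t * g t) \<in> products"
| add: "f \<in> products \<Longrightarrow> g \<in> products \<Longrightarrow> (\<lambda>t. f t + g t) \<in> products"

lemma has_der_mult:
  assumes "smooth_fun f" "smooth_fun g"
  shows "((\<lambda>t. f t * g t) has_vector_derivative f t * der g t + der f t * g t) (at t)"
  by (intro has_vector_derivative_mult smooth_has_der assms)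

lemma smooth_mult:
  fixes f g :: "real \<Rightarrow> complex"
  assumes "smooth_fun f" "smooth_fun g"
  shows "smooth_fun (\<lambda>t. f t * g t)"
proof -
  have "\<exists>g'\<in>products. \<forall>t. (h has_vector_derivative g' t) (at t)" if "h \<in> products" for h
    using that
  proof induction
    case (prod f g)
    then have "(\<lambda>t. f t * der g t + der f t * g t) \<in> products"
      by (intro products.intros smooth_der)
    then show ?case by (rule bexI[rotated]) (intro allI has_der_mult prod)
  next
    case (add f g)
    then obtain f' g' where "f' \<in> products" "g' \<in> products"
      "\<forall>t. (f has_vector_derivative f' t) (at t)" "\<forall>t. (g has_vector_derivative g' t) (at t)"
      by blast
    then show ?case
      by (intro bexI[of _ "\<lambda>t. f' t + g' t"]) (auto intro: products.intros derivative_intros)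
  qed
  then show ?thesis using assms by (intro smooth_coinduct[of _ products]) (auto intro: products.intros)
qed

lemma has_der_affine:
  assumes "smooth_fun f"
  shows "((\<lambda>t. f (a * t + b)) has_vector_derivative of_real a * der f (a * t + b)) (at t)"
proof -
  have "((f \<circ> (\<lambda>t. a * t + b)) has_vector_derivative a *\<^sub>R der f (a * t + b)) (at t)"
    by (intro vector_diff_chain_at smooth_has_der assms)
      (auto intro!: derivative_eq_intros)
  then show ?thesis by (simp add: o_def scaleR_conv_of_real)
qed

lemma smooth_affine:
  fixes f :: "real \<Rightarrow> complex"
  assumes "smooth_fun f"
  shows "smooth_fun (\<lambda>t. f (a * t + b))"
proof -
  \<comment> \<open>The constant c absorbs the factor a that each differentiation produces.\<close>
  let ?S = "{(\<lambda>t. c * f (a * t + b)) |c f. smooth_fun (f :: real \<Rightarrow> complex)}"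
  have "\<exists>g'\<in>?S. \<forall>t. (h has_vector_derivative g' t) (at t)" if "h \<in> ?S" for h
  proof -
    from that have "\<exists>c g. h = (\<lambda>t. c * g (a * t + b)) \<and> smooth_fun g"
      by simp
    then obtain c g where h: "h = (\<lambda>t. c * g (a * t + b))" "smooth_fun g"
      by (elim exE conjE) (rule that)
    have "(h has_vector_derivative (c * of_real a) * der g (a * t + b)) (at t)" for t
      unfolding h(1) mult.assoc by (intro derivative_intros has_der_affine h)
    then show ?thesis using smooth_der[OF h(2)]
      by (intro bexI[of _ "\<lambda>t. (c * of_real a) * der g (a * t + b)"]) auto
  qed
  then show ?thesis using assms 
    by (intro smooth_coinduct[of _ ?S]) (auto intro!: exI[of _ 1] exI[of _ f])
qed

text \<open>Leibniz rule without binomial coefficients: each differentiation doubles the number of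
  products, and every product is at most A * B.\<close>

lemma der_iter_mult_bound:
  assumes "smooth_fun f" "smooth_fun g"
    and "\<And>i. i \<le> n \<Longrightarrow> norm ((der ^^ i) f t) \<le> A" "\<And>i. i \<le> n \<Longrightarrow> norm ((der ^^ i) g t) \<le> B"
  shows "norm ((der ^^ n) (\<lambda>t. f t * g t) t) \<le> 2 ^ n * (A * B)"
  using assms
proof (induction n arbitrary: f g)
  case 0
  have "0 \<le> A" using 0(3)[of 0] norm_ge_zero order_trans by blast
  then show ?case using 0(3)[of 0] 0(4)[of 0] by (auto simp: norm_mult intro: mult_mono)
next
  case (Suc n)
  have sh: "(der ^^ i) (der h) = (der ^^ Suc i) h" for i h
    by (simp only: funpow_Suc_right o_apply)
  have "der (\<lambda>t. f t * g t) = (\<lambda>t. 1 * (f t * der g t) + 1 * (der f t * g t))"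
    by (rule der_eqI) (use has_der_mult[OF Suc.prems(1,2)] in auto)
  then have "(der ^^ Suc n) (\<lambda>t. f t * g t) t
      = (der ^^ n) (\<lambda>t. f t * der g t) t + (der ^^ n) (\<lambda>t. der f t * g t) t"
    using der_iter_lincomb[of "\<lambda>t. f t * der g t" "\<lambda>t. der f t * g t" n 1 1] Suc.prems(1,2)
    by (simp add: funpow_Suc_right smooth_mult smooth_der del: funpow.simps)
  moreover have "norm ((der ^^ n) (\<lambda>t. f t * der g t) t) \<le> 2 ^ n * (A * B)"
    using Suc.prems by (intro Suc.IH) (auto simp: smooth_der sh simp del: funpow.simps)
  moreover have "norm ((der ^^ n) (\<lambda>t. der f t * g t) t) \<le> 2 ^ n * (A * B)"
    using Suc.prems by (intro Suc.IH) (auto simp: smooth_der sh simp del: funpow.simps)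
  ultimately show ?case
    using norm_triangle_ineq[of "(der ^^ n) (\<lambda>t. f t * der g t) t"
        "(der ^^ n) (\<lambda>t. der f t * g t) t"] by (simp del: funpow.simps)
qed

text \<open>No differentiability is assumed: \<open>frechet_derivative\<close> is a choice among
  admissible derivatives, and functions that agree near t admit the same ones.\<close>

lemma der_iter_cong_open:
  assumes "open S" "t \<in> S" "\<And>s. s \<in> S \<Longrightarrow> f s = g s"
  shows "(der ^^ n) f t = (der ^^ n) g t"
  using assms(2)
proof (induction n arbitrary: t)
  case 0 then show ?case using assms by simp
next
  case (Suc n)
  let ?f = "(der ^^ n) f" and ?g = "(der ^^ n) g"
  have "(?f has_derivative F) (at t) \<longleftrightarrow> (?g has_derivative F) (at t)" for F
    using Suc assms(1)
    by (metis has_derivative_transform_within_open)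
  then have "frechet_derivative ?f (at t) = frechet_derivative ?g (at t)"
    by (simp add: frechet_derivative_def)
  moreover have "der h t = frechet_derivative h (at t) 1" for h by (simp add: der_def)
  ultimately show ?case by simp
qed

section \<open>Iterated primitives that vanish to the right of a given point\<close>

definition tail_primitive :: "real \<Rightarrow> (real \<Rightarrow> complex) \<Rightarrow> real \<Rightarrow> complex" where
  "tail_primitive b f = (\<lambda>t. (LBINT s=ereal 0..ereal t. f s) - (LBINT s=ereal 0..ereal b. f s))"

lemma has_der_tail_primitive:
  assumes "smooth_fun f"
  shows "(tail_primitive b f has_vector_derivative f t) (at t)"
proof -
  \<comment> \<open>The fundamental theorem is applied on an interval that contains the base point 0
    and has t in its interior.\<close>
  define a c where "a = min 0 t - 1" and "c = max 0 t + 1"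
  have "((\<lambda>u. LBINT s=ereal 0..ereal u. f s) has_vector_derivative f t) (at t within {a..c})"
    by (rule interval_integral_FTC2) (auto simp: a_def c_def smooth_continuous[OF assms])
  moreover have "at t within {a..c} = at t"
    by (rule at_within_interior) (auto simp: a_def c_def)
  ultimately show ?thesis unfolding tail_primitive_def
    by (auto intro!: derivative_eq_intros)
qed

lemma smooth_tail_primitive: "smooth_fun f \<Longrightarrow> smooth_fun (tail_primitive b f)"
  by (rule smooth_primitive[of _ f]) (rule has_der_tail_primitive)

lemma der_tail_primitive: "smooth_fun f \<Longrightarrow> der (tail_primitive b f) = f"
  by (rule der_eqI) (rule has_der_tail_primitive)

lemma tail_primitive_vanishes:
  assumes "smooth_fun f" "\<And>t. b \<le> t \<Longrightarrow> f t = 0" "b \<le> t"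
  shows "tail_primitive b f t = 0"
proof -
  have "(tail_primitive b f has_vector_derivative 0) (at x within {b..})" if "x \<in> {b..}" for x
    using has_vector_derivative_at_within[OF has_der_tail_primitive[OF assms(1), of b x]] assms(2)[of x] that
    by simp
  from has_vector_derivative_zero_constant[OF convex_real_interval(1) this]
  obtain c where "\<And>x. x \<in> {b..} \<Longrightarrow> tail_primitive b f x = c" by blast
  moreover have "tail_primitive b f b = 0" by (simp add: tail_primitive_def)
  ultimately show ?thesis using assms(3) by auto
qed

lemma smooth_tail_primitive_iter: "smooth_fun f \<Longrightarrow> smooth_fun ((tail_primitive b ^^ n) f)"
  by (induction n) (auto simp: smooth_tail_primitive)

lemma tail_primitive_iter_vanishes:
  assumes "smooth_fun f" "\<And>t. b \<le> t \<Longrightarrow> f t = 0" "b \<le> t"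
  shows "(tail_primitive b ^^ n) f t = 0"
  using assms(3) 
proof (induction n arbitrary: t)
  case (Suc n)
  show ?case using tail_primitive_vanishes[OF smooth_tail_primitive_iter[OF assms(1)] Suc.IH Suc.prems] by simp
qed (use assms in auto)

lemma der_tail_primitive_iter:
  assumes "smooth_fun f" "i \<le> n"
  shows "(der ^^ i) ((tail_primitive b ^^ n) f) = (tail_primitive b ^^ (n - i)) f"
  using assms(2)
proof (induction i)
  case (Suc i)
  then have "n - i = Suc (n - Suc i)" by simp
  then show ?case using Suc by (simp add: der_tail_primitive smooth_tail_primitive_iter assms(1))
qed simp

text \<open>The factorial comes from integrating \<open>(b - s) ^ n\<close> once more at each step.
  A mean value inequality against an explicit majorant replaces iterated integrals.\<close>

lemma tail_primitive_iter_bound: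
  assumes "smooth_fun f" "\<And>t. b \<le> t \<Longrightarrow> f t = 0" "\<And>t. norm (f t) \<le> A" "t \<le> b"
  shows "norm ((tail_primitive b ^^ n) f t) \<le> A * (b - t) ^ n / fact n"
  using assms(4)
proof (induction n arbitrary: t)
  case 0 then show ?case using assms(3) by simp
next
  case (Suc n)
  \<comment> \<open>\<open>?p\<close> is the negative of the claimed bound: its derivative is the
    bound for n, and like \<open>?g\<close> it vanishes at b.\<close>
  let ?g = "(tail_primitive b ^^ Suc n) f" and ?p = "\<lambda>s. - (A * (b - s) ^ Suc n / fact (Suc n))"
  have gd: "(?g has_vector_derivative (tail_primitive b ^^ n) f s) (at s)" for s
    using has_der_tail_primitive[OF smooth_tail_primitive_iter[OF assms(1)]] by simp
  have pd: "(?p has_vector_derivative A * (b - s) ^ n / fact n) (at s)" for s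
  proof -
    have "((\<lambda>s. (b - s) ^ Suc n) has_real_derivative - (real (Suc n) * (b - s) ^ n)) (at s)"
      using DERIV_power[OF DERIV_diff[OF DERIV_const[of b "at s"] DERIV_ident], of "Suc n"]
      by simp
    from DERIV_cmult[OF this, of "- (A / fact (Suc n))"]
    have "((\<lambda>s. - (A / fact (Suc n)) * (b - s) ^ Suc n) has_real_derivative
        - (A / fact (Suc n)) * - (real (Suc n) * (b - s) ^ n)) (at s)" .
    moreover have "- (A / fact (Suc n)) * - (real (Suc n) * (b - s) ^ n) = A * (b - s) ^ n / fact n"
      by (simp add: divide_simps del: of_nat_Suc)
    moreover have "(\<lambda>s. - (A / fact (Suc n)) * (b - s) ^ Suc n) = ?p"
      by simp
    ultimately show ?thesis
      unfolding has_real_derivative_iff_has_vector_derivative by metis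
  qed
  show ?case
  proof (cases "t = b")
    case True
    then show ?thesis using tail_primitive_iter_vanishes[OF assms(1,2), of b t "Suc n"] assms(3)[of t]
      by (simp del: funpow.simps)
  next
    case False
    then have "t < b" using Suc by simp
    then have "norm (?g b - ?g t) \<le> ?p b - ?p t"
    proof (rule differentiable_bound_general)
      show "continuous_on {t..b} ?g"
        by (rule smooth_continuous[OF smooth_tail_primitive_iter[OF assms(1)]])
      show "continuous_on {t..b} ?p" by (intro continuous_intros) auto
      show "(?g has_vector_derivative (tail_primitive b ^^ n) f s) (at s)" for s by (rule gd)
      show "(?p has_vector_derivative A * (b - s) ^ n / fact n) (at s)" for s by (rule pd)
      show "norm ((tail_primitive b ^^ n) f s) \<le> A * (b - s) ^ n / fact n" if "t < s" "s < b" for s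
        using Suc.IH that by simp
    qed
    moreover have "?g b = 0" by (rule tail_primitive_iter_vanishes[OF assms(1,2)]) auto
    ultimately show ?thesis by (simp del: funpow.simps)
  qed
qed


section \<open>Bump functions and a cut-off in time\<close>

definition flat_exp :: "nat \<Rightarrow> real \<Rightarrow> real" where
  "flat_exp n t = (if t > 0 then (1 / t) ^ n * exp (- (1 / t)) else 0)"

lemma flat_exp_nonneg: "0 \<le> flat_exp n t"
  by (simp add: flat_exp_def)

lemma tendsto_flat_exp: "(flat_exp n \<longlongrightarrow> 0) (at 0)"
proof -
  have "((\<lambda>t. (inverse t) ^ n / exp (inverse t)) \<longlongrightarrow> (0::real)) (at_right 0)"
    by (rule filterlim_compose[OF tendsto_power_div_exp_0 filterlim_inverse_at_top_right])
  moreover have "eventually (\<lambda>t. (inverse t) ^ n / exp (inverse t) = flat_exp n t) (at_right 0)"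
    using eventually_at_right_less[of 0]
    by eventually_elim (simp add: flat_exp_def exp_minus field_simps)
  ultimately have R: "(flat_exp n \<longlongrightarrow> 0) (at_right 0)"
    by (rule Lim_transform_eventually)
  have "eventually (\<lambda>t. 0 = flat_exp n t) (at_left 0)"
    unfolding eventually_at_filter by (simp add: flat_exp_def)
  then have "(flat_exp n \<longlongrightarrow> 0) (at_left 0)"
    by (rule Lim_transform_eventually[OF tendsto_const])
  then show ?thesis using R by (simp add: filterlim_split_at)
qed

text \<open>The powers of 1/t belong to \<open>flat_exp\<close> so that derivatives remain linear
  combinations within the family, as \<open>smooth_coinduct\<close> requires.\<close>

lemma has_der_flat_exp:
  "(flat_exp n has_real_derivative flat_exp (n + 2) t - n * flat_exp (n + 1) t) (at t)"
proof (rule linorder_cases[of t 0])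
  assume t: "t < 0"
  have "((\<lambda>t. 0) has_real_derivative 0) (at t)" by simp
  then have "(flat_exp n has_real_derivative 0) (at t)"
    by (rule has_field_derivative_transform_within_open[where S = "{..<0}"]) (use t in \<open>auto simp: flat_exp_def\<close>)
  then show ?thesis using t by (simp add: flat_exp_def)
next
  assume t: "t = 0"
  \<comment> \<open>The difference quotient at 0 is \<open>flat_exp (Suc n)\<close> itself, so
    differentiability at 0 is the known limit of the next member of the family.\<close>
  have "((\<lambda>h. (flat_exp n h - flat_exp n 0) / h) \<longlongrightarrow> 0) (at 0)"
  proof (rule Lim_transform_eventually[OF tendsto_flat_exp[of "Suc n"]])
    show "eventually (\<lambda>h. flat_exp (Suc n) h = (flat_exp n h - flat_exp n 0) / h) (at 0)"
      by (intro always_eventually) (auto simp: flat_exp_def)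
  qed
  then show ?thesis using t by (simp add: DERIV_def flat_exp_def)
next
  assume t: "0 < t"
  have "((\<lambda>t. inverse t ^ n * exp (- inverse t)) has_real_derivative
      inverse t ^ n * (exp (- inverse t) * inverse t ^ 2)
        - n * inverse t ^ (n + 1) * exp (- inverse t)) (at t)"
  proof (cases n)
    case 0
    then show ?thesis using t
      by (auto intro!: derivative_eq_intros simp: power2_eq_square)
  next
    case (Suc k)
    then show ?thesis using t
      by (auto intro!: derivative_eq_intros simp: power2_eq_square algebra_simps) (cases k, auto)
  qed
  then have "((\<lambda>t. inverse t ^ n * exp (- inverse t)) has_real_derivative
      flat_exp (n + 2) t - n * flat_exp (n + 1) t) (at t)"
    using t by (simp add: flat_exp_def field_simps power2_eq_square)
  then show ?thesis
    by (rule has_field_derivative_transform_within_open[where S = "{0<..}"])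
      (use t in \<open>auto simp: flat_exp_def inverse_eq_divide\<close>)
qed

inductive_set flat_exps :: "(real \<Rightarrow> complex) set" where
  base: "(\<lambda>t. of_real (flat_exp n t)) \<in> flat_exps"
| lincomb: "f \<in> flat_exps \<Longrightarrow> g \<in> flat_exps \<Longrightarrow> (\<lambda>t. f t + of_real a * g t) \<in> flat_exps"

lemma smooth_flat_exp: "smooth_fun (\<lambda>t. complex_of_real (flat_exp n t))"
proof (rule smooth_coinduct[of _ flat_exps])
  show "(\<lambda>t. complex_of_real (flat_exp n t)) \<in> flat_exps" by (rule flat_exps.base)
  fix h assume "h \<in> flat_exps"
  then show "\<exists>g'\<in>flat_exps. \<forall>t. (h has_vector_derivative g' t) (at t)"
  proof induction
    case (base n)
    have "((\<lambda>t. complex_of_real (flat_exp n t)) has_vector_derivative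
        of_real (flat_exp (n + 2) t - n * flat_exp (n + 1) t)) (at t)" for t
      using has_der_flat_exp[of n t]
      by (intro has_vector_derivative_of_real)
        (simp add: has_real_derivative_iff_has_vector_derivative)
    moreover have "(\<lambda>t. complex_of_real (flat_exp (n + 2) t)
        + of_real (- real n) * of_real (flat_exp (n + 1) t)) \<in> flat_exps"
      by (intro flat_exps.intros)
    ultimately show ?case by (intro bexI) (auto simp: algebra_simps)
  next
    case (lincomb f g a)
    then obtain f' g' where "f' \<in> flat_exps" "g' \<in> flat_exps"
      "\<forall>t. (f has_vector_derivative f' t) (at t)" "\<forall>t. (g has_vector_derivative g' t) (at t)"
      by blast
    then show ?case
      by (intro bexI[of _ "\<lambda>t. f' t + of_real a * g' t"])
        (auto intro: flat_exps.intros intro!: derivative_intros)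
  qed
qed

definition bump :: "real \<Rightarrow> real" where
  "bump t = flat_exp 0 (1 + t) * flat_exp 0 (1 - t)"

lemma bump_nonneg: "0 \<le> bump t"
  by (simp add: bump_def flat_exp_nonneg)

lemma bump_pos_iff: "0 < bump t \<longleftrightarrow> \<bar>t\<bar> < 1"
  by (auto simp: bump_def flat_exp_def)

lemma smooth_bump_affine: "smooth_fun (\<lambda>t. complex_of_real (bump (a * t + b)))"
proof -
  have "smooth_fun (\<lambda>t. complex_of_real (flat_exp 0 (1 * t + 1)) * of_real (flat_exp 0 ((- 1) * t + 1)))"
    by (intro smooth_mult smooth_affine smooth_flat_exp)
  then have "smooth_fun (\<lambda>t. complex_of_real (bump t))"
    by (simp add: bump_def algebra_simps)
  from smooth_affine[OF this, of a b] show ?thesis .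
qed

lemma tsupp_subset: "closed S \<Longrightarrow> (\<And>x. f x \<noteq> 0 \<Longrightarrow> x \<in> S) \<Longrightarrow> tsupp f \<subseteq> S"
  unfolding tsupp_def by (intro closure_minimal) auto

lemma not_in_tsupp: "x \<notin> tsupp f \<Longrightarrow> f x = 0"
  using closure_subset[of "{x. f x \<noteq> 0}"] by (auto simp: tsupp_def)

lemma closed_tsupp: "closed (tsupp f)"
  by (simp add: tsupp_def)

lemma test_funI:
  fixes f :: "real \<Rightarrow> complex"
  assumes "smooth_fun f" "\<And>t. f t \<noteq> 0 \<Longrightarrow> a \<le> t \<and> t \<le> b"
  shows "test_fun f"
proof -
  have "tsupp f \<subseteq> {a..b}" using assms(2) by (intro tsupp_subset) auto
  then have "compact (tsupp f)"
    using compact_Int_closed[OF compact_Icc[of a b] closed_tsupp[of f]] by (simp add: Int_absorb1)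
  then show ?thesis using assms by (simp add: test_fun_def)
qed

lemma test_fun_bounded_support:
  assumes "test_fun (f :: real \<Rightarrow> complex)"
  obtains R where "0 < R" "\<And>t. R \<le> \<bar>t\<bar> \<Longrightarrow> f t = 0"
proof -
  have "bounded (tsupp f)" using assms by (simp add: test_fun_def compact_imp_bounded)
  then obtain R where R: "\<And>t. t \<in> tsupp f \<Longrightarrow> \<bar>t\<bar> \<le> R" by (auto simp: bounded_iff)
  show ?thesis
  proof (rule that[of "\<bar>R\<bar> + 1"])
    show "f t = 0" if "\<bar>R\<bar> + 1 \<le> \<bar>t\<bar>" for t
      using R[of t] that by (intro not_in_tsupp) auto
  qed simp
qed

lemma test_fun_bump:
  assumes "a > 0"
  shows "test_fun (\<lambda>t. complex_of_real (bump (a * t + b)))"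
proof (rule test_funI[OF smooth_bump_affine])
  fix t assume "complex_of_real (bump (a * t + b)) \<noteq> 0"
  then have "\<bar>a * t + b\<bar> < 1" using bump_pos_iff[of "a * t + b"] bump_nonneg[of "a * t + b"] by simp
  then show "(- 1 - b) / a \<le> t \<and> t \<le> (1 - b) / a" using assms by (auto simp: field_simps)
qed

text \<open>Here \<eta> = 1 - g / c, where g is the primitive of a bump on (-2, -1) that vanishes
  right of -1, and c is its constant value left of -2. What \<eta> removes from a function then has
  closed support inside t < 0.\<close>

lemma cutoff_exists:
  obtains \<eta> :: "real \<Rightarrow> complex"
  where "smooth_fun \<eta>" "\<And>t. - 1 \<le> t \<Longrightarrow> \<eta> t = 1" "\<And>t. t \<le> - 2 \<Longrightarrow> \<eta> t = 0"
proof -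
  \<comment> \<open>The argument 2 t + 3 maps (-2, -1) onto (-1, 1), where \<open>bump\<close> is
    positive.\<close>
  define \<beta> where "\<beta> = (\<lambda>t. complex_of_real (bump (2 * t + 3)))"
  define g where "g = tail_primitive (- 1) \<beta>"
  have sm: "smooth_fun \<beta>" unfolding \<beta>_def by (rule smooth_bump_affine)
  have g1: "g t = 0" if "- 1 \<le> t" for t
    unfolding g_def
  proof (rule tail_primitive_vanishes[OF sm _ that])
    fix t :: real assume "- 1 \<le> t"
    then have "\<not> 0 < bump (2 * t + 3)" by (simp add: bump_pos_iff)
    then show "\<beta> t = 0" using bump_nonneg[of "2 * t + 3"] by (simp add: \<beta>_def)
  qed
  have gd: "(g has_vector_derivative \<beta> t) (at t)" for t
    unfolding g_def by (rule has_der_tail_primitive[OF sm])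
  have gd0: "(g has_vector_derivative 0) (at x within {..-2})" if "x \<in> {..-2}" for x
  proof -
    have "\<not> 0 < bump (2 * x + 3)" using that by (simp add: bump_pos_iff)
    then have "\<beta> x = 0" using bump_nonneg[of "2 * x + 3"] by (simp add: \<beta>_def)
    then show ?thesis using has_vector_derivative_at_within[OF gd[of x]] by simp
  qed
  from has_vector_derivative_zero_constant[OF convex_real_interval(2) gd0]
  obtain c where c: "\<And>x. x \<in> {..-2} \<Longrightarrow> g x = c" by blast
  \<comment> \<open>The value of g is c at -2 and 0 at -1, and its real part increases strictly in
    between.\<close>
  have "c \<noteq> 0"
  proof
    assume "c = 0"
    have rd: "((\<lambda>t. Re (g t)) has_real_derivative bump (2 * t + 3)) (at t)" for t
    proof -
      have "(\<lambda>h. Re (h *\<^sub>R \<beta> t)) = (*) (bump (2 * t + 3))" by (auto simp: \<beta>_def)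
      then show ?thesis
        using has_derivative_Re[OF gd[of t, unfolded has_vector_derivative_def]]
        by (simp add: has_field_derivative_def)
    qed
    have "Re (g (-2)) < Re (g (-1))"
    proof (rule DERIV_pos_imp_increasing_open[where f = "\<lambda>t. Re (g t)"])
      show "\<exists>y. ((\<lambda>t. Re (g t)) has_real_derivative y) (at x) \<and> 0 < y" if "-2 < x" "x < -1" for x
        using rd[of x] that by (auto simp: bump_pos_iff intro!: exI[of _ "bump (2 * x + 3)"])
      show "continuous_on {-2..-1} (\<lambda>t. Re (g t))"
        using rd DERIV_isCont continuous_at_imp_continuous_on by blast
    qed simp
    then show False using \<open>c = 0\<close> c[of "-2"] g1[of "-1"] by simp
  qed
  show ?thesis
  proof
    show "smooth_fun (\<lambda>t. 1 * 1 + (- 1 / c) * g t)"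
      by (intro smooth_lincomb smooth_const) (simp add: g_def smooth_tail_primitive sm)
  qed (use g1 c \<open>c \<noteq> 0\<close> in auto)
qed

subsection \<open>Tensor products of functions of one variable\<close>


text \<open>Enough test functions for the uniqueness argument lie in this class, and derivatives and
  Fourier transforms act on them one coordinate at a time.\<close>

definition tens :: "('a::euclidean_space \<Rightarrow> real \<Rightarrow> complex) \<Rightarrow> 'a \<Rightarrow> complex" where
  "tens F p = (\<Prod>b\<in>Basis. F b (p \<bullet> b))"

lemma tens_cong: "(\<And>b. b \<in> Basis \<Longrightarrow> F b = G b) \<Longrightarrow> tens F = tens G"
  by (auto simp: tens_def)

lemma has_derivative_tens:
  assumes "\<And>b. b \<in> Basis \<Longrightarrow> smooth_fun (F b)"
  shows "(tens F has_derivative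
    (\<lambda>h. \<Sum>b\<in>Basis. ((h \<bullet> b) *\<^sub>R der (F b) (p \<bullet> b)) * (\<Prod>c\<in>Basis - {b}. F c (p \<bullet> c)))) (at p)"
proof -
  have "((\<lambda>p. F b (p \<bullet> b)) has_derivative (\<lambda>h. (h \<bullet> b) *\<^sub>R der (F b) (p \<bullet> b))) (at p)"
    if "b \<in> Basis" for b
    using has_derivative_compose[OF has_derivative_inner_left[OF has_derivative_ident]
        smooth_has_der[OF assms[OF that], of "p \<bullet> b", unfolded has_vector_derivative_def]]
    by simp
  then show ?thesis unfolding tens_def[abs_def] by (rule has_derivative_prod)
qed

lemma frechet_derivative_tens:
  assumes "\<And>b. b \<in> Basis \<Longrightarrow> smooth_fun (F b)" "v \<in> Basis"
  shows "frechet_derivative (tens F) (at p) v = tens (F(v := der (F v))) p"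
proof -
  have "frechet_derivative (tens F) (at p) v
      = (\<Sum>b\<in>Basis. ((v \<bullet> b) *\<^sub>R der (F b) (p \<bullet> b)) * (\<Prod>c\<in>Basis - {b}. F c (p \<bullet> c)))"
    by (rule fun_cong[OF frechet_derivative_at[OF has_derivative_tens[OF assms(1)]], symmetric])
  also have "\<dots> = (\<Sum>b\<in>Basis. if b = v then der (F v) (p \<bullet> v) * (\<Prod>c\<in>Basis - {v}. F c (p \<bullet> c)) else 0)"
    using assms(2) by (intro sum.cong) (auto simp: inner_Basis)
  also have "\<dots> = der (F v) (p \<bullet> v) * (\<Prod>c\<in>Basis - {v}. F c (p \<bullet> c))"
    using assms(2) by simp
  also have "\<dots> = tens (F(v := der (F v))) p"
    unfolding tens_def using assms(2) by (subst (2) prod.remove[of _ v]) auto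
  finally show ?thesis .
qed

lemma dd_tens:
  assumes "\<And>b. b \<in> Basis \<Longrightarrow> smooth_fun (F b)" "set vs \<subseteq> Basis"
  shows "dd vs (tens F) = tens (\<lambda>b. (der ^^ count_list vs b) (F b))"
  using assms(2)
proof (induction vs)
  case (Cons v vs)
  have "dd (v # vs) (tens F) = tens ((\<lambda>b. (der ^^ count_list vs b) (F b))
      (v := der ((der ^^ count_list vs v) (F v))))"
    using Cons assms(1) by (auto simp: frechet_derivative_tens smooth_der_iter)
  also have "\<dots> = tens (\<lambda>b. (der ^^ count_list (v # vs) b) (F b))"
    by (rule tens_cong) auto
  finally show ?case .
qed simp

lemma smooth_fun_tens:
  assumes "\<And>b. b \<in> Basis \<Longrightarrow> smooth_fun (F b)"
  shows "smooth_fun (tens F)"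
  unfolding smooth_fun_def
proof (intro allI impI)
  fix vs :: "'a list" and x
  assume "set vs \<subseteq> Basis"
  then show "dd vs (tens F) differentiable (at x)"
    using dd_tens[of F vs] has_derivative_tens[of "\<lambda>b. (der ^^ count_list vs b) (F b)" x] assms
    by (auto simp: smooth_der_iter differentiable_def)
qed

lemma test_fun_tens:
  fixes F :: "'a::euclidean_space \<Rightarrow> real \<Rightarrow> complex"
  assumes "\<And>b. b \<in> Basis \<Longrightarrow> test_fun (F b)"
  shows "test_fun (tens F)"
proof -
  have "\<forall>b\<in>Basis. \<exists>R. \<forall>t. R \<le> \<bar>t\<bar> \<longrightarrow> F b t = 0"
    using assms test_fun_bounded_support by metis
  then obtain R where R: "\<And>b t. b \<in> Basis \<Longrightarrow> R b \<le> \<bar>t\<bar> \<Longrightarrow> F b t = 0" by metis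
  have "norm p \<le> (\<Sum>b\<in>Basis. R b)" if "tens F p \<noteq> 0" for p
  proof -
    have "\<bar>p \<bullet> b\<bar> \<le> R b" if "b \<in> Basis" for b
      using R[OF that, of "p \<bullet> b"] \<open>tens F p \<noteq> 0\<close> that by (force simp: tens_def)
    then show ?thesis by (rule order_trans[OF norm_le_l1 sum_mono])
  qed
  then have "bounded {p. tens F p \<noteq> 0}"
    unfolding bounded_iff by (intro exI[of _ "\<Sum>b\<in>Basis. R b"]) simp
  then have "compact (tsupp (tens F))"
    by (simp add: tsupp_def compact_closure)
  then show ?thesis using assms smooth_fun_tens by (auto simp: test_fun_def)
qed

section \<open>Linear combinations of test functions and of values of distributions\<close>

lemma differentiable_lincomb:
  fixes f g :: "'a::euclidean_space \<Rightarrow> complex"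
  assumes "f differentiable (at x)" "g differentiable (at x)"
  shows "(\<lambda>x. a * f x + b * g x) differentiable (at x)"
    and "frechet_derivative (\<lambda>x. a * f x + b * g x) (at x) v
      = a * frechet_derivative f (at x) v + b * frechet_derivative g (at x) v"
proof -
  have d: "((\<lambda>x. a * f x + b * g x) has_derivative
      (\<lambda>v. a * frechet_derivative f (at x) v + b * frechet_derivative g (at x) v)) (at x)"
    using assms unfolding frechet_derivative_works by (intro derivative_intros)
  then show "(\<lambda>x. a * f x + b * g x) differentiable (at x)"
    by (auto simp: differentiable_def)
  show "frechet_derivative (\<lambda>x. a * f x + b * g x) (at x) v
      = a * frechet_derivative f (at x) v + b * frechet_derivative g (at x) v"
    by (rule fun_cong[OF frechet_derivative_at[OF d], symmetric])
qed

lemma dd_lincomb: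
  fixes f g :: "'a::euclidean_space \<Rightarrow> complex"
  assumes "smooth_fun f" "smooth_fun g" "set vs \<subseteq> Basis"
  shows "dd vs (\<lambda>x. a * f x + b * g x) = (\<lambda>x. a * dd vs f x + b * dd vs g x)"
  using assms(3)
proof (induction vs)
  case (Cons v vs)
  then show ?case using assms
    by (auto simp: smooth_fun_def intro!: ext differentiable_lincomb(2))
qed simp

lemma test_fun_lincomb:
  fixes f g :: "'a::euclidean_space \<Rightarrow> complex"
  assumes "test_fun f" "test_fun g"
  shows "test_fun (\<lambda>x. a * f x + b * g x)"
proof -
  have "smooth_fun (\<lambda>x. a * f x + b * g x)"
    unfolding smooth_fun_def
  proof (intro allI impI)
    fix vs :: "'a list" and x
    assume vs: "set vs \<subseteq> Basis"
    have "smooth_fun f" "smooth_fun g" using assms by (auto simp: test_fun_def)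
    then show "dd vs (\<lambda>x. a * f x + b * g x) differentiable (at x)"
      unfolding dd_lincomb[OF \<open>smooth_fun f\<close> \<open>smooth_fun g\<close> vs]
      using vs by (intro differentiable_lincomb(1)) (auto simp: smooth_fun_def)
  qed
  moreover have "tsupp (\<lambda>x. a * f x + b * g x) \<subseteq> tsupp f \<union> tsupp g"
    using not_in_tsupp[of _ f] not_in_tsupp[of _ g]
    by (intro tsupp_subset closed_Un closed_tsupp) force
  then have "compact (tsupp (\<lambda>x. a * f x + b * g x))"
    using compact_Int_closed[of "tsupp f \<union> tsupp g" "tsupp (\<lambda>x. a * f x + b * g x)"] assms
    by (simp add: Int_absorb1 test_fun_def closed_tsupp compact_Un)
  ultimately show ?thesis by (simp add: test_fun_def)
qed

lemma test_fun_zero: "test_fun (\<lambda>x::'a::euclidean_space. 0)"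
proof -
  obtain b :: 'a where b: "b \<in> Basis" using nonempty_Basis by blast
  have "test_fun (tens (\<lambda>(b::'a) t. complex_of_real (bump (1 * t + 0))))"
    by (intro test_fun_tens test_fun_bump) simp
  from test_fun_lincomb[OF this this, of 0 0] show ?thesis by simp
qed

lemma distribution_sum:
  assumes T: "distribution T" and "finite A" "\<And>a. a \<in> A \<Longrightarrow> test_fun (f a)"
  shows "T (\<lambda>x. \<Sum>a\<in>A. w a * f a x) = (\<Sum>a\<in>A. w a * T (f a))"
    and "test_fun (\<lambda>x. \<Sum>a\<in>A. w a * f a x)"
proof -
  have L: "T (\<lambda>x. a * f x + b * g x) = a * T f + b * T g"
    if "test_fun f" "test_fun g" for a b f g
    using T that unfolding distribution_def by blast
  have "T (\<lambda>x. \<Sum>a\<in>A. w a * f a x) = (\<Sum>a\<in>A. w a * T (f a)) \<and> test_fun (\<lambda>x. \<Sum>a\<in>A. w a * f a x)"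
    using assms(2,3)
  proof (induction A)
    case empty
    \<comment> \<open>Linearity with both coefficients 0 gives the value at the zero
      function.\<close>
    then show ?case using L[OF test_fun_zero test_fun_zero, of 0 0] test_fun_zero by simp
  next
    case (insert a A)
    let ?s = "\<lambda>x. \<Sum>a\<in>A. w a * f a x"
    have "test_fun ?s" "T ?s = (\<Sum>a\<in>A. w a * T (f a))" "test_fun (f a)" using insert by auto
    then show ?case
      using L[of "f a" ?s "w a" 1] test_fun_lincomb[of "f a" ?s "w a" 1] insert(1,2) by simp
  qed
  then show "T (\<lambda>x. \<Sum>a\<in>A. w a * f a x) = (\<Sum>a\<in>A. w a * T (f a))"
    "test_fun (\<lambda>x. \<Sum>a\<in>A. w a * f a x)" by auto
qed

section \<open>Splitting off the time variable\<close>

definition tens_time :: "(real \<Rightarrow> complex) \<Rightarrow> (real^'d::finite \<Rightarrow> real \<Rightarrow> complex) \<Rightarrow> (real^'d) \<times> real \<Rightarrow> real \<Rightarrow> complex"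
  where "tens_time \<phi> F b = (if fst b = 0 then \<phi> else F (fst b))"

text \<open>The basis vectors of space-time are (e, 0) and (0, 1), and no basis vector e is zero, so
  \<open>fst b = 0\<close> singles out the time direction. The result is the form of test function
  on which U is known through u.\<close>

lemma tens_tens_time:
  fixes F :: "real^'d::finite \<Rightarrow> real \<Rightarrow> complex"
  shows "tens (tens_time \<phi> F) = (\<lambda>(x, t). \<phi> t * tens F x)"
proof
  fix p :: "(real^'d) \<times> real"
  have "tens (tens_time \<phi> F) p = (\<Prod>b\<in>(\<lambda>u. (u, 0)) ` Basis \<union> (\<lambda>v. (0, v)) ` Basis. tens_time \<phi> F b (p \<bullet> b))"
    by (simp add: tens_def Basis_prod_def)
  also have "\<dots> = (\<Prod>b\<in>(\<lambda>u. (u, 0)) ` Basis. tens_time \<phi> F b (p \<bullet> b))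
      * (\<Prod>b\<in>(\<lambda>v. (0, v)) ` Basis. tens_time \<phi> F b (p \<bullet> b))"
    by (intro prod.union_disjoint) auto
  also have "(\<Prod>b\<in>(\<lambda>u. (u, 0)) ` Basis. tens_time \<phi> F b (p \<bullet> b)) = tens F (fst p)"
    unfolding tens_def
    by (subst prod.reindex) (auto simp: inj_on_def tens_time_def inner_prod_def intro!: prod.cong)
  also have "(\<Prod>b\<in>(\<lambda>v. (0, v)) ` Basis. tens_time \<phi> F b (p \<bullet> b)) = \<phi> (snd p)"
    by (simp add: tens_time_def inner_prod_def)
  finally show "tens (tens_time \<phi> F) p = (\<lambda>(x, t). \<phi> t * tens F x) p"
    by (simp add: case_prod_beta)
qed

lemma tens_time_component:
  fixes F :: "real^'d::finite \<Rightarrow> real \<Rightarrow> complex"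
  assumes "P \<phi>" "\<And>b. b \<in> Basis \<Longrightarrow> P (F b)" "b \<in> Basis"
  shows "P (tens_time \<phi> F b)"
  using assms by (auto simp: tens_time_def Basis_prod_def)

text \<open>Multi-indices are functions on the index type, while tensor factors are indexed by basis
  vectors; this map passes from the latter to the former.\<close>

definition axis_index :: "real^'d::finite \<Rightarrow> 'd" where
  "axis_index b = (THE i. b = axis i 1)"

lemma axis_index_axis [simp]: "axis_index (axis i 1) = i"
  by (auto simp: axis_index_def axis_eq_axis intro!: the_equality)

lemma Basis_vec_real: "Basis = range (\<lambda>i. axis i (1::real))"
  by (auto simp: Basis_vec_def)

lemma prod_Basis_vec: "(\<Prod>b\<in>(Basis :: (real^'d::finite) set). f b) = (\<Prod>i\<in>UNIV. f (axis i 1))"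
  unfolding Basis_vec_real
  by (subst prod.reindex) (auto simp: inj_on_def axis_eq_axis)

lemma dd_replicate_tens:
  assumes "\<And>b. b \<in> Basis \<Longrightarrow> smooth_fun (F b)" "v \<in> Basis"
  shows "dd (replicate n v) (tens F) = tens (F(v := (der ^^ n) (F v)))"
proof -
  have "dd (replicate n v) (tens F) = tens (\<lambda>b. (der ^^ count_list (replicate n v) b) (F b))"
    using assms by (intro dd_tens) auto
  moreover have "count_list (replicate n v) b = (if b = v then n else 0)" for b
    by (induction n) auto
  ultimately show ?thesis by (auto intro!: tens_cong)
qed

text \<open>Restricting to tensor products makes the partial derivatives commute trivially, so the
fold in \<open>pder\<close> does not depend on the order of the coordinates.\<close>

lemma pder_tens:
  fixes F :: "real^'d::finite \<Rightarrow> real \<Rightarrow> complex"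
  assumes "smooth_fun \<phi>" "\<And>b. b \<in> Basis \<Longrightarrow> smooth_fun (F b)"
  shows "pder \<alpha> j (tens (tens_time \<phi> F)) = tens (tens_time ((der ^^ j) \<phi>) (\<lambda>b. (der ^^ \<alpha> (axis_index b)) (F b)))"
proof -
  let ?f = "\<lambda>i. dd (replicate (\<alpha> i) (xdir i))"
  \<comment> \<open>The state of the fold after the coordinates in A have been processed.\<close>
  define G where "G A b = (if axis_index b \<in> A then (der ^^ \<alpha> (axis_index b)) (F b) else F b)" for A b
  have xdir: "xdir i \<in> Basis" for i :: 'd by (auto simp: xdir_def Basis_prod_def Basis_vec_real)
  have tdir: "(tdir :: (real^'d) \<times> real) \<in> Basis" by (auto simp: tdir_def Basis_prod_def)
  have sm: "smooth_fun (tens_time \<phi> (G A) b)" if "b \<in> Basis" for A b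
    using assms smooth_der_iter by (intro tens_time_component[where P = smooth_fun] that) (auto simp: G_def)
  have *: "y = tens (tens_time \<phi> (G A))" if "fold_graph ?f (tens (tens_time \<phi> F)) A y" for A y
    using that
  proof induction
    case emptyI
    then show ?case by (simp add: G_def[abs_def])
  next
    case (insertI i A y)
    have "?f i y = tens ((tens_time \<phi> (G A))(xdir i := (der ^^ \<alpha> i) (tens_time \<phi> (G A) (xdir i))))"
      unfolding insertI.IH by (rule dd_replicate_tens[OF sm xdir])
    also have "\<dots> = tens (tens_time \<phi> (G (insert i A)))"
    proof (rule tens_cong)
      fix b :: "(real^'d) \<times> real" assume "b \<in> Basis"
      then consider k where "b = xdir k" | "b = tdir"
        by (auto simp: Basis_prod_def Basis_vec_real xdir_def tdir_def)
      then show "((tens_time \<phi> (G A))(xdir i := (der ^^ \<alpha> i) (tens_time \<phi> (G A) (xdir i)))) b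
          = tens_time \<phi> (G (insert i A)) b"
        using insertI(1) by cases (auto simp: tens_time_def xdir_def tdir_def G_def axis_eq_axis)
    qed
    finally show ?case .
  qed
  \<comment> \<open>\<open>Finite_Set.fold\<close> denotes the unique value reached by
    \<open>fold_graph\<close>. The induction above proves uniqueness for this one starting function,
    so commutation is never asked of arbitrary functions.\<close>
  have "Finite_Set.fold ?f (tens (tens_time \<phi> F)) UNIV = tens (tens_time \<phi> (G UNIV))"
    unfolding Finite_Set.fold_def using * finite_imp_fold_graph[of UNIV ?f "tens (tens_time \<phi> F)"]
    by (auto intro: the_equality)
  then have "pder \<alpha> j (tens (tens_time \<phi> F)) = dd (replicate j tdir) (tens (tens_time \<phi> (G UNIV)))"
    by (simp add: pder_def)
  also have "\<dots> = tens ((tens_time \<phi> (G UNIV))(tdir := (der ^^ j) (tens_time \<phi> (G UNIV) tdir)))"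
    by (rule dd_replicate_tens[OF sm tdir])
  also have "\<dots> = tens (tens_time ((der ^^ j) \<phi>) (\<lambda>b. (der ^^ \<alpha> (axis_index b)) (F b)))"
    by (rule tens_cong) (auto simp: Basis_prod_def Basis_vec_real tdir_def tens_time_def G_def)
  finally show ?thesis .
qed

subsection \<open>Fourier transforms\<close>


lemma cis_inner: "cis (\<xi> \<bullet> x) = (\<Prod>b\<in>Basis. cis ((\<xi> \<bullet> b) * (x \<bullet> b)))"
  for \<xi> x :: "'a::euclidean_space"
proof -
  have "cis (\<Sum>b\<in>A. g b) = (\<Prod>b\<in>A. cis (g b))" if "finite A" for g :: "'a \<Rightarrow> real" and A
    using that by (induction A) (auto simp flip: cis_mult)
  then show ?thesis by (simp add: euclidean_inner[of \<xi> x])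
qed

lemma norm_tens: "norm (tens F p) = (\<Prod>b\<in>Basis. norm (F b (p \<bullet> b)))"
  by (simp add: tens_def prod_norm)

lemma measurable_tens:
  assumes "\<And>b. b \<in> Basis \<Longrightarrow> F b \<in> borel_measurable borel"
  shows "tens F \<in> borel_measurable borel"
  unfolding tens_def[abs_def]
  by (intro borel_measurable_prod measurable_compose[OF _ assms]) measurable

lemma tens_coords:
  "tens F (\<Sum>b\<in>Basis. f b *\<^sub>R b) = (\<Prod>b\<in>Basis. F b (f b))"
  unfolding tens_def by (intro prod.cong) (auto simp: inner_sum_left inner_Basis if_distrib cong: if_cong)

text \<open>\<open>lborel\<close> is the image of the product of one-dimensional Lebesgue measures
  under the coordinate map, which reduces both claims to integrals over finite products.\<close>

lemma
  fixes F :: "'a::euclidean_space \<Rightarrow> real \<Rightarrow> complex"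
  assumes "\<And>b. b \<in> Basis \<Longrightarrow> integrable lborel (F b)"
  shows integrable_tens: "integrable lborel (tens F)"
    and integral_tens: "integral\<^sup>L lborel (tens F) = (\<Prod>b\<in>Basis. integral\<^sup>L lborel (F b))"
proof -
  interpret product_sigma_finite "\<lambda>_::'a. lborel :: real measure" ..
  have [measurable]: "tens F \<in> borel_measurable borel"
    using assms by (intro measurable_tens) (auto dest: borel_measurable_integrable)
  let ?T = "\<lambda>f. \<Sum>b\<in>Basis. f b *\<^sub>R (b::'a)"
  have T[measurable]: "?T \<in> (\<Pi>\<^sub>M b\<in>Basis. lborel) \<rightarrow>\<^sub>M borel" by measurable
  show "integrable lborel (tens F)"
    unfolding lborel_eq[where 'a='a] using product_integrable_prod[OF finite_Basis assms]
    by (subst integrable_distr_eq) (auto simp: tens_coords)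
  show "integral\<^sup>L lborel (tens F) = (\<Prod>b\<in>Basis. integral\<^sup>L lborel (F b))"
    unfolding lborel_eq[where 'a='a] using product_integral_prod[OF finite_Basis assms]
    by (subst integral_distr) (auto simp: tens_coords)
qed

text \<open>The kernel has the sign of the inverse transform, as in \<open>besov_pair\<close>, so
  \<open>der\<close> becomes multiplication by -i s; the powers of 2 pi stay outside.\<close>

definition fourier :: "(real \<Rightarrow> complex) \<Rightarrow> real \<Rightarrow> complex" where
  "fourier f s = (\<integral>t. f t * cis (s * t) \<partial>lborel)"

lemma integrable_mult_cis:
  fixes f :: "'a::euclidean_space \<Rightarrow> complex"
  assumes "integrable lborel f" "g \<in> borel_measurable borel"
  shows "integrable lborel (\<lambda>t. f t * cis (g t))"
proof (rule Bochner_Integration.integrable_bound[OF assms(1)])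
  have "f \<in> borel_measurable lborel" using assms(1) by simp
  moreover have "(\<lambda>t. cis (g t)) \<in> borel_measurable lborel"
    using assms(2) by (simp add: cis_conv_exp)
  ultimately show "(\<lambda>t. f t * cis (g t)) \<in> borel_measurable lborel" by simp
qed (simp add: norm_mult)

lemma fourier_tens:
  fixes F :: "'a::euclidean_space \<Rightarrow> real \<Rightarrow> complex"
  assumes "\<And>b. b \<in> Basis \<Longrightarrow> integrable lborel (F b)"
  shows "(\<integral>x. tens F x * cis (\<xi> \<bullet> x) \<partial>lborel) = tens (\<lambda>b. fourier (F b)) \<xi>"
proof -
  have "tens F x * cis (\<xi> \<bullet> x) = tens (\<lambda>b t. F b t * cis ((\<xi> \<bullet> b) * t)) x" for x
    by (simp add: tens_def cis_inner prod.distrib)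
  then have "(\<integral>x. tens F x * cis (\<xi> \<bullet> x) \<partial>lborel)
      = integral\<^sup>L lborel (tens (\<lambda>b t. F b t * cis ((\<xi> \<bullet> b) * t)))"
    by presburger
  also have "\<dots> = (\<Prod>b\<in>Basis. (\<integral>t. F b t * cis ((\<xi> \<bullet> b) * t) \<partial>lborel))"
    using assms by (intro integral_tens integrable_mult_cis) measurable
  finally show ?thesis by (simp add: tens_def fourier_def)
qed

lemma measurable_fourier [measurable]:
  assumes "integrable lborel f"
  shows "fourier f \<in> borel_measurable borel"
proof -
  have [measurable]: "f \<in> borel_measurable borel" using assms by simp
  show ?thesis unfolding fourier_def[abs_def] cis_conv_exp by measurable
qed

lemma norm_fourier_le: "norm (fourier f s) \<le> (\<integral>t. norm (f t) \<partial>lborel)"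
  unfolding fourier_def using integral_norm_bound[of lborel "\<lambda>t. f t * cis (s * t)"]
  by (simp add: norm_mult)

lemma test_fun_smooth: "test_fun f \<Longrightarrow> smooth_fun f"
  by (simp add: test_fun_def)

lemma integrable_test_fun:
  fixes f :: "real \<Rightarrow> complex"
  assumes "test_fun f"
  shows "integrable lborel f"
proof -
  have "integrable lborel (\<lambda>x. indicator (tsupp f) x *\<^sub>R f x)"
    using assms smooth_continuous by (intro borel_integrable_compact) (auto simp: test_fun_def)
  moreover have "indicator (tsupp f) x *\<^sub>R f x = f x" for x
    using not_in_tsupp[of x f] by (cases "x \<in> tsupp f") auto
  ultimately show ?thesis by simp
qed

lemma tsupp_der_iter: "tsupp ((der ^^ n) f) \<subseteq> tsupp f"
proof (rule tsupp_subset[OF closed_tsupp])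
  fix x assume "(der ^^ n) f x \<noteq> 0"
  moreover have "(der ^^ n) f x = 0" if "x \<notin> tsupp f"
  proof -
    have "(der ^^ n) f x = (der ^^ n) (\<lambda>x. 0) x"
      by (rule der_iter_cong_open[of "- tsupp f"])
        (use that closed_tsupp not_in_tsupp in \<open>auto simp: open_Compl\<close>)
    also have "(der ^^ n) (\<lambda>x. 0) = (\<lambda>x. 0)"
      by (induction n) (auto intro!: der_eqI derivative_eq_intros)
    finally show ?thesis .
  qed
  ultimately show "x \<in> tsupp f" by blast
qed

lemma test_fun_der_iter:
  assumes "test_fun f"
  shows "test_fun ((der ^^ n) f)"
  using assms compact_Int_closed[of "tsupp f" "tsupp ((der ^^ n) f)"] tsupp_der_iter[of n f]
  by (simp add: test_fun_def smooth_der_iter closed_tsupp Int_absorb1)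

text \<open>Integration by parts, phrased as the vanishing of the integral of the derivative of
  \<open>f t * cis (s * t)\<close>, a function with no boundary values on a large interval.\<close>

lemma fourier_der:
  assumes "test_fun f"
  shows "fourier (der f) s = - \<i> * s * fourier f s"
proof -
  obtain R where R: "0 < R" "\<And>t. R \<le> \<bar>t\<bar> \<Longrightarrow> f t = 0"
    using test_fun_bounded_support[OF assms] by blast
  let ?g = "\<lambda>t. f t * cis (s * t)"
  let ?g' = "\<lambda>t. der f t * cis (s * t) + \<i> * s * (f t * cis (s * t))"
  have g: "(?g has_vector_derivative ?g' t) (at t)" for t
  proof -
    have "((\<lambda>t. cis (s * t)) has_vector_derivative s *\<^sub>R (\<i> * cis (s * t))) (at t)"
      unfolding has_vector_derivative_def
      by (auto intro!: derivative_eq_intros simp: scaleR_conv_of_real)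
    from has_vector_derivative_mult[OF smooth_has_der[OF test_fun_smooth[OF assms]] this]
    show ?thesis by (simp add: scaleR_conv_of_real algebra_simps)
  qed
  have df: "test_fun (der f)" using test_fun_der_iter[OF assms, of 1] by simp
  have i1: "integrable lborel (\<lambda>t. der f t * cis (s * t))"
    and i2: "integrable lborel (\<lambda>t. f t * cis (s * t))"
    using assms df by (intro integrable_mult_cis integrable_test_fun; simp)+
  have "(?g' has_integral ?g R - ?g (- R)) {-R..R}"
    using R(1) g by (intro fundamental_theorem_of_calculus)
      (auto simp: has_vector_derivative_at_within)
  then have "(?g' has_integral 0) {-R..R}" using R by simp
  moreover have "?g' t = 0" if "t \<notin> {-R..R}" for t
  proof -
    have "f x = 0" if "x \<in> {..<-R} \<union> {R<..}" for x using that R by auto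
    then have "tsupp f \<subseteq> {-R..R}" by (intro tsupp_subset) force+
    moreover have "tsupp (der f) \<subseteq> tsupp f" using tsupp_der_iter[of 1 f] by simp
    ultimately have "t \<notin> tsupp f" "t \<notin> tsupp (der f)" using that by blast+
    then show ?thesis by (simp add: not_in_tsupp)
  qed
  ultimately have "(?g' has_integral 0) UNIV"
    using has_integral_on_superset[of ?g' 0 "{-R..R}" UNIV] by blast
  moreover have "(?g' has_integral (\<integral>t. ?g' t \<partial>lborel)) UNIV"
    using i1 i2 by (intro has_integral_integral_lborel) auto
  ultimately have "(\<integral>t. ?g' t \<partial>lborel) = 0" using has_integral_unique by blast
  moreover have "(\<integral>t. ?g' t \<partial>lborel) = fourier (der f) s + \<i> * s * fourier f s"
    using i1 i2 unfolding fourier_def by (subst Bochner_Integration.integral_add) auto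
  ultimately show ?thesis by (simp add: add_eq_0_iff)
qed

lemma fourier_der_iter:
  assumes "test_fun f"
  shows "fourier ((der ^^ n) f) s = (- \<i> * s) ^ n * fourier f s"
  by (induction n) (use fourier_der[OF test_fun_der_iter[OF assms]] in auto)

lemma fourier_lincomb:
  assumes "test_fun f" "test_fun g"
  shows "fourier (\<lambda>t. a * f t + b * g t) s = a * fourier f s + b * fourier g s"
proof -
  have "integrable lborel (\<lambda>t. f t * cis (s * t))" "integrable lborel (\<lambda>t. g t * cis (s * t))"
    using assms by (intro integrable_mult_cis integrable_test_fun; simp)+
  then show ?thesis unfolding fourier_def
    by (simp add: algebra_simps)
qed

text \<open>The transform of f - f'' is \<open>1 + s\<^sup>2\<close> times that of f, so each
  induction step gains one factor, without the singularity at s = 0 that division by powers of s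
  would bring.\<close>

lemma fourier_decay:
  assumes "test_fun f"
  shows "\<exists>C\<ge>0. \<forall>s. norm (fourier f s) \<le> C * inverse (1 + s\<^sup>2) ^ M"
  using assms
proof (induction M arbitrary: f)
  case 0
  then show ?case using norm_fourier_le[of f]
    by (intro exI[of _ "\<integral>t. norm (f t) \<partial>lborel"]) auto
next
  case (Suc M)
  let ?g = "\<lambda>t. 1 * f t + (- 1) * (der ^^ 2) f t"
  have "test_fun ?g" by (intro test_fun_lincomb test_fun_der_iter Suc.prems)
  from Suc.IH[OF this] obtain C where C: "C \<ge> 0" "\<And>s. norm (fourier ?g s) \<le> C * inverse (1 + s\<^sup>2) ^ M"
    by blast
  have "norm (fourier f s) \<le> C * inverse (1 + s\<^sup>2) ^ Suc M" for s
  proof -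
    have p: "0 < 1 + s\<^sup>2" by (simp add: add_pos_nonneg)
    have "fourier ?g s = of_real (1 + s\<^sup>2) * fourier f s"
      using fourier_lincomb[OF Suc.prems test_fun_der_iter[OF Suc.prems, of 2], of 1 "-1" s]
        fourier_der_iter[OF Suc.prems, of 2 s]
      by (simp add: power_mult_distrib algebra_simps)
    then have "(1 + s\<^sup>2) * norm (fourier f s) \<le> C * inverse (1 + s\<^sup>2) ^ M"
      using C(2)[of s] p by (simp only: norm_mult norm_of_real abs_of_pos)
    then have "norm (fourier f s) \<le> (C * inverse (1 + s\<^sup>2) ^ M) / (1 + s\<^sup>2)"
      using p by (simp add: pos_le_divide_eq mult.commute)
    then show ?thesis by (simp add: divide_inverse mult_ac)
  qed
  then show ?case using C(1) by blast
qed

lemma integrable_pair_mult: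
  fixes f :: "'a::euclidean_space \<Rightarrow> complex" and g :: "'b::euclidean_space \<Rightarrow> complex"
  assumes f: "integrable lborel f" and g: "integrable lborel g"
    and [measurable]: "k \<in> borel_measurable (lborel \<Otimes>\<^sub>M lborel)" and k: "\<And>p. norm (k p) \<le> 1"
  shows "integrable (lborel \<Otimes>\<^sub>M lborel) (\<lambda>(x, y). f x * g y * k (x, y))"
proof -
  have [measurable]: "f \<in> borel_measurable lborel" "g \<in> borel_measurable lborel"
    using f g by simp_all
  have "integrable (lborel \<Otimes>\<^sub>M lborel) (\<lambda>(x, y). f x * g y)"
  proof (rule lborel_pair.Fubini_integrable)
    show "integrable lborel (\<lambda>x. \<integral>y. norm (case (x, y) of (x, y) \<Rightarrow> f x * g y) \<partial>lborel)"
      using f by (simp add: norm_mult)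
  qed (use g in simp_all)
  then show ?thesis
    by (rule Bochner_Integration.integrable_bound)
      (use k in \<open>auto simp: norm_mult mult_left_le intro!: AE_I2\<close>)
qed

section \<open>Gaussian kernels and injectivity of the Fourier transform on integrable
  functions\<close>

definition gauss :: "'a::euclidean_space \<Rightarrow> complex" where
  "gauss = tens (\<lambda>_ s. complex_of_real (std_normal_density s))"

lemma integrable_std_normal: "integrable lborel std_normal_density"
  by (rule integrable_normal_density) simp

lemma integrable_gauss: "integrable lborel gauss"
  unfolding gauss_def by (intro integrable_tens integrable_of_real integrable_std_normal)

lemma integral_gauss: "integral\<^sup>L lborel gauss = 1"
  unfolding gauss_def
  by (subst integral_tens) (auto simp: integrable_std_normal integral_normal_density)

lemma fourier_std_normal:
  "fourier (\<lambda>s. complex_of_real (std_normal_density s)) w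
    = of_real (sqrt (2 * pi) * std_normal_density w)"
proof -
  have "fourier (\<lambda>s. complex_of_real (std_normal_density s)) w = char std_normal_distribution w"
    unfolding char_def fourier_def
    by (subst integral_density) (auto simp: scaleR_conv_of_real cis_conv_exp mult.commute)
  also have "\<dots> = of_real (sqrt (2 * pi) * std_normal_density w)"
    unfolding char_std_normal_distribution by (simp add: normal_density_def)
  finally show ?thesis .
qed

lemma fourier_gauss:
  "(\<integral>x. gauss x * cis (w \<bullet> x) \<partial>lborel) = of_real (sqrt (2 * pi)) ^ DIM('a) * gauss w"
  for w :: "'a::euclidean_space"
  unfolding gauss_def
  by (subst fourier_tens)
    (auto simp: fourier_std_normal tens_def prod.distrib integrable_std_normal)

lemma lborel_integral_affine:
  fixes f :: "'a::euclidean_space \<Rightarrow> complex"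
  assumes "f \<in> borel_measurable borel" "c \<noteq> 0"
  shows "(\<integral>x. f x \<partial>lborel) = \<bar>c\<bar> ^ DIM('a) *\<^sub>R (\<integral>x. f (t + c *\<^sub>R x) \<partial>lborel)"
  using assms by (subst lborel_affine[OF assms(2), of t])
    (simp add: integral_density integral_distr)

text \<open>By \<open>fourier_gauss\<close> a Gaussian is a superposition of characters. Fubini
  exchanges the integrals, leaving inside an integral of H against a single character, which
  vanishes.\<close>

lemma L1_orthogonal_to_gauss:
  fixes H :: "'a::euclidean_space \<Rightarrow> complex"
  assumes H: "integrable lborel H" and z: "\<And>a. (\<integral>\<xi>. H \<xi> * cis (\<xi> \<bullet> a) \<partial>lborel) = 0"
  shows "(\<integral>\<xi>. H \<xi> * gauss (c *\<^sub>R (y - \<xi>)) \<partial>lborel) = 0"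
proof -
  let ?k = "\<lambda>p. cis ((c *\<^sub>R (y - fst p)) \<bullet> snd p)"
  have [measurable]: "H \<in> borel_measurable borel" "(gauss :: 'a \<Rightarrow> complex) \<in> borel_measurable borel"
    using H integrable_gauss[where 'a='a] by (auto dest: borel_measurable_integrable)
  have k: "?k \<in> borel_measurable (lborel \<Otimes>\<^sub>M lborel)"
    unfolding cis_conv_exp by measurable
  have i: "integrable (lborel \<Otimes>\<^sub>M lborel) (\<lambda>(\<xi>, x). H \<xi> * gauss x * ?k (\<xi>, x))"
    by (rule integrable_pair_mult[OF H integrable_gauss k]) (simp_all add: norm_cis)
  have "of_real (sqrt (2 * pi)) ^ DIM('a) * (\<integral>\<xi>. H \<xi> * gauss (c *\<^sub>R (y - \<xi>)) \<partial>lborel)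
      = (\<integral>\<xi>. (\<integral>x. H \<xi> * gauss x * ?k (\<xi>, x) \<partial>lborel) \<partial>lborel)"
  proof -
    have "(\<integral>x. H \<xi> * gauss x * ?k (\<xi>, x) \<partial>lborel)
        = of_real (sqrt (2 * pi)) ^ DIM('a) * (H \<xi> * gauss (c *\<^sub>R (y - \<xi>)))" for \<xi>
      using fourier_gauss[of "c *\<^sub>R (y - \<xi>)"] by (simp add: mult.assoc mult.left_commute)
    then show ?thesis by simp
  qed
  also have "\<dots> = (\<integral>x. (\<integral>\<xi>. H \<xi> * gauss x * ?k (\<xi>, x) \<partial>lborel) \<partial>lborel)"
    using lborel_pair.Fubini_integral[OF i] by simp
  also have "\<dots> = (\<integral>x. gauss x * cis (c * (y \<bullet> x)) * (\<integral>\<xi>. H \<xi> * cis (\<xi> \<bullet> (- c *\<^sub>R x)) \<partial>lborel) \<partial>lborel)"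
  proof (intro Bochner_Integration.integral_cong refl)
    fix x
    have "?k (\<xi>, x) = cis (c * (y \<bullet> x)) * cis (\<xi> \<bullet> (- c *\<^sub>R x))" for \<xi>
      by (simp add: cis_mult algebra_simps)
    then show "(\<integral>\<xi>. H \<xi> * gauss x * ?k (\<xi>, x) \<partial>lborel)
        = gauss x * cis (c * (y \<bullet> x)) * (\<integral>\<xi>. H \<xi> * cis (\<xi> \<bullet> (- c *\<^sub>R x)) \<partial>lborel)"
      by (subst integral_mult_right_zero[symmetric]) (simp add: mult_ac)
  qed
  also have "\<dots> = 0" by (simp only: z mult_zero_right Bochner_Integration.integral_zero)
  finally show ?thesis by simp
qed


lemma AE_not_in_frontier_box: "AE x in lborel. x \<notin> cbox a b - box a b"
  for a b :: "'a::euclidean_space"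
proof (rule AE_not_in)
  have "cbox a b - box a b \<in> null_sets lebesgue"
    using negligible_frontier_interval negligible_iff_null_sets by blast
  then show "cbox a b - box a b \<in> null_sets lborel"
    by (auto simp: null_sets_def)
qed

text \<open>Gaussian averages at scale 1 / (n + 1) form an approximate identity. Off the frontier of
  the box the indicator is locally constant, so for each z the integrand is eventually constant in
  n.\<close>

lemma smoothed_indicator_tendsto:
  fixes a b x :: "'a::euclidean_space"
  assumes "x \<notin> cbox a b - box a b"
  shows "(\<lambda>n. \<integral>z. gauss z * indicator (box a b) (x + inverse (real (Suc n)) *\<^sub>R z) \<partial>lborel)
      \<longlonglongrightarrow> indicator (box a b) x"
proof -
  have g[measurable]: "(gauss :: 'a \<Rightarrow> complex) \<in> borel_measurable borel"
    using integrable_gauss[where 'a='a] by (auto dest: borel_measurable_integrable)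
  have "(\<lambda>n. \<integral>z. gauss z * indicator (box a b) (x + inverse (real (Suc n)) *\<^sub>R z) \<partial>lborel)
      \<longlonglongrightarrow> integral\<^sup>L lborel (\<lambda>z::'a. gauss z * indicator (box a b) x)"
  proof (rule integral_dominated_convergence[where w = "\<lambda>z::'a. norm (gauss z)"])
    show "integrable lborel (\<lambda>z::'a. norm (gauss z))"
      using integrable_gauss by (rule integrable_norm)
    show "AE z in lborel. (\<lambda>n. gauss z * indicator (box a b) (x + inverse (real (Suc n)) *\<^sub>R z))
        \<longlonglongrightarrow> gauss z * indicator (box a b) x"
    proof (rule AE_I2, rule tendsto_mult[OF tendsto_const], rule tendsto_eventually)
      fix z
      have t: "(\<lambda>n. x + inverse (real (Suc n)) *\<^sub>R z) \<longlonglongrightarrow> x + 0 *\<^sub>R z"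
        by (intro tendsto_intros LIMSEQ_inverse_real_of_nat)
      consider "x \<in> box a b" | "x \<in> - cbox a b" using assms by blast
      then show "\<forall>\<^sub>F n in sequentially. (indicator (box a b) (x + inverse (real (Suc n)) *\<^sub>R z) :: complex)
          = indicator (box a b) x"
      proof cases
        case 1
        then have "\<forall>\<^sub>F n in sequentially. x + inverse (real (Suc n)) *\<^sub>R z \<in> box a b"
          using topological_tendstoD[OF t open_box] by simp
        then show ?thesis using 1 by (auto elim: eventually_mono)
      next
        case 2
        then have "\<forall>\<^sub>F n in sequentially. x + inverse (real (Suc n)) *\<^sub>R z \<in> - cbox a b"
          using topological_tendstoD[OF t, of "- cbox a b"] by (simp add: open_Compl closed_cbox)
        then show ?thesis using 2 box_subset_cbox[of a b]
          by (auto elim!: eventually_mono simp: indicator_def)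
      qed
    qed
  qed (auto simp: norm_mult mult_left_le indicator_def)
  then show ?thesis by (simp add: integral_gauss)
qed

text \<open>A majorant free of x and c, for use in dominated convergence. If the integrand is not
  integrable, the Bochner integral is 0 by convention.\<close>

lemma norm_smoothed_indicator_le:
  fixes x :: "'a::euclidean_space"
  shows "norm (\<integral>z. gauss z * indicator A (x + c *\<^sub>R z) \<partial>lborel) \<le> integral\<^sup>L lborel (\<lambda>z::'a. norm (gauss z))"
proof (cases "integrable lborel (\<lambda>z. gauss z * indicator A (x + c *\<^sub>R z))")
  case True
  have "norm (\<integral>z. gauss z * indicator A (x + c *\<^sub>R z) \<partial>lborel)
      \<le> (\<integral>z. norm (gauss z * indicator A (x + c *\<^sub>R z)) \<partial>lborel)"
    by (rule integral_norm_bound)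
  also have "\<dots> \<le> integral\<^sup>L lborel (\<lambda>z::'a. norm (gauss z))"
    using True integrable_gauss
    by (intro integral_mono integrable_norm) (auto simp: norm_mult indicator_def)
  finally show ?thesis .
qed (simp add: not_integrable_integral_eq)

text \<open>The substitution y = \<xi> + c z turns the average of the indicator into an integral
  over the box of scaled Gaussians centred at y; by Fubini each of them meets H first.\<close>

lemma L1_orthogonal_to_smoothed_indicator:
  fixes H :: "'a::euclidean_space \<Rightarrow> complex"
  assumes H: "integrable lborel H" and z: "\<And>a. (\<integral>\<xi>. H \<xi> * cis (\<xi> \<bullet> a) \<partial>lborel) = 0" and c: "c \<noteq> 0"
  shows "(\<integral>\<xi>. H \<xi> * (\<integral>z. gauss z * indicator (box a b) (\<xi> + c *\<^sub>R z) \<partial>lborel) \<partial>lborel) = 0"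
proof -
  have [measurable]: "H \<in> borel_measurable borel" "(gauss :: 'a \<Rightarrow> complex) \<in> borel_measurable borel"
    using H integrable_gauss[where 'a='a] by (auto dest: borel_measurable_integrable)
  let ?d = "\<bar>inverse c\<bar> ^ DIM('a)"
  let ?k = "\<lambda>p. gauss (inverse c *\<^sub>R (snd p - fst p)) :: complex"
  \<comment> \<open>The kernel in \<open>integrable_pair_mult\<close> has to be bounded by 1; the
    density is at most 1 / sqrt (2 pi) on each axis.\<close>
  have "norm (gauss x :: complex) \<le> 1" for x :: 'a
  proof -
    have "std_normal_density t \<le> 1" for t
    proof -
      have "exp (- t\<^sup>2 / 2) \<le> 1" by simp
      also have "1 \<le> sqrt (2 * pi)" using pi_gt3 by simp
      finally show ?thesis
        unfolding std_normal_density_def times_divide_eq_left mult_1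
        by (subst divide_le_eq_1_pos) simp_all
    qed
    then show ?thesis unfolding gauss_def norm_tens by (intro prod_le_1) auto
  qed
  moreover have "integrable lborel (\<lambda>y. of_real (indicator (box a b) y) :: complex)"
    using emeasure_lborel_box_finite[of a b] by (intro integrable_of_real integrable_real_indicator) auto
  then have "integrable lborel (indicator (box a b) :: 'a \<Rightarrow> complex)" by (simp add: of_real_indicator)
  ultimately have i: "integrable (lborel \<Otimes>\<^sub>M lborel) (\<lambda>(\<xi>, y). H \<xi> * indicator (box a b) y * ?k (\<xi>, y))"
    by (intro integrable_pair_mult H) auto
  have sub: "(\<integral>z. gauss z * indicator (box a b) (\<xi> + c *\<^sub>R z) \<partial>lborel)
      = ?d *\<^sub>R (\<integral>y. indicator (box a b) y * gauss (inverse c *\<^sub>R (y - \<xi>)) \<partial>lborel)" for \<xi>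
  proof -
    have "(\<integral>z. gauss z * indicator (box a b) (\<xi> + c *\<^sub>R z) \<partial>lborel)
        = ?d *\<^sub>R (\<integral>y. gauss (- inverse c *\<^sub>R \<xi> + inverse c *\<^sub>R y)
            * indicator (box a b) (\<xi> + c *\<^sub>R (- inverse c *\<^sub>R \<xi> + inverse c *\<^sub>R y)) \<partial>lborel)"
      using c by (intro lborel_integral_affine) auto
    also have "(\<lambda>y. gauss (- inverse c *\<^sub>R \<xi> + inverse c *\<^sub>R y)
            * indicator (box a b) (\<xi> + c *\<^sub>R (- inverse c *\<^sub>R \<xi> + inverse c *\<^sub>R y)))
          = (\<lambda>y. indicator (box a b) y * gauss (inverse c *\<^sub>R (y - \<xi>)))"
      using c by (intro ext) (simp add: scaleR_diff_right scaleR_right_distrib)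
    finally show ?thesis .
  qed
  have "(\<integral>\<xi>. H \<xi> * (\<integral>z. gauss z * indicator (box a b) (\<xi> + c *\<^sub>R z) \<partial>lborel) \<partial>lborel)
      = ?d *\<^sub>R (\<integral>\<xi>. (\<integral>y. H \<xi> * indicator (box a b) y * ?k (\<xi>, y) \<partial>lborel) \<partial>lborel)"
    unfolding sub by (simp add: mult.assoc)
  also have "(\<integral>\<xi>. (\<integral>y. H \<xi> * indicator (box a b) y * ?k (\<xi>, y) \<partial>lborel) \<partial>lborel)
      = (\<integral>y. (\<integral>\<xi>. H \<xi> * indicator (box a b) y * ?k (\<xi>, y) \<partial>lborel) \<partial>lborel)"
    using lborel_pair.Fubini_integral[OF i] by simp
  also have "\<dots> = (\<integral>y. indicator (box a b) y * (\<integral>\<xi>. H \<xi> * gauss (inverse c *\<^sub>R (y - \<xi>)) \<partial>lborel) \<partial>lborel)"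
    by (subst integral_mult_right_zero[symmetric]) (simp add: mult_ac)
  also have "\<dots> = 0" using L1_orthogonal_to_gauss[OF H z] by simp
  finally show ?thesis by simp
qed

text \<open>Letting the Gaussian scale tend to 0 shows that H integrates to zero over every open
  box. Boxes are stable under intersection and generate the Borel sets, so a Dynkin induction
  reaches all Borel sets.\<close>

theorem L1_fourier_injective:
  fixes H :: "'a::euclidean_space \<Rightarrow> complex"
  assumes H: "integrable lborel H" and z: "\<And>a. (\<integral>\<xi>. H \<xi> * cis (\<xi> \<bullet> a) \<partial>lborel) = 0"
  shows "AE \<xi> in lborel. H \<xi> = 0"
proof (rule sigma_finite_measure.density_zero[OF sigma_finite_lborel H])
  have [measurable]: "H \<in> borel_measurable borel" "(gauss :: 'a \<Rightarrow> complex) \<in> borel_measurable borel"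
    using H integrable_gauss[where 'a='a] by (auto dest: borel_measurable_integrable)
  have si: "set_integrable lborel A H" if "A \<in> sets lborel" for A
    using H that by (auto simp: set_integrable_def intro: integrable_mult_indicator)
  have box: "set_lebesgue_integral lborel (box a b) H = 0" for a b
  proof -
    let ?K = "\<lambda>n \<xi>. \<integral>z. gauss z * indicator (box a b) (\<xi> + inverse (real (Suc n)) *\<^sub>R z) \<partial>lborel"
    have "(\<lambda>n. \<integral>\<xi>. H \<xi> * ?K n \<xi> \<partial>lborel) \<longlonglongrightarrow> (\<integral>\<xi>. H \<xi> * indicator (box a b) \<xi> \<partial>lborel)"
    proof (rule integral_dominated_convergence[where w = "\<lambda>\<xi>. norm (H \<xi>) * integral\<^sup>L lborel (\<lambda>z::'a. norm (gauss z))"])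
      show "AE \<xi> in lborel. (\<lambda>n. H \<xi> * ?K n \<xi>) \<longlonglongrightarrow> H \<xi> * indicator (box a b) \<xi>"
        using AE_not_in_frontier_box[of a b]
        by eventually_elim (intro tendsto_mult tendsto_const smoothed_indicator_tendsto)
      show "AE \<xi> in lborel. norm (H \<xi> * ?K n \<xi>) \<le> norm (H \<xi>) * integral\<^sup>L lborel (\<lambda>z::'a. norm (gauss z))" for n
        by (intro AE_I2) (simp add: norm_mult mult_left_mono norm_smoothed_indicator_le del: of_nat_Suc)
    qed (use H in simp_all)
    moreover have "(\<integral>\<xi>. H \<xi> * ?K n \<xi> \<partial>lborel) = 0" for n
      by (rule L1_orthogonal_to_smoothed_indicator[OF H z]) simp
    ultimately have "(\<integral>\<xi>. H \<xi> * indicator (box a b) \<xi> \<partial>lborel) = 0"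
      by (simp add: LIMSEQ_const_iff del: of_nat_Suc)
    moreover have "(\<lambda>\<xi>. H \<xi> * indicator (box a b) \<xi>) = (\<lambda>\<xi>. indicator (box a b) \<xi> *\<^sub>R H \<xi>)"
      by (auto simp: indicator_def)
    ultimately show ?thesis by (simp add: set_lebesgue_integral_def)
  qed
  fix A assume "A \<in> sets (lborel :: 'a measure)"
  then have A: "A \<in> sigma_sets UNIV (range (\<lambda>(a, b). box a b :: 'a set))"
    by (simp add: borel_eq_box)
  have meas: "A \<in> sets lborel" if "A \<in> sigma_sets UNIV (range (\<lambda>(a, b). box a b :: 'a set))" for A
    using that by (simp add: borel_eq_box)
  have stable: "Int_stable (range (\<lambda>(a, b). box a b :: 'a set))"
    by (auto simp: Int_stable_def box_Int_box)
  show "set_lebesgue_integral lborel A H = 0"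
    using stable subset_UNIV[of "range (\<lambda>(a, b). box a b :: 'a set)", folded Pow_UNIV] A
  proof (induction rule: sigma_sets_induct_disjoint)
    \<comment> \<open>Complements use that H has total integral zero, which is the hypothesis at a =
      0.\<close>
    case (compl A)
    have "(\<integral>\<xi>. H \<xi> \<partial>lborel) = set_lebesgue_integral lborel (A \<union> (UNIV - A)) H"
      by (simp add: set_lebesgue_integral_def)
    also have "\<dots> = set_lebesgue_integral lborel A H + set_lebesgue_integral lborel (UNIV - A) H"
      using meas[OF compl(1)] by (intro set_integral_Un si) auto
    finally show ?case using compl(2) z[of 0] by simp
  next
    case (union A)
    have m: "A i \<in> sets lborel" for i using union(2) by (intro meas) auto
    have "set_lebesgue_integral lborel (\<Union>i. A i) H = (\<Sum>i. set_lebesgue_integral lborel (A i) H)"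
      using union(1) m by (intro lebesgue_integral_countable_add si sets.countable_UN)
        (auto simp: disjoint_family_on_def)
    then show ?case using union(3) by simp
  qed (use box in \<open>auto simp: set_lebesgue_integral_def\<close>)
qed

subsection \<open>Weights and separation by test functions\<close>


text \<open>A product over coordinates instead of a power of
  \<open>1 + (norm \<xi>)\<^sup>2\<close>: integrability for M = 1 and comparison with
  \<open>fourier_decay\<close> then become one-dimensional facts.\<close>

definition weight :: "nat \<Rightarrow> 'a::euclidean_space \<Rightarrow> real" where
  "weight M \<xi> = (\<Prod>b\<in>Basis. inverse (1 + (\<xi> \<bullet> b)\<^sup>2) ^ M)"

lemma weight_pos: "0 < weight M \<xi>"
  unfolding weight_def by (intro prod_pos) (auto simp: add_pos_nonneg)

lemma weight_add: "weight (M + N) \<xi> = weight M \<xi> * weight N \<xi>"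
  by (simp add: weight_def power_add prod.distrib)

lemma weight_le_1: "weight M \<xi> \<le> 1"
  unfolding weight_def
  by (intro prod_le_1 conjI power_le_one) (auto simp: inverse_eq_divide divide_le_eq add_pos_nonneg)

lemma measurable_weight [measurable]: "weight M \<in> borel_measurable borel"
  unfolding weight_def[abs_def] by measurable

lemma integrable_weight: "integrable lborel (weight 1 :: 'a::euclidean_space \<Rightarrow> real)"
proof -
  have "integrable lborel (\<lambda>x::real. inverse (1 + x\<^sup>2))"
    using integrable_inverse_1_plus_square by (simp add: set_integrable_def)
  then have "integrable lborel (tens (\<lambda>(b::'a) x. complex_of_real (inverse (1 + x\<^sup>2))))"
    by (intro integrable_tens integrable_of_real)
  then have "integrable lborel (\<lambda>\<xi>. Re (tens (\<lambda>(b::'a) x. complex_of_real (inverse (1 + x\<^sup>2))) \<xi>))"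
    by (rule integrable_Re)
  moreover have "tens (\<lambda>(b::'a) x. complex_of_real (inverse (1 + x\<^sup>2))) = (\<lambda>\<xi>. complex_of_real (weight 1 \<xi>))"
    by (rule ext) (simp add: tens_def weight_def)
  ultimately show ?thesis by simp
qed

lemma one_plus_norm_sq_le: "1 + (norm \<xi>)\<^sup>2 \<le> (\<Prod>b\<in>Basis. 1 + (\<xi> \<bullet> b)\<^sup>2)"
  for \<xi> :: "'a::euclidean_space"
proof -
  have "1 + (\<Sum>b\<in>A. (\<xi> \<bullet> b)\<^sup>2) \<le> (\<Prod>b\<in>A. 1 + (\<xi> \<bullet> b)\<^sup>2)" if "finite A" for A :: "'a set"
    using that
  proof induction
    case (insert a A)
    have "1 * (\<xi> \<bullet> a)\<^sup>2 \<le> (\<Prod>b\<in>A. 1 + (\<xi> \<bullet> b)\<^sup>2) * (\<xi> \<bullet> a)\<^sup>2"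
      by (intro mult_right_mono prod_ge_1) auto
    then show ?case using insert by (simp add: algebra_simps)
  qed simp
  moreover have "(norm \<xi>)\<^sup>2 = (\<Sum>b\<in>Basis. (\<xi> \<bullet> b)\<^sup>2)"
    unfolding power2_norm_eq_inner by (subst euclidean_inner) (simp add: power2_eq_square)
  ultimately show ?thesis by simp
qed

text \<open>The temperate inequality for the pair -\<xi>, \<xi> bounds \<open>k 0\<close> by a
  polynomial times \<open>k \<xi>\<close>, so k decays at most polynomially.\<close>

lemma temperate_weight_lower_bound:
  assumes "temperate_weight (k :: real^'d::finite \<Rightarrow> real)"
  obtains \<kappa> M where "0 < \<kappa>" "\<And>\<xi>. \<kappa> * weight M \<xi> \<le> k \<xi>"
proof -
  from assms obtain C N where k: "\<And>\<xi>. 0 < k \<xi>" and C: "C > 0" "N > 0"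
    and le: "\<And>\<xi> \<eta>. k (\<xi> + \<eta>) \<le> (1 + C * norm \<xi>) powr N * k \<eta>"
    unfolding temperate_weight_def by blast
  define M where "M = nat \<lceil>N\<rceil>"
  define c where "c = (2 * (1 + C)) ^ M"
  have c: "0 < c" using C by (simp add: c_def)
  show ?thesis
  proof (rule that[of "k 0 / c" M])
    show "0 < k 0 / c" using k c by simp
    fix \<xi> :: "real^'d"
    let ?p = "\<Prod>b\<in>Basis. 1 + (\<xi> \<bullet> b)\<^sup>2"
    \<comment> \<open>The linear bound in the norm is traded for a quadratic one, which
      \<open>one_plus_norm_sq_le\<close> compares with the product defining
      \<open>weight\<close>.\<close>
    have "norm \<xi> \<le> 1 + (norm \<xi>)\<^sup>2"
      using sum_power2_ge_zero[of "norm \<xi> - 1" "norm \<xi>"] by (simp add: power2_eq_square algebra_simps)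
    then have "1 + C * norm \<xi> \<le> (1 + (norm \<xi>)\<^sup>2) + C * (1 + (norm \<xi>)\<^sup>2)"
      using C by (intro add_mono mult_left_mono) auto
    also have "\<dots> = 1 * ((1 + C) * (1 + (norm \<xi>)\<^sup>2))" by (simp add: algebra_simps)
    also have "\<dots> \<le> 2 * ((1 + C) * (1 + (norm \<xi>)\<^sup>2))"
      using C by (intro mult_right_mono mult_nonneg_nonneg add_nonneg_nonneg) auto
    also have "\<dots> = 2 * (1 + C) * (1 + (norm \<xi>)\<^sup>2)" by (simp add: mult.assoc)
    also have "\<dots> \<le> 2 * (1 + C) * ?p" using C one_plus_norm_sq_le[of \<xi>] by (intro mult_left_mono) auto
    finally have *: "1 + C * norm \<xi> \<le> 2 * (1 + C) * ?p" .
    have "k 0 \<le> (1 + C * norm (- \<xi>)) powr N * k \<xi>" using le[of "- \<xi>" \<xi>] by simp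
    also have "(1 + C * norm (- \<xi>)) powr N \<le> (1 + C * norm \<xi>) powr real M"
      using C by (simp add: powr_mono M_def) 
    also have "\<dots> = (1 + C * norm \<xi>) ^ M"
      using C by (intro powr_realpow) (simp add: add_pos_nonneg)
    also have "\<dots> \<le> (2 * (1 + C) * ?p) ^ M"
      using * C by (intro power_mono) auto
    also have "\<dots> = c * ?p ^ M" by (simp add: c_def power_mult_distrib)
    finally have "k 0 \<le> c * ?p ^ M * k \<xi>" using k[of \<xi>] by simp
    moreover have "weight M \<xi> = inverse (?p ^ M)"
      unfolding weight_def by (simp add: prod_power_distrib[symmetric] power_inverse prod_inversef[unfolded comp_def])
    moreover have "0 < ?p ^ M" by (intro zero_less_power prod_pos) (auto simp: add_pos_nonneg)
    ultimately show "k 0 / c * weight M \<xi> \<le> k \<xi>" using c by (simp add: field_simps)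
  qed
qed

text \<open>The bound \<open>y \<le> 1 + y\<^sup>r\<close>, applied to \<open>y = k \<bar>f\<bar> / B\<close>, replaces Hoelder's inequality and treats all
finite \<open>r\<close> at once.\<close>

lemma nn_integral_weight_besov_le:
  fixes f :: "real^'d::finite \<Rightarrow> complex"
  assumes \<kappa>: "0 < \<kappa>" "\<And>\<xi>. \<kappa> * weight M \<xi> \<le> k \<xi>" and r: "1 \<le> r"
    and [measurable]: "f \<in> borel_measurable borel" and b: "besov_le k r f B" and B: "0 < B"
  shows "(\<integral>\<^sup>+ \<xi>. ennreal (\<kappa> * weight (Suc M) \<xi> * cmod (f \<xi>)) \<partial>lborel)
      \<le> ennreal (B * (1 + integral\<^sup>L lborel (weight 1 :: real^'d \<Rightarrow> real)))"
proof -
  let ?w = "weight 1 :: real^'d \<Rightarrow> real"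
  let ?y = "\<lambda>\<xi>. \<kappa> * weight M \<xi> * cmod (f \<xi>)"
  have W: "0 \<le> integral\<^sup>L lborel ?w" by (intro integral_nonneg_AE AE_I2 less_imp_le weight_pos)
  have nw: "(\<integral>\<^sup>+ \<xi>. ennreal (B * ?w \<xi>) \<partial>lborel) = ennreal (B * integral\<^sup>L lborel ?w)"
    using B integrable_weight less_imp_le[OF weight_pos[of 1]]
    by (subst nn_integral_eq_integral) (auto intro!: AE_I2 mult_nonneg_nonneg)
  have y0: "0 \<le> ?y \<xi>" for \<xi> using \<kappa> weight_pos[of M \<xi>] by simp
  have yk: "?y \<xi> \<le> k \<xi> * cmod (f \<xi>)" for \<xi> using \<kappa>(2)[of \<xi>] by (intro mult_right_mono) auto
  \<comment> \<open>Of the M + 1 powers, M are absorbed by k and one is kept as an integrable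
    factor.\<close>
  have split: "\<kappa> * weight (Suc M) \<xi> * cmod (f \<xi>) = ?w \<xi> * ?y \<xi>" for \<xi>
    using weight_add[of M 1 \<xi>] by simp
  show ?thesis
  proof (cases "r = \<infinity>")
    case True
    then have "AE \<xi> in lborel. k \<xi> * cmod (f \<xi>) \<le> B" using b by (simp add: besov_le_def)
    then have "AE \<xi> in lborel. ennreal (\<kappa> * weight (Suc M) \<xi> * cmod (f \<xi>)) \<le> ennreal (B * ?w \<xi>)"
    proof eventually_elim
      case (elim \<xi>)
      then have "?w \<xi> * ?y \<xi> \<le> ?w \<xi> * B"
        using yk[of \<xi>] weight_pos[of 1 \<xi>] by (intro mult_left_mono) auto
      then show ?case unfolding split by (intro ennreal_leI) (simp add: mult.commute)
    qed
    then have "(\<integral>\<^sup>+ \<xi>. ennreal (\<kappa> * weight (Suc M) \<xi> * cmod (f \<xi>)) \<partial>lborel)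
        \<le> ennreal (B * integral\<^sup>L lborel ?w)"
      unfolding nw[symmetric] by (rule nn_integral_mono_AE)
    also have "\<dots> \<le> ennreal (B * (1 + integral\<^sup>L lborel ?w))"
      using B by (intro ennreal_leI mult_left_mono) auto
    finally show ?thesis .
  next
    case False
    define q where "q = real_of_ereal r"
    have q: "1 \<le> q" using r False by (cases r) (auto simp: q_def one_ereal_def)
    have bb: "(\<integral>\<^sup>+ \<xi>. ennreal ((k \<xi> * cmod (f \<xi>)) powr q) \<partial>lborel) \<le> ennreal (B powr q)"
      using b False by (simp add: besov_le_def q_def)
    have pt: "\<kappa> * weight (Suc M) \<xi> * cmod (f \<xi>) \<le> B * ?w \<xi> + B / B powr q * ?y \<xi> powr q" for \<xi>
    proof -
      have "x \<le> 1 + x powr q" if "0 \<le> x" for x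
      proof (cases "x \<le> 1")
        case False
        then have "x powr 1 \<le> x powr q" using q by (intro powr_mono) auto
        then show ?thesis using False by simp
      qed (use that in \<open>simp add: add_increasing2\<close>)
      from this[of "?y \<xi> / B"] have "?y \<xi> / B \<le> 1 + ?y \<xi> powr q / B powr q"
        using B y0[of \<xi>] by (simp add: powr_divide)
      then have "?y \<xi> \<le> B * (1 + ?y \<xi> powr q / B powr q)"
        using B by (simp add: divide_le_eq mult.commute)
      then have "?w \<xi> * ?y \<xi> \<le> ?w \<xi> * (B * (1 + ?y \<xi> powr q / B powr q))"
        using weight_pos[of 1 \<xi>] by (intro mult_left_mono) auto
      also have "\<dots> = B * ?w \<xi> + ?w \<xi> * (B / B powr q * ?y \<xi> powr q)"
        by (simp add: algebra_simps)
      also have "\<dots> \<le> B * ?w \<xi> + 1 * (B / B powr q * ?y \<xi> powr q)"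
        using weight_le_1[of 1 \<xi>] B by (intro add_left_mono mult_right_mono) auto
      finally show ?thesis unfolding split by simp
    qed
    have "(\<integral>\<^sup>+ \<xi>. ennreal (\<kappa> * weight (Suc M) \<xi> * cmod (f \<xi>)) \<partial>lborel)
        \<le> (\<integral>\<^sup>+ \<xi>. ennreal (B * ?w \<xi>) + ennreal (B / B powr q) * ennreal (?y \<xi> powr q) \<partial>lborel)"
    proof (rule nn_integral_mono)
      fix \<xi>
      have "ennreal (\<kappa> * weight (Suc M) \<xi> * cmod (f \<xi>)) \<le> ennreal (B * ?w \<xi> + B / B powr q * ?y \<xi> powr q)"
        by (rule ennreal_leI[OF pt])
      also have "\<dots> = ennreal (B * ?w \<xi>) + ennreal (B / B powr q * ?y \<xi> powr q)"
        using B less_imp_le[OF weight_pos[of 1 \<xi>]] by (intro ennreal_plus) auto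
      also have "ennreal (B / B powr q * ?y \<xi> powr q) = ennreal (B / B powr q) * ennreal (?y \<xi> powr q)"
        using B by (intro ennreal_mult) auto
      finally show "ennreal (\<kappa> * weight (Suc M) \<xi> * cmod (f \<xi>))
          \<le> ennreal (B * ?w \<xi>) + ennreal (B / B powr q) * ennreal (?y \<xi> powr q)" .
    qed
    also have "\<dots> = ennreal (B * integral\<^sup>L lborel ?w)
        + ennreal (B / B powr q) * (\<integral>\<^sup>+ \<xi>. ennreal (?y \<xi> powr q) \<partial>lborel)"
      by (subst nn_integral_add) (simp_all add: nw nn_integral_cmult del: One_nat_def)
    also have "(\<integral>\<^sup>+ \<xi>. ennreal (?y \<xi> powr q) \<partial>lborel) \<le> (\<integral>\<^sup>+ \<xi>. ennreal ((k \<xi> * cmod (f \<xi>)) powr q) \<partial>lborel)"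
      using q y0 yk by (intro nn_integral_mono ennreal_leI powr_mono2) auto
    also have "\<dots> \<le> ennreal (B powr q)" by (rule bb)
    also have "ennreal (B * integral\<^sup>L lborel ?w) + ennreal (B / B powr q) * ennreal (B powr q)
        = ennreal (B * (1 + integral\<^sup>L lborel ?w))"
      using B W by (simp add: ennreal_mult[symmetric] ennreal_plus[symmetric] algebra_simps del: ennreal_plus)
    finally show ?thesis by (simp add: add_left_mono mult_left_mono)
  qed
qed

lemma besov_le_mono:
  assumes b: "besov_le k r f B" and r: "1 \<le> r" and "B \<le> B'"
  shows "besov_le k r f B'"
proof (cases "r = \<infinity>")
  case True
  then show ?thesis using b \<open>B \<le> B'\<close> unfolding besov_le_def by (auto elim: eventually_mono)
next
  case False
  have "B powr real_of_ereal r \<le> B' powr real_of_ereal r"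
    using assms False unfolding besov_le_def by (cases r) (auto intro!: powr_mono2)
  then show ?thesis
    using assms False unfolding besov_le_def by (auto intro: order_trans ennreal_leI)
qed

text \<open>Passes from the Besov norm to a norm in which terms can be added and restricted to
  subsets in the same way for every r.\<close>

lemma besov_weighted_L1:
  fixes k :: "real^'d::finite \<Rightarrow> real"
  assumes "temperate_weight k" "1 \<le> r"
  obtains C M where "\<And>f B. f \<in> borel_measurable borel \<Longrightarrow> besov_le k r f B \<Longrightarrow>
    integrable lborel (\<lambda>\<xi>. weight M \<xi> * cmod (f \<xi>)) \<and> (\<integral>\<xi>. weight M \<xi> * cmod (f \<xi>) \<partial>lborel) \<le> C * B"
proof -
  obtain \<kappa> M where \<kappa>: "0 < \<kappa>" "\<And>\<xi>. \<kappa> * weight M \<xi> \<le> k \<xi>"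
    using temperate_weight_lower_bound[OF assms(1)] by blast
  define W where "W = 1 + integral\<^sup>L lborel (weight 1 :: real^'d \<Rightarrow> real)"
  have W: "0 < W" unfolding W_def by (intro add_pos_nonneg integral_nonneg_AE AE_I2 less_imp_le weight_pos) simp
  show ?thesis
  proof (rule that[of "Suc M" "W / \<kappa>"])
    fix f :: "real^'d \<Rightarrow> complex" and B
    assume [measurable]: "f \<in> borel_measurable borel" and b: "besov_le k r f B"
    let ?g = "\<lambda>\<xi>. weight (Suc M) \<xi> * cmod (f \<xi>)"
    have g0: "0 \<le> \<kappa> * ?g \<xi>" for \<xi> using \<kappa> weight_pos[of "Suc M" \<xi>] by simp
    have B0: "0 \<le> B" using b by (simp add: besov_le_def)
    have le: "(\<integral>\<^sup>+ \<xi>. ennreal (\<kappa> * ?g \<xi>) \<partial>lborel) \<le> ennreal (B' * W)" if "B < B'" for B'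
      using nn_integral_weight_besov_le[OF \<kappa> assms(2) _ besov_le_mono[OF b assms(2)], of B'] that B0
      by (simp add: W_def mult.assoc)
    have int: "integrable lborel (\<lambda>\<xi>. \<kappa> * ?g \<xi>)"
    proof (rule integrableI_bounded)
      show "(\<integral>\<^sup>+ \<xi>. ennreal (norm (\<kappa> * ?g \<xi>)) \<partial>lborel) < \<infinity>"
        using le[of "B + 1"] g0 by (simp add: less_top[symmetric] top_unique)
           (metis ennreal_less_top le_less_trans less_irrefl)
    qed simp
    have bound: "(\<integral>\<xi>. \<kappa> * ?g \<xi> \<partial>lborel) \<le> B' * W" if "B < B'" for B'
      using le[OF that] that B0 W g0 int
      by (subst (asm) nn_integral_eq_integral) (auto simp: ennreal_le_iff)
    \<comment> \<open>The estimate used above divides by its bound and is therefore applied to every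
      B' > B; density of the reals recovers B itself, including B = 0.\<close>
    have "(\<integral>\<xi>. \<kappa> * ?g \<xi> \<partial>lborel) / W \<le> B"
    proof (rule dense_ge)
      fix B' assume "B < B'"
      then show "(\<integral>\<xi>. \<kappa> * ?g \<xi> \<partial>lborel) / W \<le> B'"
        using bound[of B'] W by (subst pos_divide_le_eq) auto
    qed
    then have "\<kappa> * (\<integral>\<xi>. ?g \<xi> \<partial>lborel) / W \<le> B" by simp
    then have "(\<integral>\<xi>. ?g \<xi> \<partial>lborel) \<le> W / \<kappa> * B"
      using W \<kappa>(1) by (simp add: pos_divide_le_eq pos_le_divide_eq mult.commute)
    moreover have "integrable lborel ?g" using int \<kappa>(1) by simp
    ultimately show "integrable lborel ?g \<and> (\<integral>\<xi>. ?g \<xi> \<partial>lborel) \<le> W / \<kappa> * B" by blast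
  qed
qed

lemma fourier_tens_decay:
  fixes F :: "'a::euclidean_space \<Rightarrow> real \<Rightarrow> complex"
  assumes "\<And>b. b \<in> Basis \<Longrightarrow> test_fun (F b)"
  obtains C where "\<And>\<xi>. norm (tens (\<lambda>b. fourier (F b)) \<xi>) \<le> C * weight M \<xi>"
proof -
  have "\<forall>b\<in>Basis. \<exists>C. \<forall>s. norm (fourier (F b) s) \<le> C * inverse (1 + s\<^sup>2) ^ M"
    using fourier_decay assms by meson
  then obtain C where C: "\<And>b s. b \<in> Basis \<Longrightarrow> norm (fourier (F b) s) \<le> C b * inverse (1 + s\<^sup>2) ^ M"
    by metis
  show ?thesis
    by (rule that[of "\<Prod>b\<in>Basis. C b"])
      (auto simp: norm_tens weight_def prod.distrib[symmetric] intro!: prod_mono C)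
qed

lemma measurable_fourier_tens:
  fixes F :: "'a::euclidean_space \<Rightarrow> real \<Rightarrow> complex"
  assumes "\<And>b. b \<in> Basis \<Longrightarrow> test_fun (F b)"
  shows "tens (\<lambda>b. fourier (F b)) \<in> borel_measurable borel"
  by (intro measurable_tens measurable_fourier integrable_test_fun assms)

text \<open>The transforms of test functions decay faster than every \<open>weight\<close>, which
  matches the weighted integrability of f.\<close>

lemma integrable_besov_fourier_tens:
  fixes F :: "real^'d::finite \<Rightarrow> real \<Rightarrow> complex"
  assumes "temperate_weight k" "1 \<le> r" "in_besov k r f" "\<And>b. b \<in> Basis \<Longrightarrow> test_fun (F b)"
  shows "integrable lborel (\<lambda>\<xi>. f \<xi> * tens (\<lambda>b. fourier (F b)) \<xi>)"
proof -
  have f[measurable]: "f \<in> borel_measurable borel" using assms(3) by (simp add: in_besov_def)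
  note measurable_fourier_tens[OF assms(4), measurable]
  obtain M where i: "integrable lborel (\<lambda>\<xi>. weight M \<xi> * cmod (f \<xi>))"
    using besov_weighted_L1[OF assms(1,2)] assms(3) f unfolding in_besov_def by metis
  obtain C where C: "\<And>\<xi>. norm (tens (\<lambda>b. fourier (F b)) \<xi>) \<le> C * weight M \<xi>"
    using fourier_tens_decay[where F = F and M = M, OF assms(4)] by blast
  have "integrable lborel (\<lambda>\<xi>. C * (weight M \<xi> * cmod (f \<xi>)))" using i by simp
  then show ?thesis
  proof (rule Bochner_Integration.integrable_bound)
    show "AE \<xi> in lborel. norm (f \<xi> * tens (\<lambda>b. fourier (F b)) \<xi>) \<le> norm (C * (weight M \<xi> * cmod (f \<xi>)))"
    proof (rule AE_I2)
      fix \<xi>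
      have "norm (f \<xi> * tens (\<lambda>b. fourier (F b)) \<xi>) \<le> cmod (f \<xi>) * (C * weight M \<xi>)"
        unfolding norm_mult by (intro mult_left_mono C) simp
      also have "\<dots> \<le> norm (C * (weight M \<xi> * cmod (f \<xi>)))"
        using abs_ge_self[of "C * (weight M \<xi> * cmod (f \<xi>))"] by (simp add: mult_ac)
      finally show "norm (f \<xi> * tens (\<lambda>b. fourier (F b)) \<xi>) \<le> norm (C * (weight M \<xi> * cmod (f \<xi>)))" .
    qed
  qed simp
qed

lemma besov_pair_tens:
  fixes F :: "real^'d::finite \<Rightarrow> real \<Rightarrow> complex"
  assumes "\<And>b. b \<in> Basis \<Longrightarrow> test_fun (F b)"
  shows "besov_pair f (tens F) = complex_of_real ((2 * pi) powr (- real CARD('d)))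
    * (\<integral>\<xi>. f \<xi> * tens (\<lambda>b. fourier (F b)) \<xi> \<partial>lborel)"
  unfolding besov_pair_def using assms by (simp add: fourier_tens integrable_test_fun)

lemma fourier_shift: "fourier (\<lambda>t. f (t - a)) s = cis (s * a) * fourier f s"
proof -
  have "fourier (\<lambda>t. f (t - a)) s = (\<integral>t. f ((a + 1 * t) - a) * cis (s * (a + 1 * t)) \<partial>lborel)"
    unfolding fourier_def by (subst lborel_integral_real_affine[where c = 1 and t = a]) simp_all
  also have "\<dots> = (\<integral>t. cis (s * a) * (f t * cis (s * t)) \<partial>lborel)"
    by (intro Bochner_Integration.integral_cong refl) (simp add: cis_mult[symmetric] distrib_left)
  finally show ?thesis by (simp add: fourier_def)
qed

text \<open>Where the bump is positive, \<bar>s t\<bar> < 1 < pi / 2 and the cosine is positive. The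
  real part of the transform thus integrates a nonnegative function that is positive on an
  interval.\<close>

lemma fourier_bump_nonzero:
  assumes "0 < N" "\<bar>s\<bar> \<le> N"
  shows "fourier (\<lambda>t. complex_of_real (bump (N * t))) s \<noteq> 0"
proof
  assume z: "fourier (\<lambda>t. complex_of_real (bump (N * t))) s = 0"
  let ?g = "\<lambda>t. bump (N * t) * cos (s * t)"
  have i: "integrable lborel (\<lambda>t. complex_of_real (bump (N * t)) * cis (s * t))"
    using test_fun_bump[OF assms(1), of 0]
    by (intro integrable_mult_cis integrable_test_fun) auto
  have ig: "integrable lborel ?g" using integrable_Re[OF i] by simp
  have "Re (fourier (\<lambda>t. complex_of_real (bump (N * t))) s) = integral\<^sup>L lborel ?g"
    unfolding fourier_def using integral_Re[OF i] by simp
  then have "integral\<^sup>L lborel ?g = 0" using z by simp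
  have st: "0 < cos (s * t)" if "\<bar>t\<bar> < 1 / N" for t
  proof -
    have "\<bar>s * t\<bar> \<le> N * \<bar>t\<bar>" using assms by (simp add: abs_mult mult_right_mono)
    also have "N * \<bar>t\<bar> < 1" using that assms by (simp add: field_simps)
    finally have "\<bar>s * t\<bar> < pi / 2" using pi_gt3 by linarith
    then show ?thesis by (intro cos_gt_zero_pi) linarith+
  qed
  have bt: "0 < bump (N * t) \<longleftrightarrow> \<bar>t\<bar> < 1 / N" for t
    using assms by (simp add: bump_pos_iff abs_mult field_simps)
  have "0 \<le> ?g t" for t
    using bt[of t] st[of t] bump_nonneg[of "N * t"] by (cases "bump (N * t) = 0") auto
  then have "AE t in lborel. ?g t = 0"
    using \<open>integral\<^sup>L lborel ?g = 0\<close> integral_nonneg_eq_0_iff_AE[OF ig] by simp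
  then have "AE t in lborel. t \<notin> {- (1 / N)<..<1 / N}"
  proof eventually_elim
    case (elim t)
    show ?case
    proof
      assume "t \<in> {- (1 / N)<..<1 / N}"
      then have "\<bar>t\<bar> < 1 / N" by auto
      then show False using elim bt[of t] st[of t] by simp
    qed
  qed
  then have "{- (1 / N)<..<1 / N} \<in> null_sets lborel" by (subst AE_iff_null_sets) auto
  then have "emeasure lborel {- (1 / N)<..<1 / N} = 0" by (rule null_setsD1)
  then show False using assms by (simp add: ennreal_eq_0_iff)
qed

text \<open>Translating a test function multiplies its transform by a character, so \<open>G\<close> times that transform
is an \<open>L\<^sup>1\<close> function with vanishing Fourier transform; bumps of small width have transforms without
zeros on a given ball.\<close>

theorem tens_fourier_separating:
  fixes G :: "'a::euclidean_space \<Rightarrow> complex"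
  assumes "\<And>F. (\<And>b. b \<in> Basis \<Longrightarrow> test_fun (F b)) \<Longrightarrow>
      integrable lborel (\<lambda>\<xi>. G \<xi> * tens (\<lambda>b. fourier (F b)) \<xi>) \<and>
      (\<integral>\<xi>. G \<xi> * tens (\<lambda>b. fourier (F b)) \<xi> \<partial>lborel) = 0"
  shows "AE \<xi> in lborel. G \<xi> = 0"
proof -
  have "AE \<xi> in lborel. \<forall>n. norm \<xi> \<le> real (Suc n) \<longrightarrow> G \<xi> = 0"
    unfolding AE_all_countable
  proof
    fix n
    let ?N = "real (Suc n)"
    define \<psi> where "\<psi> = (\<lambda>t. complex_of_real (bump (?N * t)))"
    have shift: "test_fun (\<lambda>t. \<psi> (t - a))" for a
      using test_fun_bump[of ?N "- ?N * a"] by (simp add: \<psi>_def algebra_simps)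
    let ?H = "\<lambda>\<xi>. G \<xi> * tens (\<lambda>_. fourier \<psi>) \<xi>"
    have "AE \<xi> in lborel. ?H \<xi> = 0"
    proof (rule L1_fourier_injective)
      show "integrable lborel ?H"
        using assms[of "\<lambda>_ t. \<psi> (t - 0)"] shift[of 0] by simp
      fix a :: 'a
      have "tens (\<lambda>b. fourier (\<lambda>t. \<psi> (t - a \<bullet> b))) \<xi> = cis (\<xi> \<bullet> a) * tens (\<lambda>_. fourier \<psi>) \<xi>" for \<xi>
        by (simp add: tens_def fourier_shift prod.distrib cis_inner)
      then show "(\<integral>\<xi>. ?H \<xi> * cis (\<xi> \<bullet> a) \<partial>lborel) = 0"
        using assms[of "\<lambda>b t. \<psi> (t - a \<bullet> b)"] shift by (simp add: mult_ac)
    qed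
    then show "AE \<xi> in lborel. norm \<xi> \<le> ?N \<longrightarrow> G \<xi> = 0"
    proof eventually_elim
      case (elim \<xi>)
      show ?case
      proof
        assume n: "norm \<xi> \<le> ?N"
        have "fourier \<psi> (\<xi> \<bullet> b) \<noteq> 0" if "b \<in> Basis" for b
          unfolding \<psi>_def using Basis_le_norm[OF that, of \<xi>] n
          by (intro fourier_bump_nonzero) auto
        then have "tens (\<lambda>_. fourier \<psi>) \<xi> \<noteq> 0" by (simp add: tens_def)
        then show "G \<xi> = 0" using elim by simp
      qed
    qed
  qed
  then show ?thesis
  proof eventually_elim
    case (elim \<xi>)
    obtain n where "norm \<xi> \<le> real n" using real_arch_simple by blast
    then show ?case using elim[rule_format, of n] by simp
  qed
qed

subsection \<open>Zero sets of polynomials\<close>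


text \<open>Kronecker substitution: the exponent of the new coordinate becomes the lowest digit in
  base B. Positivity of the \<open>e i\<close> will make every coordinate \<open>s ^ e i\<close> of
  the curve nonconstant.\<close>

lemma separating_exponents:
  fixes A :: "('d \<Rightarrow> nat) set"
  assumes "finite A" "finite I"
  shows "\<exists>e::'d \<Rightarrow> nat. (\<forall>i. 0 < e i) \<and> (\<forall>\<alpha>\<in>A. \<forall>\<beta>\<in>A.
    (\<Sum>i\<in>I. \<alpha> i * e i) = (\<Sum>i\<in>I. \<beta> i * e i) \<longrightarrow> (\<forall>i\<in>I. \<alpha> i = \<beta> i))"
  using assms(2)
proof induction
  case empty
  then show ?case by (intro exI[of _ "\<lambda>_. 1"]) simp
next
  case (insert j I)
  then obtain e where e: "\<And>i. 0 < e i" "\<And>\<alpha> \<beta> i. \<alpha> \<in> A \<Longrightarrow> \<beta> \<in> A \<Longrightarrow>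
      (\<Sum>i\<in>I. \<alpha> i * e i) = (\<Sum>i\<in>I. \<beta> i * e i) \<Longrightarrow> i \<in> I \<Longrightarrow> \<alpha> i = \<beta> i" by blast
  \<comment> \<open>Exceeds every exponent of j that occurs in A, so that reduction modulo B
    recovers it.\<close>
  define B where "B = Suc (\<Sum>\<alpha>\<in>A. \<alpha> j)"
  have "0 < B" by (simp add: B_def)
  have lt: "\<alpha> j < B" if "\<alpha> \<in> A" for \<alpha>
    unfolding B_def using member_le_sum[OF that, of "\<lambda>\<alpha>. \<alpha> j"] assms(1) by simp
  define e' where "e' i = (if i = j then 1 else B * e i)" for i
  have s: "(\<Sum>i\<in>insert j I. \<alpha> i * e' i) = \<alpha> j + B * (\<Sum>i\<in>I. \<alpha> i * e i)" for \<alpha>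
  proof -
    have "(\<Sum>i\<in>I. \<alpha> i * e' i) = (\<Sum>i\<in>I. B * (\<alpha> i * e i))"
      using insert by (intro sum.cong) (auto simp: e'_def)
    then show ?thesis using insert by (simp add: sum_distrib_left e'_def)
  qed
  have "\<forall>i\<in>insert j I. \<alpha> i = \<beta> i"
    if "\<alpha> \<in> A" "\<beta> \<in> A" "(\<Sum>i\<in>insert j I. \<alpha> i * e' i) = (\<Sum>i\<in>insert j I. \<beta> i * e' i)" for \<alpha> \<beta>
  proof -
    have eq: "\<alpha> j + B * (\<Sum>i\<in>I. \<alpha> i * e i) = \<beta> j + B * (\<Sum>i\<in>I. \<beta> i * e i)"
      using that(3) unfolding s .
    from arg_cong[OF eq, of "\<lambda>n. n mod B"] have "\<alpha> j = \<beta> j" using lt that by simp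
    moreover from this eq have "B * (\<Sum>i\<in>I. \<alpha> i * e i) = B * (\<Sum>i\<in>I. \<beta> i * e i)"
      by simp
    then have "(\<Sum>i\<in>I. \<alpha> i * e i) = (\<Sum>i\<in>I. \<beta> i * e i)"
      using \<open>0 < B\<close> by simp
    ultimately show ?thesis using e(2) that by blast
  qed
  moreover have "0 < e' i" for i using e(1)[of i] \<open>0 < B\<close> by (simp add: e'_def)
  ultimately show ?case by (intro exI[of _ e']) blast
qed

text \<open>The symbol of a partial derivative: \<open>fourier\<close> yields powers of -i \<xi>,
  and the sign of the formal transpose turns them into powers of i \<xi>.\<close>

definition monomial :: "('d::finite \<Rightarrow> nat) \<Rightarrow> real^'d \<Rightarrow> complex" where
  "monomial \<alpha> \<xi> = (\<Prod>i\<in>UNIV. (\<i> * of_real (\<xi> $ i)) ^ \<alpha> i)"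

lemma measurable_monomial [measurable]: "monomial \<alpha> \<in> borel_measurable borel"
  unfolding monomial_def[abs_def] by measurable

text \<open>Along the curve distinct monomials have distinct degrees in \<open>s\<close>, so the leading terms cannot cancel.\<close>

lemma finite_zeros_on_curve:
  fixes d :: "('d::finite \<Rightarrow> nat) \<Rightarrow> complex" and \<xi> :: "real^'d"
  assumes A: "finite A" "A \<noteq> {}" and d: "\<And>\<alpha>. \<alpha> \<in> A \<Longrightarrow> d \<alpha> \<noteq> 0"
    and e: "\<And>i. 0 < e i" "inj_on (\<lambda>\<alpha>. \<Sum>i\<in>UNIV. \<alpha> i * e i) A"
  shows "finite {s::real. (\<Sum>\<alpha>\<in>A. d \<alpha> * monomial \<alpha> (\<xi> + (\<chi> i. s ^ e i))) = 0}"
proof -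
  \<comment> \<open>The i-th coordinate of the curve, times the imaginary unit, as a polynomial in
    s. Its degree is \<open>e i\<close>, so the degree of \<open>m \<alpha>\<close> is the weighted
    sum that is injective on A.\<close>
  define l where "l i = [:\<i> * of_real (\<xi> $ i):] + monom \<i> (e i)" for i
  define m where "m \<alpha> = (\<Prod>i\<in>UNIV. l i ^ \<alpha> i)" for \<alpha>
  define q where "q = (\<Sum>\<alpha>\<in>A. smult (d \<alpha>) (m \<alpha>))"
  have dl: "degree (l i) = e i" for i
    unfolding l_def using e(1)[of i] by (subst degree_add_eq_right) (auto simp: degree_monom_eq)
  have l0: "l i \<noteq> 0" for i using dl[of i] e(1)[of i] by auto
  have dm: "degree (m \<alpha>) = (\<Sum>i\<in>UNIV. \<alpha> i * e i)" for \<alpha>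
    unfolding m_def using l0 by (subst degree_prod_eq_sum_degree) (auto simp: degree_power_eq dl)
  have m0: "m \<alpha> \<noteq> 0" for \<alpha> using l0 by (simp add: m_def)
  have "Max ((\<lambda>\<alpha>. degree (m \<alpha>)) ` A) \<in> (\<lambda>\<alpha>. degree (m \<alpha>)) ` A"
    using A by (intro Max_in) auto
  then obtain \<mu> where \<mu>: "\<mu> \<in> A" "Max ((\<lambda>\<alpha>. degree (m \<alpha>)) ` A) = degree (m \<mu>)" by blast
  have le: "degree (m \<alpha>) \<le> degree (m \<mu>)" if "\<alpha> \<in> A" for \<alpha>
    unfolding \<mu>(2)[symmetric] using A that by (intro Max_ge) auto
  have "coeff q (degree (m \<mu>)) = (\<Sum>\<alpha>\<in>A. d \<alpha> * coeff (m \<alpha>) (degree (m \<mu>)))"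
    by (simp add: q_def coeff_sum)
  also have "\<dots> = (\<Sum>\<alpha>\<in>A. if \<alpha> = \<mu> then d \<mu> * lead_coeff (m \<mu>) else 0)"
  proof (intro sum.cong refl)
    fix \<alpha> assume "\<alpha> \<in> A"
    then have "degree (m \<alpha>) < degree (m \<mu>)" if "\<alpha> \<noteq> \<mu>"
      using that \<mu>(1) le[of \<alpha>] e(2) unfolding dm inj_on_def by (auto simp: le_less)
    then show "d \<alpha> * coeff (m \<alpha>) (degree (m \<mu>)) = (if \<alpha> = \<mu> then d \<mu> * lead_coeff (m \<mu>) else 0)"
      by (auto simp: coeff_eq_0)
  qed
  also have "\<dots> = d \<mu> * lead_coeff (m \<mu>)" using A(1) \<mu>(1) by simp
  also have "\<dots> \<noteq> 0" using d[OF \<mu>(1)] m0 by simp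
  finally have "q \<noteq> 0" by auto
  have "poly q (of_real s) = (\<Sum>\<alpha>\<in>A. d \<alpha> * monomial \<alpha> (\<xi> + (\<chi> i. s ^ e i)))" for s
    by (simp add: q_def poly_sum m_def poly_prod l_def poly_monom monomial_def algebra_simps)
  then have "{s::real. (\<Sum>\<alpha>\<in>A. d \<alpha> * monomial \<alpha> (\<xi> + (\<chi> i. s ^ e i))) = 0}
      = of_real -` {z. poly q z = 0}" by auto
  then show ?thesis
    using finite_vimageI[OF poly_roots_finite[OF \<open>q \<noteq> 0\<close>], of complex_of_real]
    by (simp add: inj_on_def inj_def)
qed

text \<open>The curves \<open>\<xi> + (s\<^bsup>e i\<^esup>)\<^sub>i\<close> are translates of one another, so by Tonelli a set that meets each
of them in a null set of parameters is itself null.\<close>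

theorem AE_polynomial_nonzero:
  fixes d :: "('d::finite \<Rightarrow> nat) \<Rightarrow> complex"
  assumes A: "finite A" "A \<noteq> {}" and d: "\<And>\<alpha>. \<alpha> \<in> A \<Longrightarrow> d \<alpha> \<noteq> 0"
  shows "AE \<xi> in lborel. (\<Sum>\<alpha>\<in>A. d \<alpha> * monomial \<alpha> \<xi>) \<noteq> 0"
proof -
  obtain e where e: "\<And>i. 0 < e i" and ei: "inj_on (\<lambda>\<alpha>. \<Sum>i\<in>UNIV. \<alpha> i * e i) A"
  proof -
    from separating_exponents[OF A(1), of UNIV] obtain e where "\<forall>i. 0 < e i"
      "\<forall>\<alpha>\<in>A. \<forall>\<beta>\<in>A. (\<Sum>i\<in>UNIV. \<alpha> i * e i) = (\<Sum>i\<in>UNIV. \<beta> i * e i) \<longrightarrow> (\<forall>i\<in>UNIV. \<alpha> i = \<beta> i)"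
      by auto
    note e = this
    show ?thesis
    proof (rule that[of e])
      show "inj_on (\<lambda>\<alpha>. \<Sum>i\<in>UNIV. \<alpha> i * e i) A"
        using e(2) by (intro inj_onI ext) blast
    qed (use e(1) in blast)
  qed
  define Z where "Z = {\<xi>. (\<Sum>\<alpha>\<in>A. d \<alpha> * monomial \<alpha> \<xi>) = 0}"
  have [measurable]: "Z \<in> sets borel" unfolding Z_def by measurable
  let ?v = "\<lambda>s::real. (\<chi> i. s ^ e i) :: real^'d"
  have v: "?v \<in> borel_measurable borel"
    by (intro borel_measurable_continuous_onI continuous_intros)
  \<comment> \<open>The cut to {0..1} gives the parameters total mass 1, so that averaging over
    translates of Z returns the measure of Z.\<close>
  let ?f = "\<lambda>\<xi> s. indicator Z (\<xi> + ?v s) * indicator {0..1} s :: ennreal"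
  have fm: "case_prod ?f \<in> borel_measurable (lborel \<Otimes>\<^sub>M lborel)"
    using v by measurable
  have tr: "(\<integral>\<^sup>+ \<xi>. indicator Z (\<xi> + ?v s) \<partial>lborel) = emeasure lborel Z" for s
  proof -
    have "emeasure lborel Z = (\<integral>\<^sup>+ \<xi>. indicator Z \<xi> \<partial>distr lborel borel ((+) (?v s)))"
      unfolding lborel_distr_plus by simp
    also have "\<dots> = (\<integral>\<^sup>+ \<xi>. indicator Z (?v s + \<xi>) \<partial>lborel)" by (subst nn_integral_distr) auto
    finally show ?thesis by (simp add: add.commute)
  qed
  have "emeasure lborel Z = (\<integral>\<^sup>+ s. emeasure lborel Z * indicator {0..1::real} s \<partial>lborel)"
    by (simp add: nn_integral_cmult_indicator)
  also have "\<dots> = (\<integral>\<^sup>+ s. (\<integral>\<^sup>+ \<xi>. ?f \<xi> s \<partial>lborel) \<partial>lborel)"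
    using v by (subst nn_integral_multc) (auto simp: tr)
  also have "\<dots> = (\<integral>\<^sup>+ \<xi>. (\<integral>\<^sup>+ s. ?f \<xi> s \<partial>lborel) \<partial>lborel)"
    by (rule lborel_pair.Fubini'[OF fm])
  also have "\<dots> = 0"
  proof -
    have "(\<integral>\<^sup>+ s. ?f \<xi> s \<partial>lborel) = 0" for \<xi>
    proof -
      have "finite {s. \<xi> + ?v s \<in> Z}"
        using finite_zeros_on_curve[where \<xi> = \<xi>, OF A d e ei] by (simp add: Z_def)
      then have "AE s in lborel. s \<notin> {s. \<xi> + ?v s \<in> Z}"
        by (intro AE_not_in finite_imp_null_set_lborel)
      then have "AE s in lborel. ?f \<xi> s = 0" by eventually_elim simp
      then have "(\<integral>\<^sup>+ s. ?f \<xi> s \<partial>lborel) = integral\<^sup>N lborel (\<lambda>s::real. 0)" by (rule nn_integral_cong_AE)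
      then show ?thesis by simp
    qed
    then show ?thesis by simp
  qed
  finally have "Z \<in> null_sets lborel" by (intro null_setsI) auto
  then have "AE \<xi> in lborel. \<xi> \<notin> Z" by (rule AE_not_in)
  then show ?thesis by (simp add: Z_def)
qed

subsection \<open>Vanishing of solutions supported in the future\<close>


text \<open>Far out, factorial decay puts b below \<epsilon> * \<rho> ^ n; the recursion only looks
  ahead and therefore carries this bound down to all smaller n. Then \<epsilon> tends to 0.\<close>

lemma superexponential_decay_zero:
  fixes b :: "nat \<Rightarrow> real"
  assumes S: "finite S" "\<And>a. a \<in> S \<Longrightarrow> 0 < s a" and Q: "0 \<le> Q"
    and rec: "\<And>n. b n \<le> Q * (\<Sum>a\<in>S. b (n + s a))"
    and decay: "\<And>n. b (n + M) \<le> C * x ^ n / fact n"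
  shows "b n \<le> 0"
proof -
  \<comment> \<open>One use of the recursion adds \<open>card S\<close> terms, each smaller by a
    factor \<rho>; this choice makes \<open>Q * card S * \<rho>\<close> at most 1.\<close>
  define \<rho> where "\<rho> = 1 / (1 + Q * card S)"
  have \<rho>: "0 < \<rho>" "\<rho> \<le> 1" "Q * card S * \<rho> \<le> 1"
    using Q by (auto simp: \<rho>_def add_pos_nonneg divide_le_eq)
  have "(\<lambda>n. C / \<rho> ^ M * (inverse (fact n) * (x / \<rho>) ^ n)) \<longlonglongrightarrow> C / \<rho> ^ M * 0"
    by (intro tendsto_mult tendsto_const summable_LIMSEQ_zero summable_exp)
  then have lim: "(\<lambda>n. C * x ^ n / fact n / \<rho> ^ (n + M)) \<longlonglongrightarrow> 0"
    by (simp add: divide_inverse power_add power_mult_distrib power_inverse mult_ac)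
  have "b n \<le> \<epsilon> * \<rho> ^ n" if \<epsilon>: "0 < \<epsilon>" for \<epsilon> n
  proof -
    obtain N where N: "\<And>n. N \<le> n \<Longrightarrow> C * x ^ n / fact n / \<rho> ^ (n + M) < \<epsilon>"
      using order_tendstoD(2)[OF lim \<epsilon>] by (auto simp: eventually_sequentially)
    have big: "b n \<le> \<epsilon> * \<rho> ^ n" if "N + M \<le> n" for n
    proof -
      have "b n \<le> C * x ^ (n - M) / fact (n - M)" using decay[of "n - M"] that by simp
      also have "C * x ^ (n - M) / fact (n - M) / \<rho> ^ n < \<epsilon>" using N[of "n - M"] that by simp
      then have "C * x ^ (n - M) / fact (n - M) \<le> \<epsilon> * \<rho> ^ n"
        using \<rho>(1) by (subst (asm) pos_divide_less_eq) auto
      finally show ?thesis .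
    qed
    \<comment> \<open>j bounds how far n falls short of the range covered by \<open>big\<close>;
      every shift is at least 1, so each step reduces it.\<close>
    have "b n \<le> \<epsilon> * \<rho> ^ n" if "N + M \<le> n + j" for j n
      using that
    proof (induction j arbitrary: n)
      case 0 then show ?case using big by simp
    next
      case (Suc j)
      have "b (n + s a) \<le> \<epsilon> * \<rho> ^ n * \<rho>" if "a \<in> S" for a
      proof -
        have "b (n + s a) \<le> \<epsilon> * \<rho> ^ (n + s a)" using Suc S(2)[OF that] by (intro Suc.IH) linarith
        also have "\<dots> \<le> \<epsilon> * \<rho> ^ Suc n"
          using S(2)[OF that] \<rho> \<open>0 < \<epsilon>\<close> by (intro mult_left_mono power_decreasing) auto
        finally show ?thesis by (simp add: mult_ac)
      qed
      then have "(\<Sum>a\<in>S. b (n + s a)) \<le> card S * (\<epsilon> * \<rho> ^ n * \<rho>)"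
        using sum_bounded_above[of S "\<lambda>a. b (n + s a)"] by simp
      then have "b n \<le> Q * (card S * (\<epsilon> * \<rho> ^ n * \<rho>))"
        using rec[of n] Q mult_left_mono by (meson order_trans)
      also have "\<dots> = (\<epsilon> * \<rho> ^ n) * (Q * card S * \<rho>)" by simp
      also have "\<dots> \<le> (\<epsilon> * \<rho> ^ n) * 1" using \<rho> \<open>0 < \<epsilon>\<close> by (intro mult_left_mono) auto
      finally show ?case by simp
    qed
    then show ?thesis by (meson le_add2)
  qed
  then have "b n \<le> \<epsilon>" if "0 < \<epsilon>" for \<epsilon>
    using that \<rho>(1) by (metis (no_types) divide_pos_pos nonzero_eq_divide_eq order_less_irrefl zero_less_power)
  then show ?thesis by (rule field_le_epsilon[of _ 0, simplified])
qed

text \<open>\<open>seminorm_m\<close> is a real supremum, informative only for a family bounded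
  above, so even its nonnegativity is derived from the bound B.\<close>

lemma seminorm_real_bounds:
  fixes f :: "real \<Rightarrow> complex"
  assumes "\<And>i t. i \<le> m \<Longrightarrow> norm ((der ^^ i) f t) \<le> B"
  shows "0 \<le> seminorm_m m f" "seminorm_m m f \<le> B"
proof -
  let ?I = "{(vs :: real list, x :: real). set vs \<subseteq> Basis \<and> length vs \<le> m}"
  let ?h = "\<lambda>p. norm (dd (fst p) f (snd p))"
  have I: "([], 0) \<in> ?I" by simp
  have B: "?h p \<le> B" if "p \<in> ?I" for p
  proof -
    from that obtain vs :: "real list" and t :: real
      where p: "p = (vs, t)" "set vs \<subseteq> {1}" "length vs \<le> m" by auto
    have "vs = replicate (length vs) 1" using p(2) by (intro replicate_eqI) auto
    then have "dd vs f = (der ^^ length vs) f" by (metis dd_replicate_real)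
    then show ?thesis using p assms by simp
  qed
  show "seminorm_m m f \<le> B"
    unfolding seminorm_m_def by (rule cSUP_least) (use I B in blast)+
  have "?h ([], 0) \<le> seminorm_m m f"
    unfolding seminorm_m_def by (rule cSUP_upper[OF I]) (use B in \<open>auto intro!: bdd_aboveI2\<close>)
  then show "0 \<le> seminorm_m m f" using norm_ge_zero order_trans by blast
qed

lemma der_iter_bounded_on_compact:
  assumes "smooth_fun f"
  obtains A where "\<And>i t. i \<le> m \<Longrightarrow> a \<le> t \<Longrightarrow> t \<le> b \<Longrightarrow> norm ((der ^^ i) f t) \<le> A"
proof -
  have "\<exists>A. \<forall>t\<in>{a..b}. norm ((der ^^ i) f t) \<le> A" for i
  proof -
    have "compact ((der ^^ i) f ` {a..b})"
      by (intro compact_continuous_image smooth_continuous smooth_der_iter assms) simp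
    then show ?thesis by (auto dest!: compact_imp_bounded simp: bounded_iff)
  qed
  then obtain A where A: "\<And>i t. t \<in> {a..b} \<Longrightarrow> norm ((der ^^ i) f t) \<le> A i" by metis
  show ?thesis
  proof (rule that[of "Max (A ` {..m})"])
    fix i t assume "i \<le> m" "a \<le> t" "t \<le> b"
    then show "norm ((der ^^ i) f t) \<le> Max (A ` {..m})"
      using A[of t i] Max_ge[of "A ` {..m}" "A i"] by (intro order_trans[OF A[of t i]]) auto
  qed
qed

text \<open>Fixes, together with u, a distribution U that witnesses membership in
  \<open>N_LDB\<close>. The equation and the vanishing in the past are known for U and have to be
  carried over to u.\<close>

locale null_solution =
  fixes k :: "real^'d::finite \<Rightarrow> real" and r :: ereal
    and c :: "('d \<Rightarrow> nat) \<times> nat \<Rightarrow> complex"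
    and u :: "(real \<Rightarrow> complex) \<Rightarrow> real^'d \<Rightarrow> complex"
    and U :: "((real^'d) \<times> real \<Rightarrow> complex) \<Rightarrow> complex"
  assumes temperate: "temperate_weight k" and r: "1 \<le> r"
    and finite_coeffs: "finite {a. c a \<noteq> 0}"
    and LDB: "LDB k r u" and U: "distribution U"
    and U_tensor: "\<And>\<phi> \<psi>. test_fun \<phi> \<Longrightarrow> test_fun \<psi> \<Longrightarrow> U (\<lambda>(x, t). \<phi> t * \<psi> x) = besov_pair (u \<phi>) \<psi>"
    and U_solves: "\<And>\<theta>. test_fun \<theta> \<Longrightarrow> U (transp_op c \<theta>) = 0"
    and U_past: "\<And>\<theta>. test_fun \<theta> \<Longrightarrow> tsupp \<theta> \<subseteq> {p. snd p < 0} \<Longrightarrow> U \<theta> = 0"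
begin

lemma in_besov: "test_fun \<phi> \<Longrightarrow> in_besov k r (u \<phi>)"
  using LDB by (simp add: LDB_def)

lemma measurable_u: "test_fun \<phi> \<Longrightarrow> u \<phi> \<in> borel_measurable borel"
  using in_besov by (simp add: in_besov_def)

lemma U_tens:
  assumes "test_fun \<phi>" "\<And>b. b \<in> Basis \<Longrightarrow> test_fun (F b)"
  shows "U (tens (tens_time \<phi> F)) = complex_of_real ((2 * pi) powr (- real CARD('d)))
    * (\<integral>\<xi>. u \<phi> \<xi> * tens (\<lambda>b. fourier (F b)) \<xi> \<partial>lborel)"
  using U_tensor[OF assms(1) test_fun_tens[OF assms(2)]] besov_pair_tens[OF assms(2)]
  by (simp add: tens_tens_time)

lemma integrable_u:
  assumes "test_fun \<phi>" "\<And>b. b \<in> Basis \<Longrightarrow> test_fun (F b)"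
  shows "integrable lborel (\<lambda>\<xi>. u \<phi> \<xi> * tens (\<lambda>b. fourier (F b)) \<xi>)"
  by (rule integrable_besov_fourier_tens[OF temperate r in_besov[OF assms(1)] assms(2)])

lemma test_fun_tens_time:
  assumes "test_fun \<phi>" "\<And>b. b \<in> Basis \<Longrightarrow> test_fun (F b)"
  shows "test_fun (tens (tens_time \<phi> F))"
  by (intro test_fun_tens tens_time_component[where P = test_fun] assms)

text \<open>The threshold -1 keeps the closed support of the tensor products inside the open
  half-space t < 0. All pairings with U then vanish, and the transforms of test functions
  separate.\<close>

lemma u_past_eq_0:
  assumes "test_fun \<phi>" "\<And>t. - 1 < t \<Longrightarrow> \<phi> t = 0"
  shows "AE \<xi> in lborel. u \<phi> \<xi> = 0"
proof (rule tens_fourier_separating)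
  fix F :: "real^'d \<Rightarrow> real \<Rightarrow> complex"
  assume F: "\<And>b. b \<in> Basis \<Longrightarrow> test_fun (F b)"
  have "tsupp (tens (tens_time \<phi> F)) \<subseteq> {p. snd p \<le> - 1}"
  proof (rule tsupp_subset)
    show "closed {p :: (real^'d) \<times> real. snd p \<le> - 1}"
      by (intro closed_Collect_le continuous_intros)
    fix p assume "tens (tens_time \<phi> F) p \<noteq> 0"
    then have "\<phi> (snd p) \<noteq> 0" by (auto simp: tens_tens_time case_prod_beta)
    then show "p \<in> {p. snd p \<le> - 1}" using assms(2)[of "snd p"] by force
  qed
  then have "U (tens (tens_time \<phi> F)) = 0"
    by (intro U_past test_fun_tens_time assms F) (auto dest!: subsetD)
  then show "integrable lborel (\<lambda>\<xi>. u \<phi> \<xi> * tens (\<lambda>b. fourier (F b)) \<xi>) \<and>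
      (\<integral>\<xi>. u \<phi> \<xi> * tens (\<lambda>b. fourier (F b)) \<xi> \<partial>lborel) = 0"
    using U_tens[OF assms(1) F] integrable_u[OF assms(1) F] by simp
qed

text \<open>Test functions may be altered freely at t \<le> -1, so a primitive without compact
  support may be replaced by a cut-off one.\<close>

lemma u_cong_future:
  assumes "test_fun \<phi>" "test_fun \<theta>" "\<And>t. - 1 < t \<Longrightarrow> \<phi> t = \<theta> t"
  shows "AE \<xi> in lborel. u \<phi> \<xi> = u \<theta> \<xi>"
proof -
  have "AE \<xi> in lborel. u (\<lambda>t. 1 * \<phi> t + (- 1) * \<theta> t) \<xi> = 1 * u \<phi> \<xi> + (- 1) * u \<theta> \<xi>"
    using LDB assms(1,2) unfolding LDB_def by blast
  moreover have "AE \<xi> in lborel. u (\<lambda>t. 1 * \<phi> t + (- 1) * \<theta> t) \<xi> = 0"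
    by (rule u_past_eq_0[OF test_fun_lincomb[OF assms(1,2)]]) (simp add: assms(3))
  ultimately show ?thesis by eventually_elim simp
qed

text \<open>On tensor products the transposed operator acts factor by factor. Its spatial sign
  cancels against the one in \<open>fourier_der_iter\<close>; only the sign of the time derivatives
  survives.\<close>

lemma fourier_equation:
  assumes \<phi>: "test_fun \<phi>"
  shows "AE \<xi> in lborel. (\<Sum>a | c a \<noteq> 0. c a * (- 1) ^ snd a * monomial (fst a) \<xi> * u ((der ^^ snd a) \<phi>) \<xi>) = 0"
proof (rule tens_fourier_separating)
  fix F :: "real^'d \<Rightarrow> real \<Rightarrow> complex"
  assume F: "\<And>b. b \<in> Basis \<Longrightarrow> test_fun (F b)"
  let ?S = "{a. c a \<noteq> 0}"
  let ?K = "complex_of_real ((2 * pi) powr (- real CARD('d)))"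
  define F' where "F' \<alpha> b = (der ^^ \<alpha> (axis_index b)) (F b)" for \<alpha> b
  define w where "w a = c a * (- 1) ^ (sum (fst a) UNIV + snd a)" for a
  have F': "test_fun (F' \<alpha> b)" if "b \<in> Basis" for \<alpha> b
    unfolding F'_def by (intro test_fun_der_iter F that)
  have \<phi>': "test_fun ((der ^^ j) \<phi>)" for j by (intro test_fun_der_iter \<phi>)
  have ft: "tens (\<lambda>b. fourier (F' \<alpha> b)) \<xi>
      = (- 1) ^ sum \<alpha> UNIV * (monomial \<alpha> \<xi> * tens (\<lambda>b. fourier (F b)) \<xi>)" for \<alpha> \<xi>
  proof -
    have "tens (\<lambda>b. fourier (F' \<alpha> b)) \<xi>
        = (\<Prod>b\<in>Basis. (- 1) ^ \<alpha> (axis_index b) * (\<i> * of_real (\<xi> \<bullet> b)) ^ \<alpha> (axis_index b) * fourier (F b) (\<xi> \<bullet> b))"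
      unfolding tens_def F'_def
      by (intro prod.cong refl) (simp add: fourier_der_iter[OF F] power_mult_distrib[symmetric])
    also have "\<dots> = (\<Prod>b\<in>Basis. (- 1) ^ \<alpha> (axis_index b)) * (\<Prod>b\<in>Basis. (\<i> * of_real (\<xi> \<bullet> b)) ^ \<alpha> (axis_index b))
        * tens (\<lambda>b. fourier (F b)) \<xi>"
      by (simp add: prod.distrib tens_def)
    also have "(\<Prod>b\<in>(Basis :: (real^'d) set). (- 1 :: complex) ^ \<alpha> (axis_index b)) = (- 1) ^ sum \<alpha> UNIV"
      by (simp add: prod_Basis_vec power_sum)
    also have "(\<Prod>b\<in>Basis. (\<i> * of_real (\<xi> \<bullet> b)) ^ \<alpha> (axis_index b)) = monomial \<alpha> \<xi>"
      by (simp add: prod_Basis_vec monomial_def inner_axis)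
    finally show ?thesis by (simp add: mult.assoc)
  qed
  have "transp_op c (tens (tens_time \<phi> F)) = (\<lambda>p. \<Sum>a\<in>?S. w a * tens (tens_time ((der ^^ snd a) \<phi>) (F' (fst a))) p)"
    unfolding transp_op_def w_def F'_def
    by (intro ext sum.cong refl) (simp add: pder_tens test_fun_smooth \<phi> F)
  then have "0 = U (\<lambda>p. \<Sum>a\<in>?S. w a * tens (tens_time ((der ^^ snd a) \<phi>) (F' (fst a))) p)"
    using U_solves[OF test_fun_tens_time[where F = F, OF \<phi> F]] by simp
  also have "\<dots> = (\<Sum>a\<in>?S. w a * U (tens (tens_time ((der ^^ snd a) \<phi>) (F' (fst a)))))"
    by (intro distribution_sum(1) U finite_coeffs test_fun_tens_time \<phi>' F')
  also have "\<dots> = ?K * (\<Sum>a\<in>?S. w a * (\<integral>\<xi>. u ((der ^^ snd a) \<phi>) \<xi> * tens (\<lambda>b. fourier (F' (fst a) b)) \<xi> \<partial>lborel))"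
    unfolding sum_distrib_left by (intro sum.cong refl) (simp add: U_tens[OF \<phi>' F'])
  finally have z: "(\<Sum>a\<in>?S. w a * (\<integral>\<xi>. u ((der ^^ snd a) \<phi>) \<xi> * tens (\<lambda>b. fourier (F' (fst a) b)) \<xi> \<partial>lborel)) = 0"
    by simp
  have eq: "(\<Sum>a\<in>?S. c a * (- 1) ^ snd a * monomial (fst a) \<xi> * u ((der ^^ snd a) \<phi>) \<xi>) * tens (\<lambda>b. fourier (F b)) \<xi>
      = (\<Sum>a\<in>?S. w a * (u ((der ^^ snd a) \<phi>) \<xi> * tens (\<lambda>b. fourier (F' (fst a) b)) \<xi>))" for \<xi>
  proof -
    have "(- 1 :: complex) ^ n * (- 1) ^ n = 1" for n by (simp add: power_mult_distrib[symmetric])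
    then have sq: "(- 1 :: complex) ^ n * ((- 1) ^ n * z) = z" for n z by (simp add: mult.assoc[symmetric])
    show ?thesis
      unfolding sum_distrib_right ft w_def power_add
      by (intro sum.cong refl) (simp add: mult_ac sq)
  qed
  have i: "integrable lborel (\<lambda>\<xi>. u ((der ^^ snd a) \<phi>) \<xi> * tens (\<lambda>b. fourier (F' (fst a) b)) \<xi>)" for a
    by (intro integrable_u \<phi>' F')
  show "integrable lborel (\<lambda>\<xi>. (\<Sum>a\<in>?S. c a * (- 1) ^ snd a * monomial (fst a) \<xi> * u ((der ^^ snd a) \<phi>) \<xi>)
        * tens (\<lambda>b. fourier (F b)) \<xi>) \<and>
      (\<integral>\<xi>. (\<Sum>a\<in>?S. c a * (- 1) ^ snd a * monomial (fst a) \<xi> * u ((der ^^ snd a) \<phi>) \<xi>)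
        * tens (\<lambda>b. fourier (F b)) \<xi> \<partial>lborel) = 0"
    unfolding eq using z i by (simp add: integral_sum)
qed

text \<open>All cut-off primitives are supported in the one interval {-2..b}, so continuity of u
  supplies a single constant and a single order M. Starting from the M-th primitive, M derivatives
  still leave at least n integrations, hence the factorial of n.\<close>

lemma u_primitives_decay:
  assumes \<eta>: "smooth_fun \<eta>" "\<And>t. - 1 \<le> t \<Longrightarrow> \<eta> t = 1" "\<And>t. t \<le> - 2 \<Longrightarrow> \<eta> t = 0"
    and \<phi>: "test_fun \<phi>" "\<And>t. b \<le> t \<Longrightarrow> \<phi> t = 0"
    and W: "\<And>f B. f \<in> borel_measurable borel \<Longrightarrow> besov_le k r f B \<Longrightarrow> (\<integral>\<xi>. weight N \<xi> * cmod (f \<xi>) \<partial>lborel) \<le> D * B"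
  obtains C x M where "\<And>n. (\<integral>\<xi>. weight N \<xi> * cmod (u (\<lambda>t. \<eta> t * (tail_primitive b ^^ (n + M)) \<phi> t) \<xi>) \<partial>lborel) \<le> C * x ^ n / fact n"
proof -
  let ?J = "\<lambda>n. (tail_primitive b ^^ n) \<phi>"
  let ?g = "\<lambda>n t. \<eta> t * ?J n t"
  have sm: "smooth_fun \<phi>" using \<phi>(1) by (rule test_fun_smooth)
  have Jsm: "smooth_fun (?J n)" for n by (rule smooth_tail_primitive_iter[OF sm])
  have J0: "?J n t = 0" if "b \<le> t" for n t by (rule tail_primitive_iter_vanishes[OF sm \<phi>(2) that])
  have supp: "- 2 \<le> t \<and> t \<le> b" if "?g n t \<noteq> 0" for n t
    using that \<eta>(3)[of t] J0[of t n] by (cases "t \<le> - 2"; cases "b \<le> t") auto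
  have gt: "test_fun (?g n)" for n
    using supp by (intro test_funI smooth_mult \<eta>(1) Jsm)
  have tsupp_g: "tsupp (?g n) \<subseteq> {-2..b}" for n
  proof (rule tsupp_subset)
    show "t \<in> {-2..b}" if "?g n t \<noteq> 0" for t using supp[OF that] by simp
  qed simp
  obtain E M where E: "\<And>\<theta>. test_fun \<theta> \<Longrightarrow> tsupp \<theta> \<subseteq> {-2..b} \<Longrightarrow> besov_le k r (u \<theta>) (E * seminorm_m M \<theta>)"
    using LDB compact_Icc[of "-2" b] unfolding LDB_def by metis
  have bl: "besov_le k r (u (?g n)) (E * seminorm_m M (?g n))" for n
    by (rule E[OF gt tsupp_g])
  obtain A where A: "\<And>i t. i \<le> M \<Longrightarrow> - 2 \<le> t \<Longrightarrow> t \<le> b \<Longrightarrow> norm ((der ^^ i) \<eta> t) \<le> A"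
    using der_iter_bounded_on_compact[OF \<eta>(1)] by blast
  obtain A\<^sub>0 where A0: "\<And>t. norm (\<phi> t) \<le> A\<^sub>0"
  proof -
    obtain R where R: "\<And>t. R \<le> \<bar>t\<bar> \<Longrightarrow> \<phi> t = 0" using test_fun_bounded_support[OF \<phi>(1)] by blast
    obtain A\<^sub>0 where A0: "\<And>i t. i \<le> 0 \<Longrightarrow> - R \<le> t \<Longrightarrow> t \<le> R \<Longrightarrow> norm ((der ^^ i) \<phi> t) \<le> A\<^sub>0"
      using der_iter_bounded_on_compact[OF sm] by blast
    have "norm (\<phi> t) \<le> max 0 A\<^sub>0" for t
      using A0[of 0 t] R[of t] by (cases "R \<le> \<bar>t\<bar>") (auto simp: abs_less_iff not_le)
    then show ?thesis by (rule that)
  qed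
  have A0': "0 \<le> A\<^sub>0" using A0[of 0] norm_ge_zero order_trans by blast
  \<comment> \<open>On the interval b - t \<le> b + 2; the maximum with 1 makes powers of L
    nondecreasing in the exponent.\<close>
  define L where "L = max 1 (b + 2)"
  have L: "1 \<le> L" by (simp add: L_def)
  have Jb: "norm ((der ^^ i) (?J (n + M)) t) \<le> A\<^sub>0 * L ^ (n + M) / fact n"
    if "i \<le> M" "- 2 \<le> t" "t \<le> b" for i n t
  proof -
    define m where "m = n + M - i"
    have m: "n \<le> m" "m \<le> n + M" using that by (auto simp: m_def)
    have "(der ^^ i) (?J (n + M)) t = ?J m t"
      using that unfolding m_def by (subst der_tail_primitive_iter[OF sm]) auto
    also have "norm \<dots> \<le> A\<^sub>0 * (b - t) ^ m / fact m"
      by (rule tail_primitive_iter_bound[OF sm \<phi>(2) A0 that(3)])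
    also have "\<dots> \<le> A\<^sub>0 * L ^ (n + M) / fact n"
    proof (intro frac_le mult_left_mono A0')
      have "(b - t) ^ m \<le> L ^ m" using that by (intro power_mono) (auto simp: L_def)
      also have "\<dots> \<le> L ^ (n + M)" using L m by (intro power_increasing) auto
      finally show "(b - t) ^ m \<le> L ^ (n + M)" .
      show "fact n \<le> (fact m :: real)" using m by (intro fact_mono) auto
    qed (use A0' L in auto)
    finally show ?thesis .
  qed
  have gb: "norm ((der ^^ i) (?g (n + M)) t) \<le> 2 ^ M * (\<bar>A\<bar> * (A\<^sub>0 * L ^ (n + M) / fact n))"
    if i: "i \<le> M" for i n t
  proof -
    let ?B = "\<bar>A\<bar> * (A\<^sub>0 * L ^ (n + M) / fact n)"
    have B0: "0 \<le> ?B" using A0' L by auto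
    show ?thesis
    proof (cases "- 2 \<le> t \<and> t \<le> b")
      case True
      have "norm ((der ^^ i) (?g (n + M)) t) \<le> 2 ^ i * ?B"
      proof (rule der_iter_mult_bound[OF \<eta>(1) Jsm])
        show "norm ((der ^^ l) \<eta> t) \<le> \<bar>A\<bar>" if "l \<le> i" for l
          using A[of l t] that i True by linarith
        show "norm ((der ^^ l) (?J (n + M)) t) \<le> A\<^sub>0 * L ^ (n + M) / fact n" if "l \<le> i" for l
          using Jb[of l t n] that i True by auto
      qed
      also have "\<dots> \<le> 2 ^ M * ?B" using B0 i by (intro mult_right_mono power_increasing) auto
      finally show ?thesis .
    next
      case False
      have "tsupp ((der ^^ i) (?g (n + M))) \<subseteq> {-2..b}"
        using tsupp_der_iter[of i "?g (n + M)"] tsupp_g[of "n + M"]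
        by (rule order_trans)
      then have "(der ^^ i) (?g (n + M)) t = 0" using False by (intro not_in_tsupp) auto
      then show ?thesis using mult_nonneg_nonneg[OF _ B0, of "2 ^ M"] by (simp only: norm_zero) simp
    qed
  qed
  have sn0: "0 \<le> seminorm_m M (?g (n + M))" for n
    by (rule seminorm_real_bounds(1)[where B = "2 ^ M * (\<bar>A\<bar> * (A\<^sub>0 * L ^ (n + M) / fact n))"]) (rule gb)
  have sn: "seminorm_m M (?g (n + M)) \<le> 2 ^ M * (\<bar>A\<bar> * (A\<^sub>0 * L ^ (n + M) / fact n))" for n
    by (rule seminorm_real_bounds(2)) (rule gb)
  show ?thesis
  proof (rule that[of M "\<bar>D\<bar> * \<bar>E\<bar> * 2 ^ M * \<bar>A\<bar> * A\<^sub>0 * L ^ M" L])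
    fix n
    have "(\<integral>\<xi>. weight N \<xi> * cmod (u (?g (n + M)) \<xi>) \<partial>lborel) \<le> D * (E * seminorm_m M (?g (n + M)))"
      by (rule W[OF measurable_u[OF gt] bl])
    also have "\<dots> \<le> \<bar>D\<bar> * (\<bar>E\<bar> * (2 ^ M * (\<bar>A\<bar> * (A\<^sub>0 * L ^ (n + M) / fact n))))"
    proof (rule mult_mono[OF abs_ge_self])
      show "E * seminorm_m M (?g (n + M)) \<le> \<bar>E\<bar> * (2 ^ M * (\<bar>A\<bar> * (A\<^sub>0 * L ^ (n + M) / fact n)))"
        by (intro mult_mono abs_ge_self sn sn0 abs_ge_zero)
      show "0 \<le> E * seminorm_m M (?g (n + M))" using bl[of "n + M"] unfolding besov_le_def by blast
    qed simp
    also have "\<dots> = \<bar>D\<bar> * \<bar>E\<bar> * 2 ^ M * \<bar>A\<bar> * A\<^sub>0 * L ^ M * L ^ n / fact n"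
      by (simp add: power_add)
    finally show "(\<integral>\<xi>. weight N \<xi> * cmod (u (?g (n + M)) \<xi>) \<partial>lborel)
        \<le> \<bar>D\<bar> * \<bar>E\<bar> * 2 ^ M * \<bar>A\<bar> * A\<^sub>0 * L ^ M * L ^ n / fact n" .
  qed
qed

lemma u_eq_0:
  assumes c: "\<exists>a. c a \<noteq> 0" and \<phi>: "test_fun \<phi>"
  shows "AE \<xi> in lborel. u \<phi> \<xi> = 0"
proof -
  let ?S = "{a. c a \<noteq> 0}"
  define m where "m = Max (snd ` ?S)"
  have "m \<in> snd ` ?S" unfolding m_def using c finite_coeffs by (intro Max_in) auto
  then obtain a\<^sub>0 where a0: "c a\<^sub>0 \<noteq> 0" "snd a\<^sub>0 = m" by auto
  have le_m: "snd a \<le> m" if "c a \<noteq> 0" for a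
    unfolding m_def using that finite_coeffs by (intro Max_ge) auto
  \<comment> \<open>The terms of lower order in time, whose shifts m - snd a are positive. For m = 0
    the set is empty, and the recursion below makes \<open>v n\<close> vanish at once wherever p is
    nonzero.\<close>
  define T where "T = {a \<in> ?S. snd a < m}"
  have T: "finite T" "\<And>a. a \<in> T \<Longrightarrow> 0 < m - snd a" using finite_coeffs by (auto simp: T_def)
  define p where "p \<xi> = (\<Sum>a\<in>{a \<in> ?S. snd a = m}. c a * monomial (fst a) \<xi>)" for \<xi>
  have [measurable]: "p \<in> borel_measurable borel" unfolding p_def[abs_def] by measurable
  have p_nz: "AE \<xi> in lborel. p \<xi> \<noteq> 0"
  proof -
    let ?A = "{\<alpha>. c (\<alpha>, m) \<noteq> 0}"
    have A: "{a \<in> ?S. snd a = m} = (\<lambda>\<alpha>. (\<alpha>, m)) ` ?A" by auto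
    have "finite ?A"
      using finite_vimageI[OF finite_coeffs, of "\<lambda>\<alpha>. (\<alpha>, m)"] by (simp add: inj_on_def vimage_def)
    moreover have "fst a\<^sub>0 \<in> ?A" using a0 by auto
    ultimately have "AE \<xi> in lborel. (\<Sum>\<alpha>\<in>?A. c (\<alpha>, m) * monomial \<alpha> \<xi>) \<noteq> 0"
      by (intro AE_polynomial_nonzero) auto
    moreover have "p \<xi> = (\<Sum>\<alpha>\<in>?A. c (\<alpha>, m) * monomial \<alpha> \<xi>)" for \<xi>
      unfolding p_def A by (subst sum.reindex) (auto simp: inj_on_def)
    ultimately show ?thesis by simp
  qed
  obtain \<eta> :: "real \<Rightarrow> complex" where \<eta>: "smooth_fun \<eta>" "\<And>t. - 1 \<le> t \<Longrightarrow> \<eta> t = 1"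
    "\<And>t. t \<le> - 2 \<Longrightarrow> \<eta> t = 0" using cutoff_exists by blast
  obtain b where b: "\<And>t. b \<le> t \<Longrightarrow> \<phi> t = 0"
  proof -
    obtain R where "\<And>t. R \<le> \<bar>t\<bar> \<Longrightarrow> \<phi> t = 0" using test_fun_bounded_support[OF \<phi>] by blast
    then show ?thesis by (intro that[of "\<bar>R\<bar>"]) auto
  qed
  let ?J = "\<lambda>n. (tail_primitive b ^^ n) \<phi>"
  define g where "g n = (\<lambda>t. \<eta> t * ?J n t)" for n
  define v where "v n = u (g n)" for n
  have sm: "smooth_fun \<phi>" using \<phi> by (rule test_fun_smooth)
  have g: "test_fun (g n)" for n
    unfolding g_def
  proof (rule test_funI[of _ "- 2" b])
    show "smooth_fun (\<lambda>t. \<eta> t * ?J n t)" by (intro smooth_mult \<eta>(1) smooth_tail_primitive_iter sm)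
    show "- 2 \<le> t \<and> t \<le> b" if "\<eta> t * ?J n t \<noteq> 0" for t
      using that \<eta>(3)[of t] tail_primitive_iter_vanishes[OF sm b, of b t n]
      by (cases "t \<le> - 2"; cases "b \<le> t") auto
  qed
  have [measurable]: "v n \<in> borel_measurable borel" for n
    unfolding v_def by (rule measurable_u[OF g])
  \<comment> \<open>Right of -1 the cut-off equals 1, so derivatives undo integrations there; the
    discrepancy further left is invisible to u.\<close>
  have der_g: "AE \<xi> in lborel. u ((der ^^ j) (g n)) \<xi> = v (n - j) \<xi>" if "j \<le> n" for n j
    unfolding v_def
  proof (rule u_cong_future[OF test_fun_der_iter[OF g] g])
    fix t :: real assume t: "- 1 < t"
    have "(der ^^ j) (g n) t = (der ^^ j) (?J n) t"
      by (rule der_iter_cong_open[of "{-1<..}"]) (use t \<eta>(2) in \<open>auto simp: g_def\<close>)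
    also have "\<dots> = ?J (n - j) t" using that by (subst der_tail_primitive_iter[OF sm]) auto
    also have "\<dots> = g (n - j) t" using t \<eta>(2) by (simp add: g_def)
    finally show "(der ^^ j) (g n) t = g (n - j) t" .
  qed
  \<comment> \<open>The equation is applied to \<open>g (n + m)\<close>: its top order in time gives
    \<open>v n\<close>, and order j gives \<open>v (n + (m - j))\<close>, so \<open>v n\<close> is
    controlled by later members only.\<close>
  have rec: "AE \<xi> in lborel. cmod (p \<xi>) * cmod (v n \<xi>)
      \<le> (\<Sum>a\<in>T. cmod (c a * monomial (fst a) \<xi>) * cmod (v (n + (m - snd a)) \<xi>))" for n
  proof -
    have "AE \<xi> in lborel. \<forall>a\<in>?S. u ((der ^^ snd a) (g (n + m))) \<xi> = v (n + m - snd a) \<xi>"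
      using finite_coeffs le_m by (intro AE_finite_allI der_g) (auto simp: trans_le_add2)
    then show ?thesis using fourier_equation[OF g, of "n + m"]
    proof eventually_elim
      case (elim \<xi>)
      let ?t = "\<lambda>a. c a * (- 1) ^ snd a * monomial (fst a) \<xi> * v (n + m - snd a) \<xi>"
      have "(\<Sum>a\<in>?S. ?t a)
          = (\<Sum>a\<in>?S. c a * (- 1) ^ snd a * monomial (fst a) \<xi> * u ((der ^^ snd a) (g (n + m))) \<xi>)"
        by (intro sum.cong) (use elim(1) in auto)
      then have "0 = (\<Sum>a\<in>?S. ?t a)" using elim(2) by simp
      also have "?S = {a \<in> ?S. snd a = m} \<union> T" using le_m by (auto simp: T_def le_less)
      also have "sum ?t \<dots> = sum ?t {a \<in> ?S. snd a = m} + sum ?t T"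
        using finite_coeffs by (intro sum.union_disjoint) (auto simp: T_def)
      also have "sum ?t {a \<in> ?S. snd a = m} = (- 1) ^ m * (p \<xi> * v n \<xi>)"
        unfolding p_def sum_distrib_right sum_distrib_left by (intro sum.cong refl) auto
      finally have "(- 1) ^ m * (p \<xi> * v n \<xi>) = - sum ?t T" by (simp add: eq_neg_iff_add_eq_0)
      then have "cmod ((- 1) ^ m * (p \<xi> * v n \<xi>)) = cmod (sum ?t T)" by simp
      then have "cmod (p \<xi>) * cmod (v n \<xi>) = cmod (sum ?t T)" by (simp add: norm_mult norm_power)
      also have "\<dots> \<le> (\<Sum>a\<in>T. cmod (?t a))" by (rule norm_sum)
      also have "\<dots> = (\<Sum>a\<in>T. cmod (c a * monomial (fst a) \<xi>) * cmod (v (n + (m - snd a)) \<xi>))"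
        by (intro sum.cong refl) (auto simp: T_def norm_mult norm_power)
      finally show ?case .
    qed
  qed
  obtain D N where W: "\<And>f B. f \<in> borel_measurable borel \<Longrightarrow> besov_le k r f B \<Longrightarrow>
      integrable lborel (\<lambda>\<xi>. weight N \<xi> * cmod (f \<xi>)) \<and> (\<integral>\<xi>. weight N \<xi> * cmod (f \<xi>) \<partial>lborel) \<le> D * B"
    by (rule besov_weighted_L1[OF temperate r]) (rule that)
  have int: "integrable lborel (\<lambda>\<xi>. weight N \<xi> * cmod (v n \<xi>))" for n
  proof -
    obtain B where "besov_le k r (u (g n)) B" using in_besov[OF g[of n]] unfolding in_besov_def by blast
    from W[OF measurable_u[OF g] this] show ?thesis unfolding v_def by blast
  qed
  obtain C x M where dec: "\<And>n. (\<integral>\<xi>. weight N \<xi> * cmod (v (n + M) \<xi>) \<partial>lborel) \<le> C * x ^ n / fact n"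
    by (rule u_primitives_decay[OF \<eta> \<phi> b conjunct2[OF W]]) (auto simp: v_def g_def intro: that)
  \<comment> \<open>E does not depend on n, so one constant Q serves every step, and the weighted
    integrals over E satisfy the recursion of \<open>superexponential_decay_zero\<close>.\<close>
  have zero: "AE \<xi> in lborel. \<xi> \<in> E \<longrightarrow> v 0 \<xi> = 0"
    if E: "E = {\<xi>. p \<xi> \<noteq> 0 \<and> (\<forall>a\<in>T. cmod (c a * monomial (fst a) \<xi>) \<le> real Q * cmod (p \<xi>))}" for E Q
  proof -
    have [measurable]: "E \<in> sets borel" unfolding E using T(1) by measurable
    let ?b = "\<lambda>n \<xi>. indicator E \<xi> * (weight N \<xi> * cmod (v n \<xi>))"
    have ib: "integrable lborel (?b n)" for n
      using integrable_mult_indicator[OF _ int[of n], of E] by simp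
    have b0: "0 \<le> ?b n \<xi>" for n \<xi> using weight_pos[of N \<xi>] by (auto simp: indicator_def)
    have "integral\<^sup>L lborel (?b 0) \<le> 0"
    proof (rule superexponential_decay_zero[where S = T and s = "\<lambda>a. m - snd a" and Q = "real Q"])
      fix n
      have "AE \<xi> in lborel. ?b n \<xi> \<le> real Q * (\<Sum>a\<in>T. ?b (n + (m - snd a)) \<xi>)"
        using rec[of n]
      proof eventually_elim
        case (elim \<xi>)
        show ?case
        proof (cases "\<xi> \<in> E")
          case True
          then have p: "0 < cmod (p \<xi>)" by (simp add: E)
          have "cmod (p \<xi>) * cmod (v n \<xi>)
              \<le> (\<Sum>a\<in>T. (real Q * cmod (p \<xi>)) * cmod (v (n + (m - snd a)) \<xi>))"
            using True by (intro order_trans[OF elim] sum_mono mult_right_mono) (auto simp: E)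
          also have "\<dots> = cmod (p \<xi>) * (real Q * (\<Sum>a\<in>T. cmod (v (n + (m - snd a)) \<xi>)))"
            by (simp add: sum_distrib_left mult_ac)
          finally have "cmod (v n \<xi>) \<le> real Q * (\<Sum>a\<in>T. cmod (v (n + (m - snd a)) \<xi>))"
            using p by simp
          then have "weight N \<xi> * cmod (v n \<xi>)
              \<le> weight N \<xi> * (real Q * (\<Sum>a\<in>T. cmod (v (n + (m - snd a)) \<xi>)))"
            using weight_pos[of N \<xi>] by (intro mult_left_mono) auto
          then show ?thesis using True by (simp add: sum_distrib_left mult_ac)
        qed simp
      qed
      then have "integral\<^sup>L lborel (?b n) \<le> (\<integral>\<xi>. real Q * (\<Sum>a\<in>T. ?b (n + (m - snd a)) \<xi>) \<partial>lborel)"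
        using ib by (intro integral_mono_AE) auto
      also have "\<dots> = real Q * (\<Sum>a\<in>T. integral\<^sup>L lborel (?b (n + (m - snd a))))"
        using ib by (simp add: integral_sum)
      finally show "integral\<^sup>L lborel (?b n) \<le> real Q * (\<Sum>a\<in>T. integral\<^sup>L lborel (?b (n + (m - snd a))))" .
      have "integral\<^sup>L lborel (?b (n + M)) \<le> (\<integral>\<xi>. weight N \<xi> * cmod (v (n + M) \<xi>) \<partial>lborel)"
        using weight_pos[of N] by (intro integral_mono ib int) (auto simp: indicator_def intro!: mult_nonneg_nonneg less_imp_le[OF weight_pos])
      then show "integral\<^sup>L lborel (?b (n + M)) \<le> C * x ^ n / fact n" using dec[of n] by linarith
    qed (use T in auto)
    moreover have "0 \<le> integral\<^sup>L lborel (?b 0)" by (intro integral_nonneg_AE AE_I2 b0)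
    ultimately have "AE \<xi> in lborel. ?b 0 \<xi> = 0"
      using integral_nonneg_eq_0_iff_AE[OF ib AE_I2[OF b0]] by simp
    then show ?thesis
    proof eventually_elim
      case (elim \<xi>)
      then show ?case using weight_pos[of N \<xi>] by auto
    qed
  qed
  \<comment> \<open>Q runs through the natural numbers, so only countably many null sets are
    joined.\<close>
  have "AE \<xi> in lborel. \<forall>Q. \<xi> \<in> {\<xi>. p \<xi> \<noteq> 0 \<and> (\<forall>a\<in>T. cmod (c a * monomial (fst a) \<xi>) \<le> real Q * cmod (p \<xi>))}
      \<longrightarrow> v 0 \<xi> = 0"
    unfolding AE_all_countable using zero by blast
  moreover have "AE \<xi> in lborel. u \<phi> \<xi> = v 0 \<xi>"
    unfolding v_def by (rule u_cong_future[OF \<phi> g]) (simp add: g_def \<eta>(2))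
  ultimately show ?thesis using p_nz
  proof eventually_elim
    case (elim \<xi>)
    obtain Q where Q: "(\<Sum>a\<in>T. cmod (c a * monomial (fst a) \<xi>)) / cmod (p \<xi>) \<le> real Q"
      using real_arch_simple by blast
    have "cmod (c a * monomial (fst a) \<xi>) \<le> real Q * cmod (p \<xi>)" if "a \<in> T" for a
    proof -
      have "cmod (c a * monomial (fst a) \<xi>) \<le> (\<Sum>a\<in>T. cmod (c a * monomial (fst a) \<xi>))"
        using T(1) that by (intro member_le_sum) auto
      also have "\<dots> \<le> real Q * cmod (p \<xi>)" using Q elim(3) by (simp add: pos_divide_le_eq)
      finally show ?thesis .
    qed
    then have "\<xi> \<in> {\<xi>. p \<xi> \<noteq> 0 \<and> (\<forall>a\<in>T. cmod (c a * monomial (fst a) \<xi>) \<le> real Q * cmod (p \<xi>))}"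
      using elim(3) by simp
    then have "v 0 \<xi> = 0" using elim(1) by (elim allE[of _ Q] impE)
    then show ?case using elim(2) by simp
  qed
qed

end

subsection \<open>The zero operator\<close>


lemma test_fun_continuous:
  fixes f :: "'a::euclidean_space \<Rightarrow> complex"
  assumes "test_fun f"
  shows "continuous_on A f"
proof -
  have "f differentiable (at x)" for x
    using assms unfolding test_fun_def smooth_fun_def
    by (metis dd.simps(1) empty_subsetI list.set(1))
  then show ?thesis
    by (intro continuous_at_imp_continuous_on) (auto intro: differentiable_imp_continuous_within)
qed

text \<open>Compact support bounds f, which makes the family in the supremum bounded above.\<close>

lemma norm_le_seminorm:
  fixes f :: "'a::euclidean_space \<Rightarrow> complex"
  assumes "test_fun f"
  shows "norm (f x) \<le> seminorm_m 0 f"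
proof -
  let ?I = "{(vs :: 'a list, x :: 'a). set vs \<subseteq> Basis \<and> length vs \<le> 0}"
  have "compact (f ` tsupp f)"
    using assms by (intro compact_continuous_image test_fun_continuous) (auto simp: test_fun_def)
  from compact_imp_bounded[OF this] obtain B where B: "\<forall>x\<in>tsupp f. norm (f x) \<le> B"
    by (auto simp: bounded_iff)
  have B': "norm (f x) \<le> max 0 B" for x
    using B not_in_tsupp[of x f] by (cases "x \<in> tsupp f") auto
  let ?h = "\<lambda>p. norm (dd (fst p) f (snd p))"
  have I: "([], x) \<in> ?I" by simp
  have "?h p \<le> max 0 B" if "p \<in> ?I" for p using that B' by auto
  then have "bdd_above (?h ` ?I)" by (rule bdd_aboveI2)
  from cSUP_upper[OF I this] have "?h ([], x) \<le> seminorm_m 0 f" unfolding seminorm_m_def .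
  then show ?thesis by simp
qed

text \<open>Every slice lives on the spatial projection of K, a compact set whose finite measure
  serves all functions supported in K.\<close>

lemma test_fun_slice:
  fixes \<theta> :: "(real^'d::finite) \<times> real \<Rightarrow> complex"
  assumes "test_fun \<theta>" "tsupp \<theta> \<subseteq> K" "compact K"
  shows "integrable lborel (\<lambda>x. \<theta> (x, t))"
    and "(\<integral>x. norm (\<theta> (x, t)) \<partial>lborel) \<le> measure lborel (fst ` K) * seminorm_m 0 \<theta>"
proof -
  let ?K = "fst ` K"
  have K: "compact ?K" using assms(3) by (intro compact_continuous_image continuous_intros)
  have ind: "indicator ?K x *\<^sub>R \<theta> (x, t) = \<theta> (x, t)" for x
  proof (cases "x \<in> ?K")
    case False
    then have "(x, t) \<notin> tsupp \<theta>" using assms(2) by force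
    then show ?thesis by (simp add: not_in_tsupp)
  qed simp
  have "continuous_on ?K (\<lambda>x. \<theta> (x, t))"
    by (rule continuous_on_compose2[OF test_fun_continuous[OF assms(1), of UNIV]])
      (auto intro!: continuous_intros)
  from borel_integrable_compact[OF K this] show i: "integrable lborel (\<lambda>x. \<theta> (x, t))"
    by (simp add: ind)
  have "integrable lborel (\<lambda>x. indicator ?K x * seminorm_m 0 \<theta>)"
    using emeasure_compact_finite[OF K] K
    by (intro integrable_mult_left integrable_real_indicator) (auto simp: borel_compact)
  then have "(\<integral>x. norm (\<theta> (x, t)) \<partial>lborel) \<le> (\<integral>x. indicator ?K x * seminorm_m 0 \<theta> \<partial>lborel)"
  proof (rule integral_mono[OF integrable_norm[OF i]])
    fix x
    have "norm (\<theta> (x, t)) = indicator ?K x * norm (\<theta> (x, t))"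
      by (subst ind[symmetric]) simp
    also have "\<dots> \<le> indicator ?K x * seminorm_m 0 \<theta>"
      by (intro mult_left_mono norm_le_seminorm assms(1)) simp
    finally show "norm (\<theta> (x, t)) \<le> indicator ?K x * seminorm_m 0 \<theta>" .
  qed
  also have "\<dots> = measure lborel ?K * seminorm_m 0 \<theta>" using K by (simp add: borel_compact)
  finally show "(\<integral>x. norm (\<theta> (x, t)) \<partial>lborel) \<le> measure lborel ?K * seminorm_m 0 \<theta>" .
qed

text \<open>The unit cube has measure 1, so the pairing is bounded by the supremum of the transform,
  hence by the L1 norm; this will give continuity of the example distribution.\<close>

lemma besov_pair_cbox:
  fixes g h :: "real^'d::finite \<Rightarrow> complex"
  assumes g: "integrable lborel g" and h: "integrable lborel h"
  shows "besov_pair (indicator (cbox 0 One)) (\<lambda>x. a * g x + b * h x)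
      = a * besov_pair (indicator (cbox 0 One)) g + b * besov_pair (indicator (cbox 0 One)) h"
    and "norm (besov_pair (indicator (cbox 0 One)) g)
      \<le> (2 * pi) powr (- real CARD('d)) * (\<integral>x. norm (g x) \<partial>lborel)"
proof -
  let ?I = "indicator (cbox 0 One) :: real^'d \<Rightarrow> complex"
  let ?F = "\<lambda>g \<xi>. (\<integral>x. g x * cis (\<xi> \<bullet> x) \<partial>lborel) :: complex"
  have cb: "integrable lborel (indicator (cbox 0 One) :: real^'d \<Rightarrow> real)"
    "measure lborel (cbox 0 One :: (real^'d) set) = 1"
    by (intro integrable_real_indicator emeasure_lborel_cbox_finite) (simp_all add: measure_lborel_cbox_eq inner_diff_left)
  have F_le: "norm (?F g \<xi>) \<le> (\<integral>x. norm (g x) \<partial>lborel)" for g :: "real^'d \<Rightarrow> complex" and \<xi>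
    using integral_norm_bound[of lborel "\<lambda>x. g x * cis (\<xi> \<bullet> x)"] by (simp add: norm_mult)
  have le: "norm (?I \<xi> * ?F g \<xi>) \<le> indicator (cbox 0 One) \<xi> * (\<integral>x. norm (g x) \<partial>lborel)"
    for g :: "real^'d \<Rightarrow> complex" and \<xi>
    using F_le[of g \<xi>] by (auto simp: indicator_def)
  have int: "integrable lborel (\<lambda>\<xi>. ?I \<xi> * ?F g \<xi>)" if g: "integrable lborel g" for g :: "real^'d \<Rightarrow> complex"
  proof (rule Bochner_Integration.integrable_bound)
    show "integrable lborel (\<lambda>\<xi>::real^'d. indicator (cbox 0 One) \<xi> * (\<integral>x. norm (g x) \<partial>lborel))"
      by (intro integrable_mult_left cb)
    have [measurable]: "g \<in> borel_measurable borel" using g by simp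
    show "(\<lambda>\<xi>. ?I \<xi> * ?F g \<xi>) \<in> borel_measurable lborel" unfolding cis_conv_exp by measurable
    show "AE \<xi> in lborel. norm (?I \<xi> * ?F g \<xi>) \<le> norm (indicator (cbox 0 One) \<xi> * (\<integral>x. norm (g x) \<partial>lborel))"
      using le[of _ g] abs_ge_self order_trans unfolding real_norm_def by (intro AE_I2) blast
  qed
  have "?F (\<lambda>x. a * g x + b * h x) \<xi> = a * ?F g \<xi> + b * ?F h \<xi>" for \<xi>
  proof -
    have "integrable lborel (\<lambda>x. g x * cis (\<xi> \<bullet> x))" "integrable lborel (\<lambda>x. h x * cis (\<xi> \<bullet> x))"
      using g h by (auto intro!: integrable_mult_cis)
    then show ?thesis by (simp add: distrib_right mult.assoc)
  qed
  then have "(\<integral>\<xi>. ?I \<xi> * ?F (\<lambda>x. a * g x + b * h x) \<xi> \<partial>lborel)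
      = (\<integral>\<xi>. a * (?I \<xi> * ?F g \<xi>) + b * (?I \<xi> * ?F h \<xi>) \<partial>lborel)"
    by (simp add: algebra_simps)
  also have "\<dots> = a * (\<integral>\<xi>. ?I \<xi> * ?F g \<xi> \<partial>lborel) + b * (\<integral>\<xi>. ?I \<xi> * ?F h \<xi> \<partial>lborel)"
    using int[OF g] int[OF h] by simp
  finally show "besov_pair ?I (\<lambda>x. a * g x + b * h x) = a * besov_pair ?I g + b * besov_pair ?I h"
    unfolding besov_pair_def by (simp add: algebra_simps)
  have "norm (\<integral>\<xi>. ?I \<xi> * ?F g \<xi> \<partial>lborel) \<le> (\<integral>\<xi>. norm (?I \<xi> * ?F g \<xi>) \<partial>lborel)"
    by (rule integral_norm_bound)
  also have "\<dots> \<le> (\<integral>\<xi>. indicator (cbox 0 One) (\<xi> :: real^'d) * (\<integral>x. norm (g x) \<partial>lborel) \<partial>lborel)"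
    using int[OF g] cb le by (intro integral_mono integrable_norm integrable_mult_left) auto
  also have "\<dots> = (\<integral>x. norm (g x) \<partial>lborel)"
    by (simp add: cb(2))
  finally show "norm (besov_pair ?I g) \<le> (2 * pi) powr (- real CARD('d)) * (\<integral>x. norm (g x) \<partial>lborel)"
    unfolding besov_pair_def norm_mult by (intro mult_mono) auto
qed

text \<open>The temperate inequality at \<eta> = 0 compares k with \<open>k 0\<close> on a bounded
  set.\<close>

lemma temperate_weight_upper_bound:
  assumes "temperate_weight (k :: real^'d::finite \<Rightarrow> real)"
  obtains \<kappa> where "0 < \<kappa>" "\<And>\<xi>. \<xi> \<in> cbox 0 One \<Longrightarrow> k \<xi> \<le> \<kappa>"
proof -
  from assms obtain C N where k: "\<And>\<xi>. 0 < k \<xi>" and C: "C > 0" "N > 0"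
    and le: "\<And>\<xi> \<eta>. k (\<xi> + \<eta>) \<le> (1 + C * norm \<xi>) powr N * k \<eta>"
    unfolding temperate_weight_def by blast
  obtain R where R: "\<And>\<xi>. \<xi> \<in> cbox (0 :: real^'d) One \<Longrightarrow> norm \<xi> \<le> R"
    using bounded_cbox[of "0 :: real^'d" One] by (auto simp: bounded_iff)
  show ?thesis
  proof (rule that[of "(1 + C * \<bar>R\<bar>) powr N * k 0"])
    have "0 < 1 + C * \<bar>R\<bar>" using C by (intro add_pos_nonneg) auto
    then show "0 < (1 + C * \<bar>R\<bar>) powr N * k 0" using k[of 0] by simp
    fix \<xi> :: "real^'d" assume "\<xi> \<in> cbox 0 One"
    then have "(1 + C * norm \<xi>) powr N \<le> (1 + C * \<bar>R\<bar>) powr N"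
      using R[of \<xi>] C by (intro powr_mono2 add_left_mono mult_left_mono) auto
    then show "k \<xi> \<le> (1 + C * \<bar>R\<bar>) powr N * k 0"
      using le[of \<xi> 0] k[of 0] by (smt (verit) add_0_right mult_right_mono)
  qed
qed

lemma besov_le_cbox:
  fixes k :: "real^'d::finite \<Rightarrow> real"
  assumes \<kappa>: "0 < \<kappa>" "\<And>\<xi>. \<xi> \<in> cbox 0 One \<Longrightarrow> k \<xi> \<le> \<kappa>" and k: "\<And>\<xi>. 0 < k \<xi>" and r: "1 \<le> r"
  shows "besov_le k r (\<lambda>\<xi>. z * indicator (cbox 0 One) \<xi>) (\<kappa> * cmod z)"
proof -
  have pt: "k \<xi> * cmod (z * indicator (cbox 0 One) \<xi>) \<le> \<kappa> * cmod z * indicator (cbox 0 One) \<xi>" for \<xi>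
    using \<kappa>(2)[of \<xi>] by (auto simp: indicator_def intro: mult_right_mono)
  show ?thesis
  proof (cases "r = \<infinity>")
    case True
    have "k \<xi> * cmod (z * indicator (cbox 0 One) \<xi>) \<le> \<kappa> * cmod z" for \<xi>
      using pt[of \<xi>] \<kappa>(1) by (auto simp: indicator_def split: if_splits)
    then show ?thesis using True \<kappa>(1) by (simp add: besov_le_def)
  next
    case False
    define q where "q = real_of_ereal r"
    have q: "1 \<le> q" using r False by (cases r) (auto simp: q_def one_ereal_def)
    have "(\<integral>\<^sup>+ \<xi>. ennreal ((k \<xi> * cmod (z * indicator (cbox 0 One) \<xi>)) powr q) \<partial>lborel)
        \<le> (\<integral>\<^sup>+ \<xi>. ennreal ((\<kappa> * cmod z) powr q) * indicator (cbox 0 One) (\<xi> :: real^'d) \<partial>lborel)"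
    proof (rule nn_integral_mono)
      fix \<xi> :: "real^'d"
      show "ennreal ((k \<xi> * cmod (z * indicator (cbox 0 One) \<xi>)) powr q)
          \<le> ennreal ((\<kappa> * cmod z) powr q) * indicator (cbox 0 One) \<xi>"
      proof (cases "\<xi> \<in> cbox 0 One")
        case True
        then have "(k \<xi> * cmod (z * indicator (cbox 0 One) \<xi>)) powr q \<le> (\<kappa> * cmod z) powr q"
          using pt[of \<xi>] q k[of \<xi>] by (intro powr_mono2) auto
        then show ?thesis using True by (simp add: ennreal_leI)
      qed simp
    qed
    also have "\<dots> = ennreal ((\<kappa> * cmod z) powr q)"
      by (simp add: nn_integral_cmult_indicator emeasure_lborel_cbox_eq inner_diff_left)
    finally show ?thesis using False \<kappa>(1) by (simp add: besov_le_def q_def)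
  qed
qed

lemma nonzero_solution_of_zero_operator:
  fixes k :: "real^'d::finite \<Rightarrow> real"
  assumes tw: "temperate_weight k" and r: "1 \<le> r" and c: "\<And>a. c a = 0"
  shows "\<exists>u \<in> N_LDB k r c. \<not> is_zero_map u"
proof -
  let ?I = "indicator (cbox 0 One) :: real^'d \<Rightarrow> complex"
  \<comment> \<open>Evaluation at time 1 with values in multiples of a fixed element; time 1 is
    positive, so nothing is seen in the past. The matching U pairs the slice at t = 1.\<close>
  define u where "u \<phi> = (\<lambda>\<xi>. \<phi> 1 * ?I \<xi>)" for \<phi> :: "real \<Rightarrow> complex"
  define U where "U \<theta> = besov_pair ?I (\<lambda>x. \<theta> (x, 1))" for \<theta> :: "(real^'d) \<times> real \<Rightarrow> complex"
  let ?K = "(2 * pi) powr (- real CARD('d))"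
  obtain \<kappa> where \<kappa>: "0 < \<kappa>" "\<And>\<xi>. \<xi> \<in> cbox 0 One \<Longrightarrow> k \<xi> \<le> \<kappa>"
    using temperate_weight_upper_bound[OF tw] by blast
  have k: "\<And>\<xi>. 0 < k \<xi>" using tw by (simp add: temperate_weight_def)
  have bl: "besov_le k r (u \<phi>) (\<kappa> * seminorm_m 0 \<phi>)" if "test_fun \<phi>" for \<phi>
    unfolding u_def using norm_le_seminorm[OF that, of 1] \<kappa>(1)
    by (intro besov_le_mono[OF besov_le_cbox[OF \<kappa> k r] r]) auto
  have LDB: "LDB k r u"
    unfolding LDB_def
  proof (intro conjI allI impI)
    show "in_besov k r (u \<phi>)" if "test_fun \<phi>" for \<phi>
      using bl[OF that] unfolding in_besov_def by (auto simp: u_def)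
    show "AE \<xi> in lborel. u (\<lambda>t. a * \<phi> t + b * \<theta> t) \<xi> = a * u \<phi> \<xi> + b * u \<theta> \<xi>" for a b \<phi> \<theta>
      by (simp add: u_def algebra_simps)
    show "\<exists>C m. \<forall>\<phi>. test_fun \<phi> \<and> tsupp \<phi> \<subseteq> K \<longrightarrow> besov_le k r (u \<phi>) (C * seminorm_m m \<phi>)" for K
      using bl by blast
  qed
  have dist: "distribution U"
    unfolding distribution_def
  proof (intro conjI allI impI; (elim conjE)?)
    fix a b and f g :: "(real^'d) \<times> real \<Rightarrow> complex" assume "test_fun f" "test_fun g"
    then show "U (\<lambda>x. a * f x + b * g x) = a * U f + b * U g"
      unfolding U_def by (intro besov_pair_cbox(1) test_fun_slice(1)[OF _ order_refl]) (auto simp: test_fun_def)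
  next
    fix K :: "((real^'d) \<times> real) set" assume K: "compact K"
    have "norm (U f) \<le> ?K * measure lborel (fst ` K) * seminorm_m 0 f"
      if "test_fun f" "tsupp f \<subseteq> K" for f
    proof -
      note s = test_fun_slice[OF that K, of 1]
      have "norm (U f) \<le> ?K * (\<integral>x. norm (f (x, 1)) \<partial>lborel)"
        unfolding U_def by (rule besov_pair_cbox(2)[OF s(1) s(1)])
      also have "\<dots> \<le> ?K * (measure lborel (fst ` K) * seminorm_m 0 f)"
        by (intro mult_left_mono s(2)) simp
      finally show ?thesis by (simp add: mult.assoc)
    qed
    then show "\<exists>C m. \<forall>f. test_fun f \<and> tsupp f \<subseteq> K \<longrightarrow> norm (U f) \<le> C * seminorm_m m f" by blast
  qed
  have tensor: "U (\<lambda>(x, t). \<phi> t * \<psi> x) = besov_pair (u \<phi>) \<psi>" for \<phi> \<psi>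
    unfolding U_def u_def besov_pair_def by (simp add: mult.assoc mult.left_commute)
  have past: "U \<theta> = 0" if "tsupp \<theta> \<subseteq> {p. snd p < 0}" for \<theta>
  proof -
    have "\<theta> (x, 1) = 0" for x using that by (intro not_in_tsupp) auto
    then show ?thesis by (simp add: U_def besov_pair_def)
  qed
  have "U (transp_op c \<theta>) = 0" for \<theta> by (simp add: U_def besov_pair_def transp_op_def c)
  then have "u \<in> N_LDB k r c"
    unfolding N_LDB_def using LDB dist tensor past by blast
  moreover have "\<not> is_zero_map u"
  proof
    \<comment> \<open>This bump is centred at 1, where it takes the positive value
      \<open>bump 0\<close>.\<close>
    let ?\<phi> = "\<lambda>t. complex_of_real (bump (1 * t + - 1))"
    have "0 < bump 0" by (simp add: bump_pos_iff)
    assume "is_zero_map u"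
    then have "AE \<xi> in lborel. u ?\<phi> \<xi> = 0"
      unfolding is_zero_map_def using test_fun_bump[of 1 "-1"] by simp
    then have "AE \<xi> in lborel. \<xi> \<notin> cbox (0 :: real^'d) One"
      by eventually_elim (use \<open>0 < bump 0\<close> in \<open>auto simp: u_def indicator_def split: if_splits\<close>)
    then have "cbox (0 :: real^'d) One \<in> null_sets lborel" by (subst AE_iff_null_sets) auto
    then have "emeasure lborel (cbox (0 :: real^'d) One) = 0" by (rule null_setsD1)
    then show False by (simp add: emeasure_lborel_cbox_eq inner_diff_left)
  qed
  ultimately show ?thesis by blast
qed

lemma zero_in_N_LDB: "1 \<le> r \<Longrightarrow> (\<lambda>\<phi> \<xi>. 0) \<in> N_LDB k r c"
proof -
  assume r: "1 \<le> r"
  have z: "besov_le k r (\<lambda>\<xi>. 0) (0 * s)" for s by (simp add: besov_le_def)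
  have "LDB k r (\<lambda>\<phi> \<xi>. 0)"
    unfolding LDB_def in_besov_def using z by (auto intro!: exI[of _ 0])
  moreover have "distribution (\<lambda>\<theta>. 0)"
    unfolding distribution_def by (auto intro!: exI[of _ 0])
  ultimately show ?thesis
    unfolding N_LDB_def by (auto simp: besov_pair_def intro!: exI[of _ "\<lambda>\<theta>. 0"])
qed

text \<open>Values of u are functions determined only almost everywhere, so equality with the zero
  space is expressed by membership of the zero map together with \<open>is_zero_map\<close> for
  every member.\<close>

theorem theorem5p1:
  fixes k :: "real^'d::finite \<Rightarrow> real"
    and r :: ereal
    and c :: "('d \<Rightarrow> nat) \<times> nat \<Rightarrow> complex"
  assumes "temperate_weight k"
    and "1 \<le> r"
    and "poly_coeffs c"
  shows "((\<lambda>\<phi> \<xi>. 0) \<in> N_LDB k r c \<and> (\<forall>u \<in> N_LDB k r c. is_zero_map u))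
           \<longleftrightarrow> (\<exists>a. c a \<noteq> 0)"
proof
  assume "(\<lambda>\<phi> \<xi>. 0) \<in> N_LDB k r c \<and> (\<forall>u \<in> N_LDB k r c. is_zero_map u)"
  then show "\<exists>a. c a \<noteq> 0"
    using nonzero_solution_of_zero_operator[OF assms(1,2), of c] by blast
next
  assume c: "\<exists>a. c a \<noteq> 0"
  have "is_zero_map u" if u: "u \<in> N_LDB k r c" for u
  proof -
    from u have "\<exists>U. null_solution k r c u U"
      using assms unfolding N_LDB_def null_solution_def poly_coeffs_def by auto
    then show ?thesis
      unfolding is_zero_map_def using null_solution.u_eq_0 c by blast
  qed
  then show "(\<lambda>\<phi> \<xi>. 0) \<in> N_LDB k r c \<and> (\<forall>u \<in> N_LDB k r c. is_zero_map u)"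
    using zero_in_N_LDB[OF assms(2)] by blast
qed

end
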